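(* Let $T>0$, let $b:[0,T]\times\mathbb{R}^d\to\mathbb{R}^d$ be measurable, and suppose there are nonnegative $C_0,C_1\in L^1([0,T])$ such that for all $t\in[0,T]$ and $x,y\in\mathbb{R}^d$, $|b(t,x)|\le C_0(t)(1+|x|)$ and $(b(t,x)-b(t,y))\cdot(x-y)\ge -C_1(t)|x-y|^2$. Let $\sigma\in L^2([0,T],\mathbb{R}^{d\times m})$ (constant in the space variable), let $W:\Omega\times[0,T]\to\mathbb{R}^m$ be a standard Brownian motion on a probability space $(\Omega,\mathcal{F},\mathbb{P})$, and let $1\le p<\infty$. For every $s\in[0,T)$, with probability one, there exists a unique $\Phi_{\cdot,s}\in C([s,T],L^p_{\mathrm{loc}}(\mathbb{R}^d))\cap L^p_{\mathrm{loc}}(\mathbb{R}^d,C([s,T]))$ such that, for a.e. $x\in\mathbb{R}^d$, $$\Phi_{t,s}(x)=x+\int_s^tb(r,\Phi_{r,s}(x))\,dr+\int_s^t\sigma_r\,dW_r\qquad\text{for all }t\in[s,T].$$ If $(b^\varepsilon)_{\varepsilon>0}$ is an admissible regularization of $b$ and $\Phi^\varepsilon$ is the unique stochastic flow solving $d_t\Phi^\varepsilon_{t,s}(x)=b^\varepsilon(t,\Phi^\varepsilon_{t,s}(x))dt+\sigma_tdW_t$, $\Phi^\varepsilon_{s,s}(x)=x$, then, with probability one, as $\varepsilon\to0$, $\Phi^\varepsilon_{\cdot,s}$ converges to $\Phi_{\cdot,s}$ in $C([s,T],L^p_{\mathrm{loc}}(\mathbb{R}^d))$ and in $L^p_{\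mathrm{loc}}(\mathbb{R}^d,C([s,T]))$.
   Context: Admissible regularization: $(b^\varepsilon)_{\varepsilon>0}\subset L^1([0,T],C^{0,1}(\mathbb{R}^d))$ with $b^\varepsilon\to b$ a.e. as $\varepsilon\to0$ and each $b^\varepsilon$ satisfying the same inequalities as $b$ with $C_0,C_1$ independent of $\varepsilon$. The integral equation is solved path by path: a continuous version of the Wiener integral $t\mapsto\int_0^t\sigma_rdW_r$ is fixed. *)

theory Defs
  imports "HOL-Probability.Probability"
begin

section \<open>Velocity fields\<close>

definition velocity_measurable :: "real \<Rightarrow> (real \<Rightarrow> real^'d \<Rightarrow> real^'d) \<Rightarrow> bool" where
  "velocity_measurable T b \<longleftrightarrow>
     (\<lambda>(t, x). b t x) \<in> borel_measurable (lebesgue_on ({0..T} \<times> UNIV))"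

definition one_sided_bounds ::
  "real \<Rightarrow> (real \<Rightarrow> real) \<Rightarrow> (real \<Rightarrow> real) \<Rightarrow> (real \<Rightarrow> real^'d \<Rightarrow> real^'d) \<Rightarrow> bool" where
  "one_sided_bounds T C0 C1 b \<longleftrightarrow>
     (\<forall>t\<in>{0..T}. \<forall>x. norm (b t x) \<le> C0 t * (1 + norm x)) \<and>
     (\<forall>t\<in>{0..T}. \<forall>x y. (b t x - b t y) \<bullet> (x - y) \<ge> - C1 t * (norm (x - y))\<^sup>2)"

definition nonneg_L1 :: "real \<Rightarrow> (real \<Rightarrow> real) \<Rightarrow> bool" where
  "nonneg_L1 T C \<longleftrightarrow> set_integrable lebesgue {0..T} C \<and> (\<forall>t\<in>{0..T}. 0 \<le> C t)"

text \<open>Here \<open>C\<^sup>0\<^sup>,\<^sup>1\<close> is the space of globally Lipschitz fields, which need not be bounded. Integrability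
  in time is required of the Lipschitz constant; that of the values is part of the growth bound
  imposed on regularizations below.\<close>

definition L1_Lipschitz :: "real \<Rightarrow> (real \<Rightarrow> real^'d \<Rightarrow> real^'d) \<Rightarrow> bool" where
  "L1_Lipschitz T b \<longleftrightarrow> velocity_measurable T b \<and>
     (\<exists>L. set_integrable lebesgue {0..T} L \<and>
          (AE t in lebesgue. t \<in> {0..T} \<longrightarrow> lipschitz_on (L t) UNIV (b t)))"

text \<open>The bounds for the regularizations are uniform in \<open>\<epsilon>\<close>, but are not required to be those
  of \<open>b\<close> (a mollification, for instance, slightly enlarges the growth bound).\<close>

definition admissible_regularization ::
  "real \<Rightarrow> (real \<Rightarrow> real^'d \<Rightarrow> real^'d) \<Rightarrow> (real \<Rightarrow> real \<Rightarrow> real^'d \<Rightarrow> real^'d) \<Rightarrow> bool" where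
  "admissible_regularization T b b\<epsilon> \<longleftrightarrow>
     (\<forall>\<epsilon>>0. L1_Lipschitz T (b\<epsilon> \<epsilon>)) \<and>
     (\<exists>C0 C1. nonneg_L1 T C0 \<and> nonneg_L1 T C1 \<and> (\<forall>\<epsilon>>0. one_sided_bounds T C0 C1 (b\<epsilon> \<epsilon>))) \<and>
     (AE (t, x) in lebesgue. t \<in> {0..T} \<longrightarrow> ((\<lambda>\<epsilon>. b\<epsilon> \<epsilon> t x) \<longlongrightarrow> b t x) (at_right 0))"


section \<open>Brownian motion and the Wiener integral\<close>

definition standard_brownian_motion ::
  "'w measure \<Rightarrow> real \<Rightarrow> (real \<Rightarrow> 'w \<Rightarrow> real^'m) \<Rightarrow> bool" where
  "standard_brownian_motion M T W \<longleftrightarrow>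
     (\<forall>t\<in>{0..T}. W t \<in> borel_measurable M) \<and>
     (AE \<omega> in M. W 0 \<omega> = 0) \<and>
     (\<forall>u t. 0 \<le> u \<and> u < t \<and> t \<le> T \<longrightarrow>
        distributed M lborel (\<lambda>\<omega>. W t \<omega> - W u \<omega>)
          (\<lambda>x. ennreal (\<Prod>i\<in>UNIV. normal_density 0 (sqrt (t - u)) (x $ i)))) \<and>
     (\<forall>n \<tau>. 0 \<le> \<tau> 0 \<and> (\<forall>i<n. \<tau> i \<le> \<tau> (Suc i)) \<and> \<tau> n \<le> T \<longrightarrow>
        prob_space.indep_vars M (\<lambda>_. borel) (\<lambda>i \<omega>. W (\<tau> (Suc i)) \<omega> - W (\<tau> i) \<omega>) {..<n}) \<and>
     (AE \<omega> in M. continuous_on {0..T} (\<lambda>t. W t \<omega>))"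

definition L2_matrix :: "real \<Rightarrow> (real \<Rightarrow> real^'m^'d) \<Rightarrow> bool" where
  "L2_matrix T \<sigma> \<longleftrightarrow> \<sigma> \<in> borel_measurable (lebesgue_on {0..T}) \<and>
     set_integrable lebesgue {0..T} (\<lambda>t. (norm (\<sigma> t))\<^sup>2)"

definition step_matrix ::
  "nat \<Rightarrow> (nat \<Rightarrow> real) \<Rightarrow> (nat \<Rightarrow> real^'m^'d) \<Rightarrow> real \<Rightarrow> real^'m^'d" where
  "step_matrix n \<tau> A r = (\<Sum>i<n. indicat_real {\<tau> i<..\<tau> (Suc i)} r *\<^sub>R A i)"

definition step_wiener_integral ::
  "(real \<Rightarrow> 'w \<Rightarrow> real^'m) \<Rightarrow> nat \<Rightarrow> (nat \<Rightarrow> real) \<Rightarrow> (nat \<Rightarrow> real^'m^'d) \<Rightarrow> 'w \<Rightarrow> real^'d" where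
  "step_wiener_integral W n \<tau> A \<omega> = (\<Sum>i<n. A i *v (W (\<tau> (Suc i)) \<omega> - W (\<tau> i) \<omega>))"

text \<open>\<open>X\<close> is (a version of) \<open>\<integral>\<^sub>0\<^sup>t \<sigma>\<^sub>r dW\<^sub>r\<close>: the mean-square limit of the integrals of
  deterministic step functions that approximate \<open>\<sigma>\<close> in \<open>L\<^sup>2([0,t])\<close>.\<close>

definition is_wiener_integral ::
  "'w measure \<Rightarrow> (real \<Rightarrow> 'w \<Rightarrow> real^'m) \<Rightarrow> (real \<Rightarrow> real^'m^'d) \<Rightarrow> real \<Rightarrow> ('w \<Rightarrow> real^'d) \<Rightarrow> bool" where
  "is_wiener_integral M W \<sigma> t X \<longleftrightarrow> X \<in> borel_measurable M \<and>
     (\<exists>n \<tau> A.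
        (\<forall>k. 0 \<le> \<tau> k 0 \<and> (\<forall>i<n k. \<tau> k i \<le> \<tau> k (Suc i)) \<and> \<tau> k (n k) \<le> t) \<and>
        (\<lambda>k. \<integral>\<^sup>+r\<in>{0..t}. ennreal ((norm (\<sigma> r - step_matrix (n k) (\<tau> k) (A k) r))\<^sup>2) \<partial>lebesgue)
           \<longlonglongrightarrow> 0 \<and>
        (\<lambda>k. \<integral>\<^sup>+\<omega>. ennreal ((norm (X \<omega> - step_wiener_integral W (n k) (\<tau> k) (A k) \<omega>))\<^sup>2) \<partial>M)
           \<longlonglongrightarrow> 0)"

definition continuous_wiener_integral ::
  "'w measure \<Rightarrow> real \<Rightarrow> (real \<Rightarrow> 'w \<Rightarrow> real^'m) \<Rightarrow> (real \<Rightarrow> real^'m^'d) \<Rightarrow> (real \<Rightarrow> 'w \<Rightarrow> real^'d) \<Rightarrow> bool"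
where
  "continuous_wiener_integral M T W \<sigma> I \<longleftrightarrow>
     (\<forall>t\<in>{0..T}. is_wiener_integral M W \<sigma> t (I t)) \<and>
     (AE \<omega> in M. continuous_on {0..T} (\<lambda>t. I t \<omega>))"


section \<open>The spaces \<open>C([s,T], L\<^sup>p\<^sub>l\<^sub>o\<^sub>c)\<close> and \<open>L\<^sup>p\<^sub>l\<^sub>o\<^sub>c(C([s,T]))\<close>\<close>

text \<open>Elements are represented by functions \<open>\<Phi> t x\<close>. All seminorms are replaced by their \<open>p\<close>-th
  powers, which take values in \<^typ>\<open>ennreal\<close>.\<close>

definition Lp_loc :: "real \<Rightarrow> (real^'d \<Rightarrow> real^'d) set" where
  "Lp_loc p = {f. f \<in> borel_measurable lebesgue \<and>
     (\<forall>K. compact K \<longrightarrow> (\<integral>\<^sup>+x\<in>K. ennreal (norm (f x) powr p) \<partial>lebesgue) < \<infinity>)}"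

definition C_Lp_loc :: "real \<Rightarrow> real \<Rightarrow> real \<Rightarrow> (real \<Rightarrow> real^'d \<Rightarrow> real^'d) set" where
  "C_Lp_loc s T p = {\<Phi>. (\<forall>t\<in>{s..T}. \<Phi> t \<in> Lp_loc p) \<and>
     (\<forall>K. compact K \<longrightarrow> (\<forall>t\<in>{s..T}.
        ((\<lambda>r. \<integral>\<^sup>+x\<in>K. ennreal (norm (\<Phi> r x - \<Phi> t x) powr p) \<partial>lebesgue) \<longlongrightarrow> 0)
          (at t within {s..T})))}"

text \<open>Since \<open>C([s,T])\<close> is separable, with Borel sets generated by the evaluations, the map
  \<open>x \<mapsto> \<Phi>(\<cdot>, x)\<close> into \<open>C([s,T])\<close> is (strongly) measurable iff every \<open>\<Phi> t\<close> is.\<close>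

definition Lp_loc_C :: "real \<Rightarrow> real \<Rightarrow> real \<Rightarrow> (real \<Rightarrow> real^'d \<Rightarrow> real^'d) set" where
  "Lp_loc_C s T p = {\<Phi>. (AE x in lebesgue. continuous_on {s..T} (\<lambda>t. \<Phi> t x)) \<and>
     (\<forall>t\<in>{s..T}. \<Phi> t \<in> borel_measurable lebesgue) \<and>
     (\<forall>K. compact K \<longrightarrow>
        (\<integral>\<^sup>+x\<in>K. (SUP t\<in>{s..T}. ennreal (norm (\<Phi> t x) powr p)) \<partial>lebesgue) < \<infinity>)}"

definition tendsto_C_Lp_loc :: "real \<Rightarrow> real \<Rightarrow> real \<Rightarrow>
  (real \<Rightarrow> real \<Rightarrow> real^'d \<Rightarrow> real^'d) \<Rightarrow> (real \<Rightarrow> real^'d \<Rightarrow> real^'d) \<Rightarrow> bool" where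
  "tendsto_C_Lp_loc s T p \<Phi>\<epsilon> \<Phi> \<longleftrightarrow>
     \<Phi> \<in> C_Lp_loc s T p \<and> (\<forall>\<epsilon>>0. \<Phi>\<epsilon> \<epsilon> \<in> C_Lp_loc s T p) \<and>
     (\<forall>K. compact K \<longrightarrow>
        ((\<lambda>\<epsilon>. SUP t\<in>{s..T}. \<integral>\<^sup>+x\<in>K. ennreal (norm (\<Phi>\<epsilon> \<epsilon> t x - \<Phi> t x) powr p) \<partial>lebesgue)
           \<longlongrightarrow> 0) (at_right 0))"

definition tendsto_Lp_loc_C :: "real \<Rightarrow> real \<Rightarrow> real \<Rightarrow>
  (real \<Rightarrow> real \<Rightarrow> real^'d \<Rightarrow> real^'d) \<Rightarrow> (real \<Rightarrow> real^'d \<Rightarrow> real^'d) \<Rightarrow> bool" where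
  "tendsto_Lp_loc_C s T p \<Phi>\<epsilon> \<Phi> \<longleftrightarrow>
     \<Phi> \<in> Lp_loc_C s T p \<and> (\<forall>\<epsilon>>0. \<Phi>\<epsilon> \<epsilon> \<in> Lp_loc_C s T p) \<and>
     (\<forall>K. compact K \<longrightarrow>
        ((\<lambda>\<epsilon>. \<integral>\<^sup>+x\<in>K. (SUP t\<in>{s..T}. ennreal (norm (\<Phi>\<epsilon> \<epsilon> t x - \<Phi> t x) powr p)) \<partial>lebesgue)
           \<longlongrightarrow> 0) (at_right 0))"


section \<open>Flows\<close>

text \<open>The equation driven by one fixed path \<open>g\<close> of the Wiener integral, so that
  \<open>\<integral>\<^sub>s\<^sup>t \<sigma>\<^sub>r dW\<^sub>r\<close> is \<open>g t - g s\<close>.\<close>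

definition solves_from :: "real \<Rightarrow> real \<Rightarrow> (real \<Rightarrow> real^'d \<Rightarrow> real^'d) \<Rightarrow>
  (real \<Rightarrow> real^'d) \<Rightarrow> real^'d \<Rightarrow> (real \<Rightarrow> real^'d) \<Rightarrow> bool" where
  "solves_from s T b g x X \<longleftrightarrow>
     set_integrable lebesgue {s..T} (\<lambda>r. b r (X r)) \<and>
     (\<forall>t\<in>{s..T}. X t = x + (LINT r:{s..t}|lebesgue. b r (X r)) + (g t - g s))"

definition Lp_flow :: "real \<Rightarrow> real \<Rightarrow> real \<Rightarrow> (real \<Rightarrow> real^'d \<Rightarrow> real^'d) \<Rightarrow>
  (real \<Rightarrow> real^'d) \<Rightarrow> (real \<Rightarrow> real^'d \<Rightarrow> real^'d) \<Rightarrow> bool" where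
  "Lp_flow s T p b g \<Phi> \<longleftrightarrow> \<Phi> \<in> C_Lp_loc s T p \<inter> Lp_loc_C s T p \<and>
     (AE x in lebesgue. solves_from s T b g x (\<lambda>t. \<Phi> t x))"

definition classical_flow :: "real \<Rightarrow> real \<Rightarrow> (real \<Rightarrow> real^'d \<Rightarrow> real^'d) \<Rightarrow>
  (real \<Rightarrow> real^'d) \<Rightarrow> (real \<Rightarrow> real^'d \<Rightarrow> real^'d) \<Rightarrow> bool" where
  "classical_flow s T b g \<Phi> \<longleftrightarrow> (\<forall>x. solves_from s T b g x (\<lambda>t. \<Phi> t x))"

end

theory Submission
  imports Defs
begin

text \<open>Only the continuity of the path \<open>g = \<integral>\<sigma> dW\<close> matters. The one-sided bound says that two solutions
  separate at most at an exponential rate backward in time, so the inverse flows of approximating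
  Lipschitz fields are uniformly Lipschitz on balls and converge locally uniformly to a Lipschitz map
  \<open>S\<close>. If \<open>S\<close> takes the value \<open>x\<close> at two points separated by a coordinate hyperplane \<open>H\<close> of rational height,
  then by continuity of the approximating flows it also takes the value \<open>x\<close> on \<open>H\<close>; since \<open>S(H)\<close> is
  a null set, \<open>S\<close> has one-point fibres over almost every \<open>x\<close>. For such \<open>x\<close> the approximating
  trajectories converge, and every solution of the limit equation starting at \<open>x\<close> is their limit.
  The same hyperplane argument, applied to a resolvent, shows that a one-sided Lipschitz map is
  continuous almost everywhere, which identifies the limit as a solution.\<close>

section \<open>Time integrals and Gronwall inequalities\<close>

text \<open>The one-sided bound gives no control on how trajectories spread forward in time. Hence
  every estimate concerns the maps leading from time \<open>t\<close> back to \<open>s\<close>, and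
  forward convergence comes from compactness. A trajectory evaluates a field on a null set of
  space-time, whereas fields are compared, and converge, only almost everywhere. Two devices bridge
  this gap. In the comparison of solutions an average over nearby points leaves only the
  \<open>L^1\<close> distance of the fields. And the Lipschitz continuity of \<open>S\<close> is
  used once more: apart from a null set of starting points, a limit trajectory lies in a null set
  \<open>N\<close> at time \<open>t\<close> only if it starts in \<open>S(N)\<close>, again a null
  set, so by Fubini almost every trajectory meets continuity points of the field at almost every
  time. The approximating sequence is kept abstract because it occurs twice: as truncated
  mollifications of \<open>b\<close> for existence, and as the regularizations along an arbitrary
  sequence of parameters tending to zero for convergence. Both times a solution of the limit
  equation is recognised as the limit of the approximating flows.\<close>

lemma abs_int_on_subinterval:
  fixes f :: "real \<Rightarrow> 'a::euclidean_space"
  assumes "f absolutely_integrable_on {a..c}" "a \<le> u" "t \<le> c"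
  shows "f absolutely_integrable_on {u..t}"
  using assms by (auto intro: set_integrable_subset)

lemma norm_integral_le_AE:
  fixes f :: "real \<Rightarrow> 'a::euclidean_space"
  assumes f: "f absolutely_integrable_on {u..t}" and h: "h absolutely_integrable_on {u..t}"
    and le: "AE r in lebesgue. r \<in> {u..t} \<longrightarrow> norm (f r) \<le> h r"
  shows "norm (integral {u..t} f) \<le> integral {u..t} h"
proof -
  have "norm (LINT r:{u..t}|lebesgue. f r) \<le> (LINT r:{u..t}|lebesgue. h r)"
    unfolding set_lebesgue_integral_def
    using le f h by (intro integral_norm_bound[THEN order_trans, OF integral_mono_AE] integrable_norm)
      (auto simp: set_integrable_def indicator_def elim!: eventually_mono)
  then show ?thesis
    by (simp add: set_lebesgue_integral_eq_integral(2)[OF f] set_lebesgue_integral_eq_integral(2)[OF h])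
qed

lemma integral_le_AE:
  fixes f h :: "real \<Rightarrow> real"
  assumes f: "f absolutely_integrable_on {u..t}" and h: "h absolutely_integrable_on {u..t}"
    and le: "AE r in lebesgue. r \<in> {u..t} \<longrightarrow> f r \<le> h r"
  shows "integral {u..t} f \<le> integral {u..t} h"
proof -
  have "(LINT r:{u..t}|lebesgue. f r) \<le> (LINT r:{u..t}|lebesgue. h r)"
    unfolding set_lebesgue_integral_def
    using le f h by (intro integral_mono_AE)
      (auto simp: set_integrable_def indicator_def elim!: eventually_mono)
  then show ?thesis
    by (simp add: set_lebesgue_integral_eq_integral(2)[OF f] set_lebesgue_integral_eq_integral(2)[OF h])
qed

lemma abs_int_on_AE_bound:
  fixes f :: "real \<Rightarrow> 'a::euclidean_space"
  assumes f: "f \<in> borel_measurable (lebesgue_on {u..t})" and h: "h absolutely_integrable_on {u..t}"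
    and le: "AE r in lebesgue. r \<in> {u..t} \<longrightarrow> norm (f r) \<le> h r"
  shows "f absolutely_integrable_on {u..t}"
proof -
  have "(\<lambda>x. indicator {u..t} x *\<^sub>R f x) \<in> borel_measurable lebesgue"
    using f by (simp add: borel_measurable_restrict_space_iff)
  moreover have "AE r in lebesgue. norm (indicat_real {u..t} r *\<^sub>R f r) \<le> norm (indicat_real {u..t} r *\<^sub>R h r)"
    by (rule eventually_mono[OF le]) (auto simp: indicator_def)
  ultimately show ?thesis
    unfolding set_integrable_def by (rule Bochner_Integration.integrable_bound[OF h[unfolded set_integrable_def]])
qed

text \<open>Completeness of Lebesgue measure. This is how compositions such as
  \<open>b r (X r)\<close> become measurable: they are identified almost everywhere with limits of
  functions already known to be measurable.\<close>

lemma measurable_lebesgue_AE_cong: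
  fixes f h :: "'a::euclidean_space \<Rightarrow> 'b::topological_space"
  assumes "AE x in lebesgue. f x = h x" "f \<in> borel_measurable lebesgue"
  shows "h \<in> borel_measurable lebesgue"
proof (rule measurableI)
  fix A :: "'b set" assume "A \<in> sets borel"
  with assms(2) have "f -` A \<inter> space lebesgue \<in> sets lebesgue" by (rule measurable_sets)
  moreover have "AE x in lebesgue. x \<in> f -` A \<inter> space lebesgue \<longleftrightarrow> x \<in> h -` A \<inter> space lebesgue"
    by (rule eventually_mono[OF assms(1)]) simp
  ultimately show "h -` A \<inter> space lebesgue \<in> sets lebesgue"
    by (metis completion.in_sets_AE inf_le2)
qed auto

lemma integral_diff_abs_int:
  fixes f :: "real \<Rightarrow> 'a::euclidean_space"
  assumes "f absolutely_integrable_on {a..c}" "a \<le> u" "u \<le> t" "t \<le> c"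
  shows "integral {a..t} f - integral {a..u} f = integral {u..t} f"
proof -
  have "f integrable_on {a..t}"
    using assms(4) by (intro set_lebesgue_integral_eq_integral(1) abs_int_on_subinterval[OF assms(1)]) auto
  from Henstock_Kurzweil_Integration.integral_combine[OF assms(2,3) this] show ?thesis by (simp add: algebra_simps)
qed

lemma continuous_indefinite:
  fixes f :: "real \<Rightarrow> 'a::euclidean_space"
  assumes "f absolutely_integrable_on {a..c}"
  shows "continuous_on {a..c} (\<lambda>t. integral {a..t} f)"
  by (intro indefinite_integral_continuous_1 set_lebesgue_integral_eq_integral(1) assms)

text \<open>Supplies the short intervals for the bisection principle \<open>Bolzano\<close>, which
  takes the place of differentiation because \<open>\<alpha>\<close> is merely integrable.\<close>

lemma small_integral_near:
  fixes \<alpha> :: "real \<Rightarrow> real"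
  assumes \<alpha>: "\<alpha> absolutely_integrable_on {a..c}" and x: "x \<in> {a..c}" and e: "e > 0"
  shows "\<exists>d>0. \<forall>u v. a \<le> u \<and> u \<le> x \<and> x \<le> v \<and> v \<le> c \<and> v - u < d \<longrightarrow> integral {u..v} \<alpha> < e"
proof -
  have "continuous_on {a..c} (\<lambda>t. integral {a..t} \<alpha>)" by (rule continuous_indefinite[OF \<alpha>])
  then obtain d where d: "d > 0" "\<And>y. y \<in> {a..c} \<Longrightarrow> dist y x < d \<Longrightarrow>
      dist (integral {a..y} \<alpha>) (integral {a..x} \<alpha>) < e/2"
    using e x unfolding continuous_on_iff by (meson half_gt_zero)
  show ?thesis
  proof (intro exI[of _ d] conjI allI impI)
    fix u v assume h: "a \<le> u \<and> u \<le> x \<and> x \<le> v \<and> v \<le> c \<and> v - u < d"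
    have "dist u x < d" "dist v x < d" "u \<in> {a..c}" "v \<in> {a..c}"
      using h by (auto simp: dist_real_def)
    then have "dist (integral {a..u} \<alpha>) (integral {a..x} \<alpha>) < e/2"
         "dist (integral {a..v} \<alpha>) (integral {a..x} \<alpha>) < e/2"
      by (blast intro: d(2))+
    moreover have "integral {a..v} \<alpha> - integral {a..u} \<alpha> = integral {u..v} \<alpha>"
      using h by (intro integral_diff_abs_int[OF \<alpha>]) auto
    ultimately show "integral {u..v} \<alpha> < e" unfolding dist_real_def by argo
  qed (rule d)
qed

lemma abs_int_mult_continuous:
  fixes \<alpha> \<phi> :: "real \<Rightarrow> real"
  assumes "\<alpha> absolutely_integrable_on {a..c}" "continuous_on {a..c} \<phi>"
  shows "(\<lambda>r. \<alpha> r * \<phi> r) absolutely_integrable_on {a..c}"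
proof -
  have "bounded (\<phi> ` {a..c})"
    using assms(2) compact_Icc compact_continuous_image compact_imp_bounded by blast
  moreover have "\<phi> \<in> borel_measurable (lebesgue_on {a..c})"
    using assms(2) by (intro continuous_imp_measurable_on_sets_lebesgue) auto
  ultimately have "(\<lambda>r. \<phi> r * \<alpha> r) absolutely_integrable_on {a..c}"
    using assms(1) by (intro absolutely_integrable_bounded_measurable_product_real) auto
  then show ?thesis by (simp add: mult.commute)
qed

text \<open>Let \<open>H\<close> be the right-hand side of the hypothesis. The estimate
  \<open>H v \<le> exp (2 * integral {u..v} \<alpha>) * H u\<close> is multiplicative under
  concatenation of intervals, so by bisection it suffices to prove it on short ones. This replaces
  differentiation of \<open>H\<close>, at the price of the factor 2 in the exponent.\<close>

lemma gronwall:
  fixes \<alpha> \<phi> :: "real \<Rightarrow> real"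
  assumes \<alpha>: "\<alpha> absolutely_integrable_on {a..c}"
    and \<alpha>0: "AE r in lebesgue. r \<in> {a..c} \<longrightarrow> 0 \<le> \<alpha> r"
    and \<phi>: "continuous_on {a..c} \<phi>" and \<phi>0: "\<And>t. t \<in> {a..c} \<Longrightarrow> 0 \<le> \<phi> t"
    and le: "\<And>t. t \<in> {a..c} \<Longrightarrow> \<phi> t \<le> k + integral {a..t} (\<lambda>r. \<alpha> r * \<phi> r)"
    and t: "t \<in> {a..c}"
  shows "\<phi> t \<le> k * exp (2 * integral {a..t} \<alpha>)"
proof -
  define H where "H t = k + integral {a..t} (\<lambda>r. \<alpha> r * \<phi> r)" for t
  have \<alpha>\<phi>: "(\<lambda>r. \<alpha> r * \<phi> r) absolutely_integrable_on {a..c}"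
    by (rule abs_int_mult_continuous[OF \<alpha> \<phi>])
  have pos: "0 \<le> integral {u..v} f" if "f absolutely_integrable_on {a..c}" "a \<le> u" "v \<le> c"
    "AE r in lebesgue. r \<in> {a..c} \<longrightarrow> 0 \<le> f r" for u v and f :: "real \<Rightarrow> real"
  proof -
    have "integral {u..v} (\<lambda>_. 0) \<le> integral {u..v} f"
      using that by (intro integral_le_AE) (auto intro: abs_int_on_subinterval elim!: eventually_mono)
    then show ?thesis by simp
  qed
  have \<alpha>\<phi>0: "AE r in lebesgue. r \<in> {a..c} \<longrightarrow> 0 \<le> \<alpha> r * \<phi> r"
    using \<alpha>0 \<phi>0 by (auto elim!: eventually_mono)
  have Hdiff: "H v - H u = integral {u..v} (\<lambda>r. \<alpha> r * \<phi> r)" if "a \<le> u" "u \<le> v" "v \<le> c" for u v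
    unfolding H_def using integral_diff_abs_int[OF \<alpha>\<phi> that] by simp
  have Hmono: "H u \<le> H v" if "a \<le> u" "u \<le> v" "v \<le> c" for u v
    using Hdiff[OF that] pos[OF \<alpha>\<phi> _ _ \<alpha>\<phi>0, of u v] that by auto
  have H0: "0 \<le> H u" if "u \<in> {a..c}" for u
    using le[OF that] \<phi>0[OF that] by (simp add: H_def)
  have "a \<le> t \<longrightarrow> t \<le> c \<longrightarrow> a \<ge> a \<longrightarrow> H t \<le> exp (2 * integral {a..t} \<alpha>) * H a"
  proof (rule Bolzano[where P="\<lambda>u v. u \<le> v \<longrightarrow> v \<le> c \<longrightarrow> u \<ge> a \<longrightarrow> H v \<le> exp (2 * integral {u..v} \<alpha>) * H u"])
    show "a \<le> t" using t by simp
  next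
    fix u v w assume 1: "u \<le> v \<longrightarrow> v \<le> c \<longrightarrow> u \<ge> a \<longrightarrow> H v \<le> exp (2 * integral {u..v} \<alpha>) * H u"
      "v \<le> w \<longrightarrow> w \<le> c \<longrightarrow> v \<ge> a \<longrightarrow> H w \<le> exp (2 * integral {v..w} \<alpha>) * H v" "u \<le> v" "v \<le> w"
    show "u \<le> w \<longrightarrow> w \<le> c \<longrightarrow> u \<ge> a \<longrightarrow> H w \<le> exp (2 * integral {u..w} \<alpha>) * H u"
    proof (intro impI)
      assume h: "w \<le> c" "u \<ge> a"
      have "integral {u..w} \<alpha> = integral {u..v} \<alpha> + integral {v..w} \<alpha>"
        using integral_diff_abs_int[OF abs_int_on_subinterval[OF \<alpha>], of u w v w] 1 h by simp
      then have e: "exp (2 * integral {u..w} \<alpha>) = exp (2 * integral {v..w} \<alpha>) * exp (2 * integral {u..v} \<alpha>)"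
        by (simp add: exp_add[symmetric] algebra_simps)
      have "H w \<le> exp (2 * integral {v..w} \<alpha>) * H v" using 1 h by auto
      also have "\<dots> \<le> exp (2 * integral {v..w} \<alpha>) * (exp (2 * integral {u..v} \<alpha>) * H u)"
        using 1 h by (intro mult_left_mono) auto
      finally show "H w \<le> exp (2 * integral {u..w} \<alpha>) * H u" unfolding e by (simp add: mult.assoc)
    qed
  next
    fix x assume x: "a \<le> x" "x \<le> t"
    then have "x \<in> {a..c}" using t by auto
    from small_integral_near[OF \<alpha> this, of "1/2"] obtain d where d: "d > 0"
      "\<And>u v. a \<le> u \<and> u \<le> x \<and> x \<le> v \<and> v \<le> c \<and> v - u < d \<Longrightarrow> integral {u..v} \<alpha> < 1/2" by auto
    show "\<exists>d>0. \<forall>u v. u \<le> x \<and> x \<le> v \<and> v - u < d \<longrightarrow>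
       u \<le> v \<longrightarrow> v \<le> c \<longrightarrow> u \<ge> a \<longrightarrow> H v \<le> exp (2 * integral {u..v} \<alpha>) * H u"
    proof (intro exI[of _ d] conjI allI impI)
      fix u v assume h: "u \<le> x \<and> x \<le> v \<and> v - u < d" "u \<le> v" "v \<le> c" "u \<ge> a"
      define J where "J = integral {u..v} \<alpha>"
      have J: "0 \<le> J" "J < 1/2" using d(2)[of u v] h pos[OF \<alpha> _ _ \<alpha>0, of u v] unfolding J_def by auto
      have *: "H v - H u \<le> J * H v"
      proof -
        have "H v - H u = integral {u..v} (\<lambda>r. \<alpha> r * \<phi> r)" using h by (intro Hdiff) auto
        also have "\<dots> \<le> integral {u..v} (\<lambda>r. \<alpha> r * H v)"
        proof (rule integral_le_AE)
          show "(\<lambda>r. \<alpha> r * \<phi> r) absolutely_integrable_on {u..v}"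
            using \<alpha>\<phi> h by (auto intro: abs_int_on_subinterval)
          show "(\<lambda>r. \<alpha> r * H v) absolutely_integrable_on {u..v}"
            using \<alpha> h by (auto intro!: abs_int_on_subinterval[where f=\<alpha>])
          have "\<phi> r \<le> H v" if "r \<in> {u..v}" for r
            using le[of r] Hmono[of r v] that h unfolding H_def by auto
          then show "AE r in lebesgue. r \<in> {u..v} \<longrightarrow> \<alpha> r * \<phi> r \<le> \<alpha> r * H v"
            using \<alpha>0 h by (auto elim!: eventually_mono intro!: mult_left_mono)
        qed
        also have "\<dots> = J * H v" by (simp add: J_def)
        finally show ?thesis .
      qed
      \<comment> \<open>The product equals \<open>1 + J * (1 - 2*J)\<close>, which is at least 1 for
        \<open>J < 1/2\<close>. It absorbs the term \<open>J * H v\<close> and is the origin of the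
        factor 2.\<close>
      have "1 \<le> (1 + 2*J) * (1 - J)"
        using J mult_left_mono[of J "1/2" "2*J"] by (simp add: algebra_simps)
      also have "\<dots> \<le> exp (2*J) * (1 - J)" using J exp_ge_add_one_self[of "2*J"]
        by (intro mult_right_mono) auto
      finally have "H v \<le> (exp (2*J) * (1 - J)) * H v"
        using H0[of v] h by (metis atLeastAtMost_iff mult_right_mono mult_1 order_trans)
      also have "\<dots> = exp (2*J) * (H v - J * H v)" by (simp add: algebra_simps)
      also have "\<dots> \<le> exp (2*J) * H u" using * by (intro mult_left_mono) auto
      finally show "H v \<le> exp (2 * integral {u..v} \<alpha>) * H u" by (simp add: J_def)
    qed (rule d)
  qed
  then have "H t \<le> exp (2 * integral {a..t} \<alpha>) * k"
    using t by (simp add: H_def)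
  with le[OF t] show ?thesis by (simp add: H_def mult.commute)
qed

lemma AE_lebesgue_iff_negligible: "(AE z in lebesgue. P z) \<longleftrightarrow> negligible {z. \<not> P z}"
  unfolding negligible_iff_null_sets completion.AE_iff_null_sets by simp

lemma AE_lborel_iff_negligible: "(AE z in lborel. P z) \<longleftrightarrow> negligible {z. \<not> P z}"
  unfolding AE_lebesgue_iff_negligible[symmetric] by (simp add: AE_completion_iff)

lemma AE_reflect:
  assumes "AE r::real in lebesgue. P r"
  shows "AE r in lebesgue. P (- r)"
proof -
  have "negligible (uminus ` {r. \<not> P r})"
    using assms unfolding AE_lebesgue_iff_negligible
    by (intro negligible_differentiable_image_negligible) (auto simp: differentiable_on_minus)
  moreover have "uminus ` {r. \<not> P r} = {r. \<not> P (-r)}" by force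
  ultimately show ?thesis unfolding AE_lebesgue_iff_negligible by simp
qed

lemma gronwall_backward:
  fixes \<alpha> \<phi> :: "real \<Rightarrow> real"
  assumes \<alpha>: "\<alpha> absolutely_integrable_on {a..c}"
    and \<alpha>0: "AE r in lebesgue. r \<in> {a..c} \<longrightarrow> 0 \<le> \<alpha> r"
    and \<phi>: "continuous_on {a..c} \<phi>" and \<phi>0: "\<And>t. t \<in> {a..c} \<Longrightarrow> 0 \<le> \<phi> t"
    and le: "\<And>t. t \<in> {a..c} \<Longrightarrow> \<phi> t \<le> k + integral {t..c} (\<lambda>r. \<alpha> r * \<phi> r)"
    and t: "t \<in> {a..c}"
  shows "\<phi> t \<le> k * exp (2 * integral {t..c} \<alpha>)"
proof -
  have "\<phi> (- (-t)) \<le> k * exp (2 * integral {-c..-t} (\<lambda>r. \<alpha> (-r)))"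
  proof (rule gronwall[where a="-c" and c="-a" and \<phi>="\<lambda>r. \<phi> (-r)"])
    show "(\<lambda>r. \<alpha> (- r)) absolutely_integrable_on {- c..- a}" using \<alpha> by simp
    show "AE r in lebesgue. r \<in> {- c..- a} \<longrightarrow> 0 \<le> \<alpha> (- r)"
      using AE_reflect[OF \<alpha>0] by (auto elim!: eventually_mono)
    show "continuous_on {- c..- a} (\<lambda>r. \<phi> (- r))"
      using \<phi> by (rule continuous_on_compose2) (auto intro: continuous_intros)
    fix u assume u: "u \<in> {- c..- a}"
    show "0 \<le> \<phi> (- u)" using \<phi>0[of "-u"] u by auto
    have "integral {-c..-(-u)} (\<lambda>r. \<alpha> (-r) * \<phi> (-r)) = integral {-u..c} (\<lambda>r. \<alpha> r * \<phi> r)"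
      by (subst Henstock_Kurzweil_Integration.integral_reflect_real[symmetric]) simp
    then show "\<phi> (- u) \<le> k + integral {- c..u} (\<lambda>r. \<alpha> (- r) * \<phi> (- r))"
      using le[of "-u"] u by auto
  qed (use t in auto)
  then show ?thesis by simp
qed

section \<open>Product rule for the squared norm of an indefinite integral\<close>

lemma abs_int_inner_continuous:
  fixes v w :: "real \<Rightarrow> 'a::euclidean_space"
  assumes "v absolutely_integrable_on {a..c}" "continuous_on {a..c} w"
  shows "(\<lambda>r. v r \<bullet> w r) absolutely_integrable_on {a..c}"
proof -
  have b: "bounded (w ` {a..c})"
    using assms(2) compact_Icc compact_continuous_image compact_imp_bounded by blast
  have m: "w \<in> borel_measurable (lebesgue_on {a..c})"
    using assms(2) by (intro continuous_imp_measurable_on_sets_lebesgue) auto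
  have "bilinear ((\<bullet>) :: 'a \<Rightarrow> 'a \<Rightarrow> real)"
    by (simp add: bilinear_conv_bounded_bilinear bounded_bilinear_inner)
  from absolutely_integrable_bounded_measurable_product[OF this m _ b assms(1)]
  have "(\<lambda>r. w r \<bullet> v r) absolutely_integrable_on {a..c}" by simp
  then show ?thesis by (simp add: inner_commute)
qed

text \<open>The increment of the squared norm is exactly
  \<open>(w t - w u) \<bullet> (w t + w u)\<close>. Replacing \<open>w t + w u\<close> by
  \<open>2 * w r\<close> under the integral costs, on a short interval, at most \<open>e\<close>
  times the integral of \<open>norm (v r)\<close>. Bisection adds up these errors, and
  \<open>e\<close> is arbitrary.\<close>

lemma norm_sq_integral:
  fixes v w :: "real \<Rightarrow> 'a::euclidean_space"
  assumes v: "v absolutely_integrable_on {a..c}" and "a \<le> c"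
    and w: "\<And>u t. a \<le> u \<Longrightarrow> u \<le> t \<Longrightarrow> t \<le> c \<Longrightarrow> w t - w u = integral {u..t} v"
  shows "(norm (w c))\<^sup>2 - (norm (w a))\<^sup>2 = integral {a..c} (\<lambda>r. 2 * (v r \<bullet> w r))"
proof -
  have contw: "continuous_on {a..c} w"
  proof -
    have "continuous_on {a..c} (\<lambda>t. w a + integral {a..t} v)"
      by (intro continuous_intros continuous_indefinite v)
    moreover have "w a + integral {a..t} v = w t" if "t \<in> {a..c}" for t
      using w[of a t] that by (auto simp: algebra_simps)
    ultimately show ?thesis by (metis (no_types, lifting) continuous_on_cong)
  qed
  have vw: "(\<lambda>r. 2 * (v r \<bullet> w r)) absolutely_integrable_on {a..c}"
    using set_integrable_mult_right[OF abs_int_inner_continuous[OF v contw]] by blast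
  have nv: "(\<lambda>r. norm (v r)) absolutely_integrable_on {a..c}"
    using v by (rule absolutely_integrable_norm[unfolded comp_def])
  define P where "P e u t \<longleftrightarrow> (a \<le> u \<and> u \<le> t \<and> t \<le> c \<longrightarrow>
    \<bar>(norm (w t))\<^sup>2 - (norm (w u))\<^sup>2 - integral {u..t} (\<lambda>r. 2 * (v r \<bullet> w r))\<bar> \<le> e * integral {u..t} (\<lambda>r. norm (v r)))"
    for e u t
  have "P e a c" if e: "e > 0" for e
    using \<open>a \<le> c\<close>
  proof (rule Bolzano)
    fix u t x assume H: "P e u t" "P e t x" "u \<le> t" "t \<le> x"
    have I: "integral {u..x} f = integral {u..t} f + integral {t..x} f"
      if "f absolutely_integrable_on {a..c}" "a \<le> u" "x \<le> c" for f :: "real \<Rightarrow> real"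
      using integral_diff_abs_int[OF abs_int_on_subinterval[OF that(1)], of u x t x] that H(3,4) by simp
    show "P e u x" unfolding P_def
    proof
      assume h: "a \<le> u \<and> u \<le> x \<and> x \<le> c"
      have "e * integral {u..x} (\<lambda>r. norm (v r)) = e * integral {u..t} (\<lambda>r. norm (v r)) + e * integral {t..x} (\<lambda>r. norm (v r))"
        using I[OF nv] h by (simp add: distrib_left)
      moreover note I[OF vw]
      ultimately show "\<bar>(norm (w x))\<^sup>2 - (norm (w u))\<^sup>2 - integral {u..x} (\<lambda>r. 2 * (v r \<bullet> w r))\<bar> \<le> e * integral {u..x} (\<lambda>r. norm (v r))"
        using H(1,2)[unfolded P_def, rule_format] H(3,4) h by argo
    qed
  next
    fix x assume x: "a \<le> x" "x \<le> c"
    obtain d where d: "d > 0" "\<And>y. y \<in> {a..c} \<Longrightarrow> dist y x < d \<Longrightarrow> dist (w y) (w x) < e/4"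
      using contw e x unfolding continuous_on_iff by (metis atLeastAtMost_iff zero_less_divide_iff zero_less_numeral)
    show "\<exists>d>0. \<forall>u t. u \<le> x \<and> x \<le> t \<and> t - u < d \<longrightarrow> P e u t"
    proof (intro exI[of _ d] conjI allI impI)
      fix u t assume h: "u \<le> x \<and> x \<le> t \<and> t - u < d"
      show "P e u t" unfolding P_def
      proof
        assume h': "a \<le> u \<and> u \<le> t \<and> t \<le> c"
        have sub: "v absolutely_integrable_on {u..t}" "(\<lambda>r. norm (v r)) absolutely_integrable_on {u..t}"
           "(\<lambda>r. 2 * (v r \<bullet> w r)) absolutely_integrable_on {u..t}"
          using h' by (blast intro: abs_int_on_subinterval[OF v] abs_int_on_subinterval[OF nv] abs_int_on_subinterval[OF vw])+
        have int: "v integrable_on {u..t}" by (intro set_lebesgue_integral_eq_integral(1) sub)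
        have vi: "(\<lambda>r. v r \<bullet> (w t + w u)) absolutely_integrable_on {u..t}"
          using sub(1) by (intro abs_int_inner_continuous) auto
        have "(norm (w t))\<^sup>2 - (norm (w u))\<^sup>2 = (w t - w u) \<bullet> (w t + w u)"
          by (simp add: power2_norm_eq_inner algebra_simps inner_commute)
        also have "\<dots> = integral {u..t} v \<bullet> (w t + w u)" using w h' by simp
        also have "\<dots> = integral {u..t} (\<lambda>r. v r \<bullet> (w t + w u))"
          using integral_linear[OF int bounded_linear_inner_left[of "w t + w u"]] by (simp add: comp_def)
        finally have "(norm (w t))\<^sup>2 - (norm (w u))\<^sup>2 - integral {u..t} (\<lambda>r. 2 * (v r \<bullet> w r)) =
          integral {u..t} (\<lambda>r. v r \<bullet> (w t + w u) - 2 * (v r \<bullet> w r))"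
          using Henstock_Kurzweil_Integration.integral_diff[OF set_lebesgue_integral_eq_integral(1)[OF vi]
              set_lebesgue_integral_eq_integral(1)[OF sub(3)]] by simp
        also have "norm \<dots> \<le> integral {u..t} (\<lambda>r. e * norm (v r))"
        proof (rule norm_integral_le_AE)
          show "(\<lambda>r. v r \<bullet> (w t + w u) - 2 * (v r \<bullet> w r)) absolutely_integrable_on {u..t}"
            using vi sub(3) by simp
          show "(\<lambda>r. e * norm (v r)) absolutely_integrable_on {u..t}" using sub(2) by simp
          have "norm (v r \<bullet> (w t + w u) - 2 * (v r \<bullet> w r)) \<le> e * norm (v r)" if "r \<in> {u..t}" for r
          proof -
            have "dist t x < d" "dist u x < d" "dist r x < d" "t \<in> {a..c}" "u \<in> {a..c}" "r \<in> {a..c}"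
              using h h' that by (auto simp: dist_real_def)
            then have D: "dist (w t) (w x) < e/4" "dist (w u) (w x) < e/4" "dist (w r) (w x) < e/4"
              by (blast intro: d(2))+
            have "dist (w t) (w r) \<le> e/2" "dist (w u) (w r) \<le> e/2"
              using D dist_triangle2[of "w t" "w r" "w x"] dist_triangle2[of "w u" "w r" "w x"] by argo+
            then have "norm ((w t - w r) + (w u - w r)) \<le> e"
              using norm_triangle_ineq[of "w t - w r" "w u - w r"] by (simp add: dist_norm)
            moreover have "v r \<bullet> (w t + w u) - 2 * (v r \<bullet> w r) = v r \<bullet> ((w t - w r) + (w u - w r))"
              by (simp add: algebra_simps)
            moreover have "\<bar>v r \<bullet> ((w t - w r) + (w u - w r))\<bar> \<le> norm (v r) * norm ((w t - w r) + (w u - w r))"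
              by (rule Cauchy_Schwarz_ineq2)
            moreover have "norm (v r) * norm ((w t - w r) + (w u - w r)) \<le> norm (v r) * e"
              using calculation(1) by (intro mult_left_mono) auto
            ultimately show ?thesis by (metis mult.commute order_trans real_norm_def)
          qed
          then show "AE r in lebesgue. r \<in> {u..t} \<longrightarrow> norm (v r \<bullet> (w t + w u) - 2 * (v r \<bullet> w r)) \<le> e * norm (v r)"
            by simp
        qed
        finally show "\<bar>(norm (w t))\<^sup>2 - (norm (w u))\<^sup>2 - integral {u..t} (\<lambda>r. 2 * (v r \<bullet> w r))\<bar> \<le> e * integral {u..t} (\<lambda>r. norm (v r))"
          by simp
      qed
    qed (rule d)
  qed
  then have *: "\<bar>(norm (w c))\<^sup>2 - (norm (w a))\<^sup>2 - integral {a..c} (\<lambda>r. 2 * (v r \<bullet> w r))\<bar> \<le> e * integral {a..c} (\<lambda>r. norm (v r))"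
    if "e > 0" for e using that \<open>a \<le> c\<close> unfolding P_def by auto
  define J where "J = integral {a..c} (\<lambda>r. norm (v r))"
  have "\<bar>(norm (w c))\<^sup>2 - (norm (w a))\<^sup>2 - integral {a..c} (\<lambda>r. 2 * (v r \<bullet> w r))\<bar> \<le> 0"
  proof (rule field_le_epsilon)
    fix e :: real assume "e > 0"
    have "e * J \<le> e * (\<bar>J\<bar> + 1)" using \<open>e > 0\<close> by (intro mult_left_mono) auto
    then have "e / (\<bar>J\<bar> + 1) * J \<le> e" by (simp add: divide_le_eq abs_add_one_gt_zero)
    moreover have "0 < e / (\<bar>J\<bar> + 1)" using \<open>e > 0\<close> by (simp add: add_nonneg_pos)
    ultimately show "\<bar>(norm (w c))\<^sup>2 - (norm (w a))\<^sup>2 - integral {a..c} (\<lambda>r. 2 * (v r \<bullet> w r))\<bar> \<le> 0 + e"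
      using *[of "e / (\<bar>J\<bar> + 1)"] unfolding J_def[symmetric] by argo
  qed
  then show ?thesis by simp
qed

section \<open>Path equations\<close>

lemma abs_int_nonneg:
  fixes f :: "real \<Rightarrow> real"
  assumes "f absolutely_integrable_on {a..c}" "AE r in lebesgue. r \<in> {a..c} \<longrightarrow> 0 \<le> f r"
    "a \<le> u" "v \<le> c"
  shows "0 \<le> integral {u..v} f"
proof -
  have "AE r in lebesgue. r \<in> {u..v} \<longrightarrow> 0 \<le> f r"
    by (rule eventually_mono[OF assms(2)]) (use assms(3,4) in auto)
  then have "integral {u..v} (\<lambda>_. 0) \<le> integral {u..v} f"
    by (intro integral_le_AE abs_int_on_subinterval[OF assms(1,3,4)]) auto
  then show ?thesis by simp
qed

text \<open>The base point may lie anywhere in the interval because solutions are prescribed at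
  \<open>s\<close> for the flows and at a later time for the inverse flows.\<close>

lemma gronwall_between:
  fixes \<alpha> \<phi> :: "real \<Rightarrow> real"
  assumes \<alpha>: "\<alpha> absolutely_integrable_on {a..c}"
    and \<alpha>0: "AE r in lebesgue. r \<in> {a..c} \<longrightarrow> 0 \<le> \<alpha> r"
    and \<phi>: "continuous_on {a..c} \<phi>" and \<phi>0: "\<And>t. t \<in> {a..c} \<Longrightarrow> 0 \<le> \<phi> t"
    and le: "\<And>t. t \<in> {a..c} \<Longrightarrow> \<phi> t \<le> k + integral {min \<tau> t..max \<tau> t} (\<lambda>r. \<alpha> r * \<phi> r)"
    and \<tau>: "\<tau> \<in> {a..c}" and t: "t \<in> {a..c}"
  shows "\<phi> t \<le> k * exp (2 * integral {a..c} \<alpha>)"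
proof -
  have k: "0 \<le> k" using le[OF \<tau>] \<phi>0[OF \<tau>] by simp
  have AEs: "AE r in lebesgue. r \<in> {u..v} \<longrightarrow> 0 \<le> \<alpha> r" if "a \<le> u" "v \<le> c" for u v
    by (rule eventually_mono[OF \<alpha>0]) (use that in auto)
  have sub: "integral {u..v} \<alpha> \<le> integral {a..c} \<alpha>" if "a \<le> u" "u \<le> v" "v \<le> c" for u v
    using integral_diff_abs_int[OF \<alpha>, of v c] integral_diff_abs_int[OF \<alpha>, of u v] that
      abs_int_nonneg[OF \<alpha> \<alpha>0, of v c] abs_int_nonneg[OF \<alpha> \<alpha>0, of a u] by auto
  have "\<exists>u v. a \<le> u \<and> u \<le> v \<and> v \<le> c \<and> \<phi> t \<le> k * exp (2 * integral {u..v} \<alpha>)"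
  proof (cases "\<tau> \<le> t")
    case True
    have "\<phi> t \<le> k * exp (2 * integral {\<tau>..t} \<alpha>)"
    proof (rule gronwall[where c=c])
      show "\<alpha> absolutely_integrable_on {\<tau>..c}" using \<tau> by (intro abs_int_on_subinterval[OF \<alpha>]) auto
      show "continuous_on {\<tau>..c} \<phi>" using \<tau> by (intro continuous_on_subset[OF \<phi>]) auto
      show "\<phi> r \<le> k + integral {\<tau>..r} (\<lambda>r. \<alpha> r * \<phi> r)" if "r \<in> {\<tau>..c}" for r
        using le[of r] that \<tau> by (auto simp: min_def max_def)
    qed (use \<tau> t True AEs \<phi>0 in auto)
    then show ?thesis using True \<tau> t by auto
  next
    case False
    have "\<phi> t \<le> k * exp (2 * integral {t..\<tau>} \<alpha>)"
    proof (rule gronwall_backward[where a=a])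
      show "\<alpha> absolutely_integrable_on {a..\<tau>}" using \<tau> by (intro abs_int_on_subinterval[OF \<alpha>]) auto
      show "continuous_on {a..\<tau>} \<phi>" using \<tau> by (intro continuous_on_subset[OF \<phi>]) auto
      show "\<phi> r \<le> k + integral {r..\<tau>} (\<lambda>r. \<alpha> r * \<phi> r)" if "r \<in> {a..\<tau>}" for r
        using le[of r] that \<tau> by (auto simp: min_def max_def split: if_splits)
    qed (use \<tau> t False AEs \<phi>0 in auto)
    then show ?thesis using False \<tau> t by (intro exI[of _ t] exI[of _ \<tau>]) auto
  qed
  then obtain u v where uv: "a \<le> u" "u \<le> v" "v \<le> c" "\<phi> t \<le> k * exp (2 * integral {u..v} \<alpha>)" by blast
  note uv(4)
  also have "k * exp (2 * integral {u..v} \<alpha>) \<le> k * exp (2 * integral {a..c} \<alpha>)"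
    using k sub uv(1-3) by (intro mult_left_mono) auto
  finally show ?thesis .
qed

text \<open>All increments are prescribed instead of the deviation from one initial value, so that
  no time is distinguished: solutions can be glued and can be read from any time in both
  directions.\<close>

definition path_sol :: "(real \<Rightarrow> 'a \<Rightarrow> 'a) \<Rightarrow> (real \<Rightarrow> 'a::euclidean_space) \<Rightarrow> real \<Rightarrow> real \<Rightarrow> (real \<Rightarrow> 'a) \<Rightarrow> bool"
  where "path_sol f g a c X \<longleftrightarrow> (\<lambda>r. f r (X r)) absolutely_integrable_on {a..c} \<and>
    (\<forall>u t. a \<le> u \<longrightarrow> u \<le> t \<longrightarrow> t \<le> c \<longrightarrow> X t - X u = integral {u..t} (\<lambda>r. f r (X r)) + (g t - g u))"

lemma path_solD:
  assumes "path_sol f g a c X"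
  shows "(\<lambda>r. f r (X r)) absolutely_integrable_on {a..c}"
    "\<And>u t. a \<le> u \<Longrightarrow> u \<le> t \<Longrightarrow> t \<le> c \<Longrightarrow> X t - X u = integral {u..t} (\<lambda>r. f r (X r)) + (g t - g u)"
  using assms unfolding path_sol_def by blast+

lemma path_sol_continuous:
  assumes X: "path_sol f g a c X" and g: "continuous_on {a..c} g"
  shows "continuous_on {a..c} X"
proof -
  have "continuous_on {a..c} (\<lambda>t. X a + integral {a..t} (\<lambda>r. f r (X r)) + (g t - g a))"
    by (intro continuous_intros continuous_indefinite path_solD(1)[OF X] g)
  moreover have "X a + integral {a..t} (\<lambda>r. f r (X r)) + (g t - g a) = X t" if "t \<in> {a..c}" for t
    using path_solD(2)[OF X, of a t] that by (auto simp: algebra_simps)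
  ultimately show ?thesis by (metis (no_types, lifting) continuous_on_cong)
qed

lemma path_sol_combine:
  assumes X: "path_sol f g a b X" and Y: "path_sol f g b c Y" and eq: "X b = Y b" and ab: "a \<le> b" "b \<le> c"
  shows "path_sol f g a c (\<lambda>r. if r \<le> b then X r else Y r)"
proof -
  define Z where "Z r = (if r \<le> b then X r else Y r)" for r
  have ZX: "Z r = X r" if "r \<le> b" for r using that by (simp add: Z_def)
  have ZY: "Z r = Y r" if "b \<le> r" for r using that eq by (auto simp: Z_def)
  have "(\<lambda>r. f r (Z r)) absolutely_integrable_on {a..b}"
    using path_solD(1)[OF X] by (rule absolutely_integrable_spike[OF _ negligible_empty]) (auto simp: ZX)
  moreover have "(\<lambda>r. f r (Z r)) absolutely_integrable_on {b..c}"
    using path_solD(1)[OF Y] by (rule absolutely_integrable_spike[OF _ negligible_empty]) (auto simp: ZY)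
  ultimately have "(\<lambda>r. f r (Z r)) absolutely_integrable_on ({a..b} \<union> {b..c})"
    by (intro set_integrable_Un) auto
  then have int: "(\<lambda>r. f r (Z r)) absolutely_integrable_on {a..c}"
    using ab by (simp add: ivl_disj_un_two_touch(4))
  have 1: "Z t - Z u = integral {u..t} (\<lambda>r. f r (Z r)) + (g t - g u)" if "a \<le> u" "u \<le> t" "t \<le> b" for u t
  proof -
    have "integral {u..t} (\<lambda>r. f r (Z r)) = integral {u..t} (\<lambda>r. f r (X r))"
      using that by (intro Henstock_Kurzweil_Integration.integral_cong) (auto simp: ZX)
    then show ?thesis using path_solD(2)[OF X] that by (simp add: ZX)
  qed
  have 2: "Z t - Z u = integral {u..t} (\<lambda>r. f r (Z r)) + (g t - g u)" if "b \<le> u" "u \<le> t" "t \<le> c" for u t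
  proof -
    have "integral {u..t} (\<lambda>r. f r (Z r)) = integral {u..t} (\<lambda>r. f r (Y r))"
      using that by (intro Henstock_Kurzweil_Integration.integral_cong) (auto simp: ZY)
    then show ?thesis using path_solD(2)[OF Y] that by (simp add: ZY)
  qed
  have "Z t - Z u = integral {u..t} (\<lambda>r. f r (Z r)) + (g t - g u)" if h: "a \<le> u" "u \<le> t" "t \<le> c" for u t
  proof -
    consider "t \<le> b" | "b \<le> u" | "u \<le> b" "b \<le> t" by linarith
    then show ?thesis
    proof cases
      case 3
      have "integral {u..t} (\<lambda>r. f r (Z r)) = integral {u..b} (\<lambda>r. f r (Z r)) + integral {b..t} (\<lambda>r. f r (Z r))"
        using integral_diff_abs_int[OF abs_int_on_subinterval[OF int], of u t b t] h 3 by (simp add: algebra_simps)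
      moreover have "Z t - Z u = (Z b - Z u) + (Z t - Z b)" by simp
      ultimately show ?thesis using 1[of u b] 2[of b t] h 3 by simp
    qed (use 1 2 h in auto)
  qed
  then show ?thesis using int unfolding path_sol_def Z_def by blast
qed

section \<open>A priori bounds and stability of solutions along one path\<close>

locale flow_setting =
  fixes s T :: real and g :: "real \<Rightarrow> 'a::euclidean_space" and C0 C1 :: "real \<Rightarrow> real"
  assumes sT: "s < T" and g: "continuous_on {s..T} g"
    and C0: "C0 absolutely_integrable_on {s..T}" and C1: "C1 absolutely_integrable_on {s..T}"
    and C0_nonneg: "\<And>r. r \<in> {s..T} \<Longrightarrow> 0 \<le> C0 r" and C1_nonneg: "\<And>r. r \<in> {s..T} \<Longrightarrow> 0 \<le> C1 r"
begin

definition growth :: "(real \<Rightarrow> 'a \<Rightarrow> 'a) \<Rightarrow> bool" where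
  "growth f \<longleftrightarrow> (AE r in lebesgue. r \<in> {s..T} \<longrightarrow> (\<forall>x. norm (f r x) \<le> C0 r * (1 + norm x)))"

text \<open>Localised to a ball because the fields constructed below for existence are truncated by
  a projection onto a ball, and the bound is available for them only inside it.\<close>

definition one_sided :: "real \<Rightarrow> (real \<Rightarrow> 'a \<Rightarrow> 'a) \<Rightarrow> bool" where
  "one_sided R f \<longleftrightarrow> (AE r in lebesgue. r \<in> {s..T} \<longrightarrow>
     (\<forall>x\<in>cball 0 R. \<forall>y\<in>cball 0 R. (f r x - f r y) \<bullet> (x - y) \<ge> - C1 r * (norm (x - y))\<^sup>2))"

text \<open>Measurability along continuous paths is made part of the notion: joint Lebesgue
  measurability alone says nothing about the values on the graph of a path, which is a null
  set.\<close>

definition lip_field :: "(real \<Rightarrow> 'a \<Rightarrow> 'a) \<Rightarrow> bool" where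
  "lip_field f \<longleftrightarrow> (\<forall>X. continuous_on {s..T} X \<longrightarrow> (\<lambda>r. f r (X r)) \<in> borel_measurable (lebesgue_on {s..T})) \<and>
     (\<exists>L. L absolutely_integrable_on {s..T} \<and>
        (AE r in lebesgue. r \<in> {s..T} \<longrightarrow> lipschitz_on (L r) UNIV (f r)))"

definition gbound :: real where "gbound = (SUP r\<in>{s..T}. norm (g r))"

text \<open>The Gronwall bound for \<open>1 + norm (X t)\<close> when \<open>norm X\<close> is at
  most \<open>\<rho>\<close> at some time; \<open>2 * gbound\<close> accounts for any increment of
  \<open>g\<close>. Since \<open>1\<close> is included, \<open>C0\<close> times this radius
  dominates the velocity.\<close>

definition rad :: "real \<Rightarrow> real" where
  "rad \<rho> = (1 + \<rho> + 2 * gbound) * exp (2 * integral {s..T} C0)"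

lemma gbound: "r \<in> {s..T} \<Longrightarrow> norm (g r) \<le> gbound"
proof -
  assume "r \<in> {s..T}"
  have "compact (norm ` g ` {s..T})"
    by (intro compact_continuous_image continuous_intros g) auto
  then have "bdd_above (norm ` g ` {s..T})"
    by (intro bounded_imp_bdd_above compact_imp_bounded)
  then show ?thesis unfolding gbound_def using \<open>r \<in> {s..T}\<close>
    by (intro cSUP_upper) (auto simp: image_image)
qed

lemma gbound_nonneg: "0 \<le> gbound"
  using gbound[of s] sT norm_ge_zero[of "g s"] by (auto intro: order_trans[OF norm_ge_zero])

lemma intC0_mono: "s \<le> a \<Longrightarrow> a \<le> c \<Longrightarrow> c \<le> T \<Longrightarrow> integral {a..c} C0 \<le> integral {s..T} C0"
  using abs_int_nonneg[OF C0, of s a] abs_int_nonneg[OF C0, of c T] C0_nonneg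
    integral_diff_abs_int[OF C0, of a c] integral_diff_abs_int[OF C0, of c T] by auto

lemma sol_bound1:
  assumes X: "path_sol f g a c X" and ac: "s \<le> a" "c \<le> T" and f: "growth f"
    and \<tau>: "\<tau> \<in> {a..c}" and x: "norm (X \<tau>) \<le> \<rho>" and t: "t \<in> {a..c}"
  shows "1 + norm (X t) \<le> rad \<rho>"
proof -
  have C0': "C0 absolutely_integrable_on {a..c}" using ac by (intro abs_int_on_subinterval[OF C0])
  have contX: "continuous_on {a..c} X"
    using ac by (intro path_sol_continuous[OF X] continuous_on_subset[OF g]) auto
  have C0nn: "r \<in> {a..c} \<Longrightarrow> 0 \<le> C0 r" for r using C0_nonneg ac by auto
  have "1 + norm (X t) \<le> (1 + \<rho> + 2 * gbound) * exp (2 * integral {a..c} C0)"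
  proof (rule gronwall_between[OF C0' _ _ _ _ \<tau> t])
    show "AE r in lebesgue. r \<in> {a..c} \<longrightarrow> 0 \<le> C0 r" using C0nn by auto
    show cont: "continuous_on {a..c} (\<lambda>t. 1 + norm (X t))" by (intro continuous_intros contX)
    fix r assume r: "r \<in> {a..c}"
    \<comment> \<open>Increments are estimated between \<open>u\<close> and \<open>v\<close> in
      their natural order, which treats times before and after \<open>\<tau>\<close>
      together.\<close>
    define u v where "u = min \<tau> r" and "v = max \<tau> r"
    have uv: "a \<le> u" "u \<le> v" "v \<le> c" using r \<tau> by (auto simp: u_def v_def)
    have "norm (X v - X u) \<le> norm (integral {u..v} (\<lambda>r. f r (X r))) + norm (g v - g u)"
      using path_solD(2)[OF X uv] norm_triangle_ineq by metis
    also have "norm (integral {u..v} (\<lambda>r. f r (X r))) \<le> integral {u..v} (\<lambda>r. C0 r * (1 + norm (X r)))"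
    proof (rule norm_integral_le_AE)
      show "(\<lambda>r. f r (X r)) absolutely_integrable_on {u..v}"
        using path_solD(1)[OF X] uv by (auto intro: abs_int_on_subinterval)
      show "(\<lambda>r. C0 r * (1 + norm (X r))) absolutely_integrable_on {u..v}"
        using abs_int_mult_continuous[OF C0' cont] uv by (auto intro: abs_int_on_subinterval)
      show "AE r in lebesgue. r \<in> {u..v} \<longrightarrow> norm (f r (X r)) \<le> C0 r * (1 + norm (X r))"
        by (rule eventually_mono[OF f[unfolded growth_def]]) (use uv ac in auto)
    qed
    also have "norm (g v - g u) \<le> norm (g v) + norm (g u)" by (rule norm_triangle_ineq4)
    also have "norm (g v) + norm (g u) \<le> 2 * gbound" using gbound[of u] gbound[of v] uv ac by auto
    finally have "norm (X v - X u) \<le> integral {u..v} (\<lambda>r. C0 r * (1 + norm (X r))) + 2 * gbound" by simp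
    moreover have "norm (X r) \<le> norm (X \<tau>) + norm (X v - X u)"
      unfolding u_def v_def by (cases "\<tau> \<le> r") (auto simp: min_def max_def norm_triangle_sub
         norm_minus_commute[of "X \<tau>" "X r"])
    ultimately show "1 + norm (X r) \<le> 1 + \<rho> + 2 * gbound + integral {min \<tau> r..max \<tau> r} (\<lambda>r. C0 r * (1 + norm (X r)))"
      using x unfolding u_def v_def by argo
  qed auto
  also have "\<dots> \<le> rad \<rho>"
  proof -
    have "0 \<le> \<rho>" using x norm_ge_zero order_trans by blast
    then show ?thesis unfolding rad_def
      using intC0_mono[OF ac(1) _ ac(2)] \<tau> gbound_nonneg by (intro mult_left_mono) auto
  qed
  finally show ?thesis .
qed

lemma sol_bound:
  assumes "path_sol f g a c X" "s \<le> a" "c \<le> T" "growth f" "\<tau> \<in> {a..c}" "norm (X \<tau>) \<le> \<rho>" "t \<in> {a..c}"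
  shows "norm (X t) \<le> rad \<rho>"
  using sol_bound1[OF assms] by simp

lemma sol_modulus:
  assumes X: "path_sol f g a c X" and ac: "s \<le> a" "c \<le> T" and f: "growth f"
    and \<tau>: "\<tau> \<in> {a..c}" and x: "norm (X \<tau>) \<le> \<rho>" and uv: "a \<le> u" "u \<le> v" "v \<le> c"
  shows "norm (X v - X u) \<le> rad \<rho> * integral {u..v} C0 + norm (g v - g u)"
proof -
  have C0': "C0 absolutely_integrable_on {u..v}" using ac uv by (intro abs_int_on_subinterval[OF C0]) auto
  have "norm (X v - X u) \<le> norm (integral {u..v} (\<lambda>r. f r (X r))) + norm (g v - g u)"
    using path_solD(2)[OF X uv] norm_triangle_ineq by metis
  also have "norm (integral {u..v} (\<lambda>r. f r (X r))) \<le> integral {u..v} (\<lambda>r. rad \<rho> * C0 r)"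
  proof (rule norm_integral_le_AE)
    show "(\<lambda>r. f r (X r)) absolutely_integrable_on {u..v}"
      using path_solD(1)[OF X] uv by (auto intro: abs_int_on_subinterval)
    show "(\<lambda>r. rad \<rho> * C0 r) absolutely_integrable_on {u..v}" using C0' by simp
    have "norm (f r (X r)) \<le> rad \<rho> * C0 r" if "\<forall>x. norm (f r x) \<le> C0 r * (1 + norm x)" "r \<in> {u..v}" for r
    proof -
      have "norm (f r (X r)) \<le> C0 r * (1 + norm (X r))" using that by blast
      also have "\<dots> \<le> C0 r * rad \<rho>"
        using that uv ac C0_nonneg by (intro mult_left_mono sol_bound1[OF X ac f \<tau> x]) auto
      finally show ?thesis by (simp add: mult.commute)
    qed
    then show "AE r in lebesgue. r \<in> {u..v} \<longrightarrow> norm (f r (X r)) \<le> rad \<rho> * C0 r"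
      using uv ac by (intro eventually_mono[OF f[unfolded growth_def]]) auto
  qed
  finally show ?thesis by simp
qed

text \<open>The constant depends on \<open>L\<close>, hence on the individual field, and is not
  uniform along an approximating sequence. It serves for qualitative facts about each single field:
  uniqueness, and continuity of its flow in the starting point.\<close>

lemma sol_lip_stable:
  assumes X: "path_sol f g a c X" and Y: "path_sol f g a c Y" and ac: "s \<le> a" "c \<le> T"
    and L: "L absolutely_integrable_on {s..T}"
      "AE r in lebesgue. r \<in> {s..T} \<longrightarrow> lipschitz_on (L r) UNIV (f r)"
    and \<tau>: "\<tau> \<in> {a..c}" and t: "t \<in> {a..c}"
  shows "norm (X t - Y t) \<le> norm (X \<tau> - Y \<tau>) * exp (2 * integral {a..c} L)"
proof -
  have L': "L absolutely_integrable_on {a..c}" using ac by (intro abs_int_on_subinterval[OF L(1)])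
  have contX: "continuous_on {a..c} X" "continuous_on {a..c} Y"
    using ac by (auto intro!: path_sol_continuous[OF X] path_sol_continuous[OF Y] continuous_on_subset[OF g])
  show ?thesis
  proof (rule gronwall_between[OF L' _ _ _ _ \<tau> t])
    show "AE r in lebesgue. r \<in> {a..c} \<longrightarrow> 0 \<le> L r"
      by (rule eventually_mono[OF L(2)]) (use ac lipschitz_on_nonneg in auto)
    show cont: "continuous_on {a..c} (\<lambda>t. norm (X t - Y t))" by (intro continuous_intros contX)
    fix r assume r: "r \<in> {a..c}"
    define u v where "u = min \<tau> r" and "v = max \<tau> r"
    have uv: "a \<le> u" "u \<le> v" "v \<le> c" using r \<tau> by (auto simp: u_def v_def)
    have i: "(\<lambda>r. f r (X r)) absolutely_integrable_on {u..v}" "(\<lambda>r. f r (Y r)) absolutely_integrable_on {u..v}"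
      using path_solD(1)[OF X] path_solD(1)[OF Y] uv by (auto intro: abs_int_on_subinterval)
    have "(X v - Y v) - (X u - Y u) = (X v - X u) - (Y v - Y u)" by simp
    also have "\<dots> = integral {u..v} (\<lambda>r. f r (X r)) - integral {u..v} (\<lambda>r. f r (Y r))"
      unfolding path_solD(2)[OF X uv] path_solD(2)[OF Y uv] by simp
    also have "\<dots> = integral {u..v} (\<lambda>r. f r (X r) - f r (Y r))"
      by (intro Henstock_Kurzweil_Integration.integral_diff[symmetric] set_lebesgue_integral_eq_integral(1) i)
    also have "norm \<dots> \<le> integral {u..v} (\<lambda>r. L r * norm (X r - Y r))"
    proof (rule norm_integral_le_AE)
      show "(\<lambda>r. f r (X r) - f r (Y r)) absolutely_integrable_on {u..v}" using i by simp
      show "(\<lambda>r. L r * norm (X r - Y r)) absolutely_integrable_on {u..v}"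
        using abs_int_mult_continuous[OF L' cont] uv by (auto intro: abs_int_on_subinterval)
      show "AE r in lebesgue. r \<in> {u..v} \<longrightarrow> norm (f r (X r) - f r (Y r)) \<le> L r * norm (X r - Y r)"
        by (rule eventually_mono[OF L(2)]) (use uv ac in \<open>auto simp: lipschitz_on_def dist_norm\<close>)
    qed
    finally have "norm ((X v - Y v) - (X u - Y u)) \<le> integral {u..v} (\<lambda>r. L r * norm (X r - Y r))" .
    moreover have "norm (X r - Y r) \<le> norm (X \<tau> - Y \<tau>) + norm ((X v - Y v) - (X u - Y u))"
      unfolding u_def v_def by (cases "\<tau> \<le> r") (auto simp: min_def max_def norm_triangle_sub
         norm_minus_commute[of "X \<tau> - Y \<tau>" "X r - Y r"])
    ultimately show "norm (X r - Y r) \<le> norm (X \<tau> - Y \<tau>) + integral {min \<tau> r..max \<tau> r} (\<lambda>r. L r * norm (X r - Y r))"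
      unfolding u_def v_def by argo
  qed auto
qed

lemma sol_unique:
  assumes "path_sol f g a c X" "path_sol f g a c Y" "s \<le> a" "c \<le> T" "lip_field f"
    "\<tau> \<in> {a..c}" "t \<in> {a..c}" "X \<tau> = Y \<tau>"
  shows "X t = Y t"
proof -
  obtain L where "L absolutely_integrable_on {s..T}"
      "AE r in lebesgue. r \<in> {s..T} \<longrightarrow> lipschitz_on (L r) UNIV (f r)"
    using assms(5) unfolding lip_field_def by blast
  from sol_lip_stable[OF assms(1-4) this assms(6,7)] assms(8) show ?thesis by simp
qed

section \<open>Existence for Lipschitz fields\<close>

lemma field_along_path_abs_int:
  assumes f: "lip_field f" "growth f" and X: "continuous_on {s..T} X" and ac: "s \<le> a" "c \<le> T"
  shows "(\<lambda>r. f r (X r)) absolutely_integrable_on {a..c}"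
proof (rule abs_int_on_subinterval[OF abs_int_on_AE_bound ac])
  show "(\<lambda>r. f r (X r)) \<in> borel_measurable (lebesgue_on {s..T})"
    using f(1) X unfolding lip_field_def by blast
  show "(\<lambda>r. C0 r * (1 + norm (X r))) absolutely_integrable_on {s..T}"
    by (intro abs_int_mult_continuous[OF C0] continuous_intros X)
  show "AE r in lebesgue. r \<in> {s..T} \<longrightarrow> norm (f r (X r)) \<le> C0 r * (1 + norm (X r))"
    by (rule eventually_mono[OF f(2)[unfolded growth_def]]) auto
qed

text \<open>Contraction with factor 1/2 on bounded continuous functions of the whole line; clamping
  time to \<open>{a..c}\<close> turns a path on the interval into such a function. The value is
  prescribed at an arbitrary \<open>\<tau>\<close>, so the same contraction solves backward in
  time.\<close>

lemma picard_local:
  assumes f: "lip_field f" "growth f" and ac: "s \<le> a" "a \<le> c" "c \<le> T"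
    and L: "L absolutely_integrable_on {s..T}"
      "AE r in lebesgue. r \<in> {s..T} \<longrightarrow> lipschitz_on (L r) UNIV (f r)"
    and small: "integral {a..c} L \<le> 1/2" and \<tau>: "\<tau> \<in> {a..c}"
  shows "\<exists>X. path_sol f g a c X \<and> X \<tau> = x"
proof -
  define F where "F \<phi> t = integral {a..t} (\<lambda>r. f r (apply_bcontfun \<phi> r))" for \<phi> :: "real \<Rightarrow>\<^sub>C 'a" and t
  define K where "K \<phi> t = x + (g t - g \<tau>) + (F \<phi> t - F \<phi> \<tau>)" for \<phi> t
  define Op where "Op \<phi> = Bcontfun (\<lambda>t. K \<phi> (clamp a c t))" for \<phi>
  have int: "(\<lambda>r. f r (apply_bcontfun \<phi> r)) absolutely_integrable_on {a..c}" for \<phi>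
    using ac by (intro field_along_path_abs_int f continuous_on_apply_bcontfun) auto
  have contK: "continuous_on {a..c} (K \<phi>)" for \<phi>
    unfolding K_def F_def by (intro continuous_intros continuous_indefinite int continuous_on_subset[OF g])
      (use ac in auto)
  have "(\<lambda>t. K \<phi> (clamp a c t)) \<in> bcontfun" for \<phi>
  proof -
    have "continuous_on (cbox a c) (K \<phi>)" using contK by simp
    moreover have "bounded (K \<phi> ` cbox a c)"
      using contK by (intro compact_imp_bounded compact_continuous_image) auto
    ultimately show ?thesis unfolding bcontfun_def
      by (auto intro: clamp_continuous_on clamp_bounded)
  qed
  then have Op: "apply_bcontfun (Op \<phi>) t = K \<phi> (clamp a c t)" for \<phi> t
    unfolding Op_def by (simp add: Bcontfun_inverse)
  have L': "L absolutely_integrable_on {a..c}" using ac by (intro abs_int_on_subinterval[OF L(1)]) auto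
  have L0: "AE r in lebesgue. r \<in> {a..c} \<longrightarrow> 0 \<le> L r"
    by (rule eventually_mono[OF L(2)]) (use ac lipschitz_on_nonneg in auto)
  have Fdiff: "F \<phi> v - F \<phi> u = integral {u..v} (\<lambda>r. f r (apply_bcontfun \<phi> r))" if "a \<le> u" "u \<le> v" "v \<le> c" for \<phi> u v
    unfolding F_def by (rule integral_diff_abs_int[OF int that])
  have Fcontr: "norm ((F \<phi> v - F \<phi> u) - (F \<psi> v - F \<psi> u)) \<le> 1/2 * dist \<phi> \<psi>"
    if uv: "a \<le> u" "u \<le> v" "v \<le> c" for \<phi> \<psi> u v
  proof -
    have i: "(\<lambda>r. f r (apply_bcontfun \<phi> r)) absolutely_integrable_on {u..v}" for \<phi>
      using uv by (intro abs_int_on_subinterval[OF int])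
    have "(F \<phi> v - F \<phi> u) - (F \<psi> v - F \<psi> u) =
        integral {u..v} (\<lambda>r. f r (apply_bcontfun \<phi> r) - f r (apply_bcontfun \<psi> r))"
      unfolding Fdiff[OF uv]
      by (intro Henstock_Kurzweil_Integration.integral_diff[symmetric] set_lebesgue_integral_eq_integral(1) i)
    also have "norm \<dots> \<le> integral {u..v} (\<lambda>r. L r * dist \<phi> \<psi>)"
    proof (rule norm_integral_le_AE)
      show "(\<lambda>r. f r (apply_bcontfun \<phi> r) - f r (apply_bcontfun \<psi> r)) absolutely_integrable_on {u..v}"
        using i by simp
      show "(\<lambda>r. L r * dist \<phi> \<psi>) absolutely_integrable_on {u..v}"
        using abs_int_on_subinterval[OF L' uv(1,3)] by simp
      have "norm (f r (apply_bcontfun \<phi> r) - f r (apply_bcontfun \<psi> r)) \<le> L r * dist \<phi> \<psi>"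
        if "lipschitz_on (L r) UNIV (f r)" for r
      proof -
        have "norm (f r (apply_bcontfun \<phi> r) - f r (apply_bcontfun \<psi> r)) \<le> L r * dist (apply_bcontfun \<phi> r) (apply_bcontfun \<psi> r)"
          using that by (auto simp: lipschitz_on_def dist_norm)
        also have "\<dots> \<le> L r * dist \<phi> \<psi>"
          using lipschitz_on_nonneg[OF that] by (intro mult_left_mono dist_bounded)
        finally show ?thesis .
      qed
      then show "AE r in lebesgue. r \<in> {u..v} \<longrightarrow>
          norm (f r (apply_bcontfun \<phi> r) - f r (apply_bcontfun \<psi> r)) \<le> L r * dist \<phi> \<psi>"
        using uv ac by (intro eventually_mono[OF L(2)]) auto
    qed
    also have "\<dots> = integral {u..v} L * dist \<phi> \<psi>" by simp
    also have "integral {u..v} L \<le> integral {a..c} L"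
      using integral_diff_abs_int[OF L', of v c] integral_diff_abs_int[OF L', of u v] uv
      abs_int_nonneg[OF L' L0, of v c] abs_int_nonneg[OF L' L0, of a u] by auto
    also note small
    finally show ?thesis by (simp add: mult_right_mono)
  qed
  have "\<exists>!\<phi>. Op \<phi> = \<phi>"
  proof (rule banach_fix_type[where c="1/2"])
    show "\<forall>\<phi> \<psi>. dist (Op \<phi>) (Op \<psi>) \<le> 1/2 * dist \<phi> \<psi>"
    proof (intro allI dist_bound)
      fix \<phi> \<psi> t
      define t' where "t' = clamp a c t"
      have t': "a \<le> t'" "t' \<le> c" using clamp_in_interval[of a c t] ac by (auto simp: t'_def)
      have "dist (apply_bcontfun (Op \<phi>) t) (apply_bcontfun (Op \<psi>) t) = norm ((F \<phi> t' - F \<phi> \<tau>) - (F \<psi> t' - F \<psi> \<tau>))"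
        unfolding Op t'_def[symmetric] dist_norm K_def by simp
      also have "\<dots> \<le> 1/2 * dist \<phi> \<psi>"
      proof (cases "\<tau> \<le> t'")
        case True
        then show ?thesis using t' \<tau> by (intro Fcontr) auto
      next
        case False
        have "norm ((F \<phi> t' - F \<phi> \<tau>) - (F \<psi> t' - F \<psi> \<tau>)) = norm ((F \<phi> \<tau> - F \<phi> t') - (F \<psi> \<tau> - F \<psi> t'))"
          by (subst norm_minus_commute) (simp add: algebra_simps)
        also have "\<dots> \<le> 1/2 * dist \<phi> \<psi>" using t' \<tau> False by (intro Fcontr) auto
        finally show ?thesis .
      qed
      finally show "dist (apply_bcontfun (Op \<phi>) t) (apply_bcontfun (Op \<psi>) t) \<le> 1/2 * dist \<phi> \<psi>" .
    qed
  qed auto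
  then obtain \<phi> where \<phi>: "Op \<phi> = \<phi>" by blast
  have val: "apply_bcontfun \<phi> t = K \<phi> t" if "t \<in> {a..c}" for t
    using Op[of \<phi> t] that by (simp add: \<phi>)
  have "path_sol f g a c (apply_bcontfun \<phi>)"
    unfolding path_sol_def
  proof (intro conjI allI impI int)
    fix u t assume h: "a \<le> u" "u \<le> t" "t \<le> c"
    then have "apply_bcontfun \<phi> t - apply_bcontfun \<phi> u = K \<phi> t - K \<phi> u" by (simp add: val)
    also have "\<dots> = (F \<phi> t - F \<phi> u) + (g t - g u)" by (simp add: K_def algebra_simps)
    finally show "apply_bcontfun \<phi> t - apply_bcontfun \<phi> u = integral {u..t} (\<lambda>r. f r (apply_bcontfun \<phi> r)) + (g t - g u)"
      using Fdiff[OF h] by simp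
  qed
  moreover have "apply_bcontfun \<phi> \<tau> = x" using val[OF \<tau>] by (simp add: K_def)
  ultimately show ?thesis by blast
qed

text \<open>Solvability from either end survives concatenation of intervals, so bisection extends it
  from short intervals to all. The bisected property quantifies over all \<open>x\<close>, since the
  second piece starts wherever the first one ends.\<close>

lemma picard_ends:
  assumes f: "lip_field f" "growth f" and ac: "s \<le> a" "a \<le> c" "c \<le> T"
  shows "(\<exists>X. path_sol f g a c X \<and> X a = x) \<and> (\<exists>X. path_sol f g a c X \<and> X c = x)"
proof -
  obtain L where L: "L absolutely_integrable_on {s..T}"
      "AE r in lebesgue. r \<in> {s..T} \<longrightarrow> lipschitz_on (L r) UNIV (f r)"
    using f(1) unfolding lip_field_def by blast
  have "s \<le> a \<longrightarrow> c \<le> T \<longrightarrow> (\<forall>x. (\<exists>X. path_sol f g a c X \<and> X a = x) \<and> (\<exists>X. path_sol f g a c X \<and> X c = x))"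
    using ac(2)
  proof (rule Bolzano)
    fix u v w :: real
    assume H: "s \<le> u \<longrightarrow> v \<le> T \<longrightarrow> (\<forall>x. (\<exists>X. path_sol f g u v X \<and> X u = x) \<and> (\<exists>X. path_sol f g u v X \<and> X v = x))"
      "s \<le> v \<longrightarrow> w \<le> T \<longrightarrow> (\<forall>x. (\<exists>X. path_sol f g v w X \<and> X v = x) \<and> (\<exists>X. path_sol f g v w X \<and> X w = x))"
      "u \<le> v" "v \<le> w"
    show "s \<le> u \<longrightarrow> w \<le> T \<longrightarrow> (\<forall>x. (\<exists>X. path_sol f g u w X \<and> X u = x) \<and> (\<exists>X. path_sol f g u w X \<and> X w = x))"
    proof (intro impI allI conjI)
      fix x assume h: "s \<le> u" "w \<le> T"
      obtain X where X: "path_sol f g u v X" "X u = x" using H h by fastforce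
      obtain Y where Y: "path_sol f g v w Y" "Y v = X v" using H h by fastforce
      from path_sol_combine[OF X(1) Y(1)] X(2) Y(2) H(3,4)
      show "\<exists>X. path_sol f g u w X \<and> X u = x"
        by (intro exI[of _ "\<lambda>r. if r \<le> v then X r else Y r"]) auto
    next
      fix x assume h: "s \<le> u" "w \<le> T"
      obtain Y where Y: "path_sol f g v w Y" "Y w = x" using H h by fastforce
      obtain X where X: "path_sol f g u v X" "X v = Y v" using H h by fastforce
      from path_sol_combine[OF X(1) Y(1)] X(2) Y(2) H(3,4)
      show "\<exists>X. path_sol f g u w X \<and> X w = x"
        by (intro exI[of _ "\<lambda>r. if r \<le> v then X r else Y r"]) auto
    qed
  next
    fix t assume t: "a \<le> t" "t \<le> c"
    then have "t \<in> {s..T}" using ac by auto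
    from small_integral_near[OF L(1) this, of "1/2"] obtain d where d: "d > 0"
      "\<And>u v. s \<le> u \<and> u \<le> t \<and> t \<le> v \<and> v \<le> T \<and> v - u < d \<Longrightarrow> integral {u..v} L < 1/2" by auto
    show "\<exists>d>0. \<forall>u v. u \<le> t \<and> t \<le> v \<and> v - u < d \<longrightarrow>
       s \<le> u \<longrightarrow> v \<le> T \<longrightarrow> (\<forall>x. (\<exists>X. path_sol f g u v X \<and> X u = x) \<and> (\<exists>X. path_sol f g u v X \<and> X v = x))"
    proof (intro exI[of _ d] conjI allI impI)
      fix u v x assume h: "u \<le> t \<and> t \<le> v \<and> v - u < d" "s \<le> u" "v \<le> T"
      then have "integral {u..v} L \<le> 1/2" using d(2)[of u v] by auto
      from picard_local[OF f h(2) _ h(3) L this] h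
      show "\<exists>X. path_sol f g u v X \<and> X u = x" "\<exists>X. path_sol f g u v X \<and> X v = x" by auto
    qed (rule d)
  qed
  then show ?thesis using ac by blast
qed

lemma sol_exists:
  assumes f: "lip_field f" "growth f" and \<tau>: "\<tau> \<in> {s..T}"
  obtains X where "path_sol f g s T X" "X \<tau> = x"
proof -
  obtain X where X: "path_sol f g s \<tau> X" "X \<tau> = x" using picard_ends[OF f, of s \<tau> x] \<tau> by auto
  obtain Y where Y: "path_sol f g \<tau> T Y" "Y \<tau> = x" using picard_ends[OF f, of \<tau> T x] \<tau> by auto
  show ?thesis
    using path_sol_combine[OF X(1) Y(1)] X(2) Y(2) \<tau>
    by (intro that[of "\<lambda>r. if r \<le> \<tau> then X r else Y r"]) auto
qed

end

section \<open>Comparison of solutions driven by different fields\<close>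

text \<open>The fields are compared at points \<open>q\<close> near the midpoint of \<open>X\<close> and \<open>Y\<close> instead of at
  \<open>X\<close> or \<open>Y\<close>; averaging over \<open>q\<close> then turns the last term into an \<open>L\<^sup>1\<close> distance.\<close>

lemma midpoint_expansion:
  fixes x y z :: "'a::real_inner"
  assumes q: "q = (1/2) *\<^sub>R (x + y) + z"
    and 1: "(f1 x - f1 q) \<bullet> (x - q) \<ge> - c * (norm (x - q))\<^sup>2"
    and 2: "(f2 q - f2 y) \<bullet> (q - y) \<ge> - c * (norm (q - y))\<^sup>2"
    and bd: "norm (f1 x) \<le> B" "norm (f1 q) \<le> B" "norm (f2 q) \<le> B" "norm (f2 y) \<le> B"
    and z: "norm z \<le> \<delta>" and c: "0 \<le> c"
  shows "- 2 * ((f1 x - f2 y) \<bullet> (x - y)) \<le>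
    2 * c * (norm (x - y))\<^sup>2 + 8 * c * \<delta>\<^sup>2 + 16 * B * \<delta> + 2 * norm (x - y) * norm (f1 q - f2 q)"
proof -
  define w where "w = x - y"
  have xq: "x - q = (1/2) *\<^sub>R w - z" "q - y = (1/2) *\<^sub>R w + z"
    by (simp_all add: q w_def algebra_simps) (simp_all add: scaleR_2[symmetric] flip: scaleR_add_left)
  \<comment> \<open>Parallelogram law: the mixed terms in \<open>z\<close> cancel, so moving
    \<open>q\<close> off the midpoint costs only order \<open>\<delta>\<close> squared in the
    one-sided terms. Multiplying the sum of both one-sided inequalities by 4 gives the constants of
    the claim.\<close>
  have "(norm ((1/2) *\<^sub>R w - z))\<^sup>2 + (norm ((1/2) *\<^sub>R w + z))\<^sup>2 = (norm w)\<^sup>2 / 2 + 2 * (norm z)\<^sup>2"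
    by (simp add: power2_norm_eq_inner algebra_simps inner_commute)
  then have "- c * (norm ((1/2) *\<^sub>R w - z))\<^sup>2 + - c * (norm ((1/2) *\<^sub>R w + z))\<^sup>2 = - c * ((norm w)\<^sup>2 / 2 + 2 * (norm z)\<^sup>2)"
    by (metis distrib_left)
  then have S: "(f1 x - f1 q) \<bullet> ((1/2) *\<^sub>R w - z) + (f2 q - f2 y) \<bullet> ((1/2) *\<^sub>R w + z) \<ge> - c * ((norm w)\<^sup>2 / 2 + 2 * (norm z)\<^sup>2)"
    using 1 2 unfolding xq by linarith
  have "(f1 x - f1 q) \<bullet> ((1/2) *\<^sub>R w - z) + (f2 q - f2 y) \<bullet> ((1/2) *\<^sub>R w + z)
     = ((f1 x - f2 y) \<bullet> w) / 2 - ((f1 q - f2 q) \<bullet> w) / 2 - (f1 x - f1 q) \<bullet> z + (f2 q - f2 y) \<bullet> z"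
    by (simp add: inner_simps diff_divide_distrib)
  moreover have cs: "\<bar>u \<bullet> z\<bar> \<le> 2 * B * \<delta>" if "norm u \<le> 2 * B" for u
  proof -
    have "\<bar>u \<bullet> z\<bar> \<le> norm u * norm z" by (rule Cauchy_Schwarz_ineq2)
    also have "\<dots> \<le> 2 * B * \<delta>" using that z order_trans[OF norm_ge_zero bd(1)] by (intro mult_mono) auto
    finally show ?thesis .
  qed
  moreover have "\<bar>(f1 x - f1 q) \<bullet> z\<bar> \<le> 2 * B * \<delta>" "\<bar>(f2 q - f2 y) \<bullet> z\<bar> \<le> 2 * B * \<delta>"
    using bd norm_triangle_ineq4[of "f1 x" "f1 q"] norm_triangle_ineq4[of "f2 q" "f2 y"] by (intro cs; simp)+
  moreover have "\<bar>(f1 q - f2 q) \<bullet> w\<bar> \<le> norm w * norm (f1 q - f2 q)"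
    using Cauchy_Schwarz_ineq2 by (metis mult.commute)
  moreover have "c * (norm z)\<^sup>2 \<le> c * \<delta>\<^sup>2" using c z by (intro mult_left_mono power_mono) auto
  moreover have "c * ((norm w)\<^sup>2 / 2 + 2 * (norm z)\<^sup>2) = (c * (norm w)\<^sup>2) / 2 + 2 * (c * (norm z)\<^sup>2)"
    by (simp add: algebra_simps)
  ultimately show ?thesis using S unfolding w_def[symmetric] by (simp add: abs_le_iff)
qed

context flow_setting begin

text \<open>The function \<open>h\<close> is only required to dominate the \<open>L^1\<close>
  distance on the ball. Such majorants can simply be added in the triangle inequality, and
  measurability in time is left to the construction of \<open>h\<close>.\<close>

definition field_dist :: "real \<Rightarrow> (real \<Rightarrow> 'a \<Rightarrow> 'a) \<Rightarrow> (real \<Rightarrow> 'a \<Rightarrow> 'a) \<Rightarrow> (real \<Rightarrow> real) \<Rightarrow> bool" where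
  "field_dist R f1 f2 h \<longleftrightarrow> h absolutely_integrable_on {s..T} \<and> (\<forall>r\<in>{s..T}. 0 \<le> h r) \<and>
     (AE r in lebesgue. r \<in> {s..T} \<longrightarrow>
        (\<integral>\<^sup>+q\<in>cball 0 R. ennreal (norm (f1 r q - f2 r q)) \<partial>lebesgue) \<le> ennreal (h r))"

text \<open>Integrating over the small ball and enlarging the domain turns an inequality valid for
  every \<open>q\<close> into one for the integral. The price is the inverse volume of the
  \<open>\<delta>\<close>-ball, so \<open>\<delta>\<close> has to be fixed before \<open>h\<close>
  is made small.\<close>

lemma averaged_bound:
  fixes u :: "'a \<Rightarrow> real"
  assumes \<theta>: "\<And>q. q \<in> cball m \<delta> \<Longrightarrow> \<theta> \<le> k * u q" and k: "0 < k" and \<delta>: "0 < \<delta>"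
    and sub: "cball m \<delta> \<subseteq> cball 0 R" and h: "0 \<le> h"
    and int: "(\<integral>\<^sup>+q\<in>cball 0 R. ennreal (u q) \<partial>lebesgue) \<le> ennreal h"
  shows "\<theta> \<le> k / measure lebesgue (cball (0::'a) \<delta>) * h"
proof -
  define V where "V = measure lebesgue (cball (0::'a) \<delta>)"
  have V: "0 < V" unfolding V_def using \<delta> by (simp add: content_cball_pos)
  have eV: "emeasure lebesgue (cball m \<delta>) = ennreal V"
  proof -
    have "measure lebesgue (cball m \<delta>) = V" using \<delta> unfolding V_def by (simp add: content_cball)
    then show ?thesis by (metis emeasure_eq_ennreal_measure emeasure_lborel_cball_finite emeasure_completion
       main_part_sets measure_def lmeasurable_cball fmeasurableD2)
  qed
  show ?thesis
  proof (cases "\<theta> \<le> 0")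
    case True
    then show ?thesis using V h k unfolding V_def[symmetric] by (simp add: order_trans[OF True])
  next
    case False
    have "ennreal (\<theta> / k) * ennreal V = (\<integral>\<^sup>+q. ennreal (\<theta> / k) * indicator (cball m \<delta>) q \<partial>lebesgue)"
      using eV by (subst nn_integral_cmult_indicator) auto
    also have "\<dots> \<le> (\<integral>\<^sup>+q\<in>cball 0 R. ennreal (u q) \<partial>lebesgue)"
    proof (intro nn_integral_mono)
      fix q
      show "ennreal (\<theta> / k) * indicator (cball m \<delta>) q \<le> ennreal (u q) * indicator (cball 0 R) q"
      proof (cases "q \<in> cball m \<delta>")
        case True
        then have "\<theta> / k \<le> u q" using \<theta>[OF True] k by (simp add: divide_le_eq mult.commute)
        then show ?thesis using True sub by (auto simp: indicator_def intro!: ennreal_leI)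
      qed auto
    qed
    also note int
    finally have "ennreal (\<theta> / k * V) \<le> ennreal h"
      using False k V by (subst ennreal_mult) (auto intro: divide_nonneg_pos)
    then have "\<theta> / k * V \<le> h" using h by (simp add: ennreal_le_iff)
    then show ?thesis using k V unfolding V_def[symmetric] by (simp add: field_simps)
  qed
qed

text \<open>The outer factor 2 is that of \<open>gronwall_backward\<close>; the inner one comes from
  differentiating the squared distance.\<close>

definition Kexp :: real where "Kexp = exp (2 * integral {s..T} (\<lambda>r. 2 * C1 r))"

lemma Kexp_pos: "0 < Kexp" by (simp add: Kexp_def)

text \<open>Backward in time the squared distance grows at rate at most \<open>2 * C1\<close>, up to
  errors: those with \<open>\<delta>\<close> come from displacing the comparison point, the last one
  from the averaged distance of the fields. Keeping both solutions within radius
  \<open>R - 1\<close> leaves room for the ball of radius \<open>\<delta> \<le> 1\<close> around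
  their midpoint.\<close>

lemma sol_comparison:
  assumes X: "path_sol f1 g s T X" and Y: "path_sol f2 g s T Y" and t: "t \<in> {s..T}"
    and gr: "growth f1" "growth f2" and os: "one_sided R f1" "one_sided R f2"
    and bX: "\<And>r. r \<in> {s..T} \<Longrightarrow> norm (X r) \<le> R - 1" and bY: "\<And>r. r \<in> {s..T} \<Longrightarrow> norm (Y r) \<le> R - 1"
    and \<delta>: "0 < \<delta>" "\<delta> \<le> 1" and h: "field_dist R f1 f2 h"
  shows "(norm (X s - Y s))\<^sup>2 \<le> ((norm (X t - Y t))\<^sup>2 + (8 * \<delta>\<^sup>2 * integral {s..T} C1
    + 16 * (1 + R) * \<delta> * integral {s..T} C0 + 4 * R / measure lebesgue (cball (0::'a) \<delta>) * integral {s..T} h)) * Kexp"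
proof -
  define V where "V = measure lebesgue (cball (0::'a) \<delta>)"
  have R: "1 \<le> R" using bX[of s] sT norm_ge_zero[of "X s"] by (simp del: norm_ge_zero)
  define e where "e r = 8 * \<delta>\<^sup>2 * C1 r + 16 * (1 + R) * \<delta> * C0 r + 4 * R / V * h r" for r
  have hi: "h absolutely_integrable_on {s..T}" and h0: "\<And>r. r \<in> {s..T} \<Longrightarrow> 0 \<le> h r"
    and hAE: "AE r in lebesgue. r \<in> {s..T} \<longrightarrow>
        (\<integral>\<^sup>+q\<in>cball 0 R. ennreal (norm (f1 r q - f2 r q)) \<partial>lebesgue) \<le> ennreal (h r)"
    using h unfolding field_dist_def by blast+
  have ei: "e absolutely_integrable_on {s..T}"
    unfolding e_def by (intro set_integral_add set_integrable_mult_right C0 C1 hi)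
  have e0: "0 \<le> e r" if "r \<in> {s..T}" for r
    unfolding e_def using that R \<delta> C0_nonneg C1_nonneg h0
    by (intro add_nonneg_nonneg mult_nonneg_nonneg divide_nonneg_nonneg) (auto simp: V_def)
  have ie: "integral {s..T} e = 8 * \<delta>\<^sup>2 * integral {s..T} C1
    + 16 * (1 + R) * \<delta> * integral {s..T} C0 + 4 * R / V * integral {s..T} h"
  proof -
    have "(e has_integral (8 * \<delta>\<^sup>2 * integral {s..T} C1
    + 16 * (1 + R) * \<delta> * integral {s..T} C0 + 4 * R / V * integral {s..T} h)) {s..T}"
      unfolding e_def
      by (intro has_integral_add has_integral_mult_right integrable_integral set_lebesgue_integral_eq_integral(1) C0 C1 hi)
    then show ?thesis by (rule integral_unique)
  qed
  define w where "w r = X r - Y r" for r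
  define v where "v r = f1 r (X r) - f2 r (Y r)" for r
  have iX: "(\<lambda>r. f1 r (X r)) absolutely_integrable_on {s..T}" and iY: "(\<lambda>r. f2 r (Y r)) absolutely_integrable_on {s..T}"
    using path_solD(1)[OF X] path_solD(1)[OF Y] by auto
  have vi: "v absolutely_integrable_on {s..T}" unfolding v_def using iX iY by simp
  have contw: "continuous_on {s..T} w"
    unfolding w_def by (intro continuous_intros path_sol_continuous[OF X] path_sol_continuous[OF Y] g)
  have wv: "w b - w a = integral {a..b} v" if "s \<le> a" "a \<le> b" "b \<le> T" for a b
  proof -
    have "w b - w a = (X b - X a) - (Y b - Y a)" by (simp add: w_def)
    also have "\<dots> = integral {a..b} (\<lambda>r. f1 r (X r)) - integral {a..b} (\<lambda>r. f2 r (Y r))"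
      unfolding path_solD(2)[OF X that] path_solD(2)[OF Y that] by simp
    also have "\<dots> = integral {a..b} v" unfolding v_def
      by (intro Henstock_Kurzweil_Integration.integral_diff[symmetric] set_lebesgue_integral_eq_integral(1)
         abs_int_on_subinterval[OF iX] abs_int_on_subinterval[OF iY] that)
    finally show ?thesis .
  qed
  have C1w: "(\<lambda>r. 2 * C1 r * (norm (w r))\<^sup>2) absolutely_integrable_on {s..T}"
    by (intro abs_int_mult_continuous set_integrable_mult_right C1 continuous_intros contw)
  have key: "AE r in lebesgue. r \<in> {s..T} \<longrightarrow> - (2 * (v r \<bullet> w r)) \<le> 2 * C1 r * (norm (w r))\<^sup>2 + e r"
    using gr[unfolded growth_def] os[unfolded one_sided_def] hAE
  proof eventually_elim
    case (elim r)
    show ?case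
    proof
      assume r: "r \<in> {s..T}"
      define m where "m = (1/2) *\<^sub>R (X r + Y r)"
      have nm: "norm m \<le> R - 1"
        unfolding m_def using norm_triangle_ineq[of "X r" "Y r"] bX[OF r] bY[OF r] by simp
      have sub: "cball m \<delta> \<subseteq> cball 0 R"
      proof
        fix q assume "q \<in> cball m \<delta>"
        then have "norm (q - m) \<le> \<delta>" by (simp add: dist_norm norm_minus_commute)
        then show "q \<in> cball 0 R" using nm \<delta> norm_triangle_sub[of q m] by simp
      qed
      have XR: "X r \<in> cball 0 R" "Y r \<in> cball 0 R" using bX[OF r] bY[OF r] by auto
      have bd: "norm (F q) \<le> C0 r * (1 + R)" if "\<forall>x. norm (F x) \<le> C0 r * (1 + norm x)" "q \<in> cball 0 R"
        for F :: "'a \<Rightarrow> 'a" and q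
      proof -
        have "norm (F q) \<le> C0 r * (1 + norm q)" using that by blast
        also have "\<dots> \<le> C0 r * (1 + R)" using that C0_nonneg[OF r] by (intro mult_left_mono) auto
        finally show ?thesis .
      qed
      have nw: "norm (X r - Y r) \<le> 2 * R"
        using norm_triangle_ineq4[of "X r" "Y r"] bX[OF r] bY[OF r] by simp
      \<comment> \<open>Everything independent of the comparison point is collected on the left.
        What remains is at most \<open>4 * R\<close> times the difference of the fields at
        \<open>q\<close>, because \<open>X r\<close> and \<open>Y r\<close> are at most
        \<open>2 * R\<close> apart.\<close>
      have "- (2 * (v r \<bullet> w r)) - (2 * C1 r * (norm (w r))\<^sup>2 + 8 * \<delta>\<^sup>2 * C1 r + 16 * (1 + R) * \<delta> * C0 r)
          \<le> 4 * R / measure lebesgue (cball (0::'a) \<delta>) * h r"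
      proof (rule averaged_bound[where u="\<lambda>q. norm (f1 r q - f2 r q)" and m=m and R=R])
        fix q assume q: "q \<in> cball m \<delta>"
        then have qR: "q \<in> cball 0 R" using sub by blast
        have nz: "norm (q - m) \<le> \<delta>" using q by (simp add: dist_norm norm_minus_commute)
        have "- 2 * ((f1 r (X r) - f2 r (Y r)) \<bullet> (X r - Y r)) \<le>
    2 * C1 r * (norm (X r - Y r))\<^sup>2 + 8 * C1 r * \<delta>\<^sup>2 + 16 * (C0 r * (1 + R)) * \<delta> + 2 * norm (X r - Y r) * norm (f1 r q - f2 r q)"
        proof (rule midpoint_expansion[where z="q - m"])
          show "q = (1/2) *\<^sub>R (X r + Y r) + (q - m)" by (simp add: m_def)
          show "- C1 r * (norm (X r - q))\<^sup>2 \<le> (f1 r (X r) - f1 r q) \<bullet> (X r - q)"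
            using elim(3) r XR qR by blast
          show "- C1 r * (norm (q - Y r))\<^sup>2 \<le> (f2 r q - f2 r (Y r)) \<bullet> (q - Y r)"
            using elim(4) r XR qR by blast
        qed (use nz C1_nonneg[OF r] bd elim(1,2) XR qR r in auto)
        moreover have "2 * norm (X r - Y r) * norm (f1 r q - f2 r q) \<le> 2 * (2 * R) * norm (f1 r q - f2 r q)"
          using nw by (intro mult_right_mono mult_left_mono) auto
        ultimately show "- (2 * (v r \<bullet> w r)) - (2 * C1 r * (norm (w r))\<^sup>2 + 8 * \<delta>\<^sup>2 * C1 r + 16 * (1 + R) * \<delta> * C0 r) \<le> 4 * R * norm (f1 r q - f2 r q)"
          unfolding v_def w_def by (simp add: algebra_simps)
      qed (use R \<delta> sub h0[OF r] elim(5) r in auto)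
      then show "- (2 * (v r \<bullet> w r)) \<le> 2 * C1 r * (norm (w r))\<^sup>2 + e r"
        unfolding e_def V_def by simp
    qed
  qed
  have e_sub: "integral {a..b} e \<le> integral {s..T} e" if "s \<le> a" "a \<le> b" "b \<le> T" for a b
    using integral_diff_abs_int[OF ei, of b T] integral_diff_abs_int[OF ei, of a b] that
      abs_int_nonneg[OF ei _, of b T] abs_int_nonneg[OF ei, of s a] e0 by auto
  have C1': "(\<lambda>r. 2 * C1 r) absolutely_integrable_on {s..t}"
    using t by (intro abs_int_on_subinterval[OF set_integrable_mult_right[OF C1]]) auto
  have "(norm (w s))\<^sup>2 \<le> ((norm (w t))\<^sup>2 + integral {s..T} e) * exp (2 * integral {s..t} (\<lambda>r. 2 * C1 r))"
  proof (rule gronwall_backward[OF C1'])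
    show "AE r in lebesgue. r \<in> {s..t} \<longrightarrow> 0 \<le> 2 * C1 r" using C1_nonneg t by auto
    show "continuous_on {s..t} (\<lambda>r. (norm (w r))\<^sup>2)"
      using t by (intro continuous_intros continuous_on_subset[OF contw]) auto
    fix u assume u: "u \<in> {s..t}"
    have ut: "s \<le> u" "u \<le> t" "t \<le> T" using u t by auto
    have vw: "(\<lambda>r. 2 * (v r \<bullet> w r)) absolutely_integrable_on {u..t}"
      using ut by (intro set_integrable_mult_right abs_int_inner_continuous abs_int_on_subinterval[OF vi]
        continuous_on_subset[OF contw]) auto
    have "(norm (w t))\<^sup>2 - (norm (w u))\<^sup>2 = integral {u..t} (\<lambda>r. 2 * (v r \<bullet> w r))"
      using ut by (intro norm_sq_integral abs_int_on_subinterval[OF vi] wv) auto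
    then have "(norm (w u))\<^sup>2 - (norm (w t))\<^sup>2 = integral {u..t} (\<lambda>r. - (2 * (v r \<bullet> w r)))" by simp
    also have "\<dots> \<le> integral {u..t} (\<lambda>r. 2 * C1 r * (norm (w r))\<^sup>2 + e r)"
    proof (rule integral_le_AE)
      show "(\<lambda>r. - (2 * (v r \<bullet> w r))) absolutely_integrable_on {u..t}"
        using set_integrable_mult_right[OF vw, of "-1"] by simp
      show "(\<lambda>r. 2 * C1 r * (norm (w r))\<^sup>2 + e r) absolutely_integrable_on {u..t}"
        by (intro set_integral_add abs_int_on_subinterval[OF C1w] abs_int_on_subinterval[OF ei] ut)
      show "AE r in lebesgue. r \<in> {u..t} \<longrightarrow> - (2 * (v r \<bullet> w r)) \<le> 2 * C1 r * (norm (w r))\<^sup>2 + e r"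
        by (rule eventually_mono[OF key]) (use ut in auto)
    qed
    also have "\<dots> = integral {u..t} (\<lambda>r. 2 * C1 r * (norm (w r))\<^sup>2) + integral {u..t} e"
      by (intro Henstock_Kurzweil_Integration.integral_add set_lebesgue_integral_eq_integral(1)
        abs_int_on_subinterval[OF C1w] abs_int_on_subinterval[OF ei] ut)
    finally show "(norm (w u))\<^sup>2 \<le> (norm (w t))\<^sup>2 + integral {s..T} e + integral {u..t} (\<lambda>r. 2 * C1 r * (norm (w r))\<^sup>2)"
      using e_sub[OF ut] by simp
  qed (use t in auto)
  also have "\<dots> \<le> ((norm (w t))\<^sup>2 + integral {s..T} e) * Kexp"
  proof -
    have "0 \<le> integral {s..T} e" using e0 by (intro abs_int_nonneg[OF ei]) auto
    moreover have "integral {s..t} (\<lambda>r. 2 * C1 r) \<le> integral {s..T} (\<lambda>r. 2 * C1 r)"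
      using integral_diff_abs_int[OF set_integrable_mult_right[OF C1, of 2], of t T]
        abs_int_nonneg[OF set_integrable_mult_right[OF C1, of 2], of t T] C1_nonneg t by auto
    ultimately show ?thesis unfolding Kexp_def by (intro mult_left_mono) auto
  qed
  finally show ?thesis unfolding ie w_def V_def .
qed

end

section \<open>Sequences of Lipschitz fields approximating a given field\<close>

locale flow_limit = flow_setting s T g C0 C1
  for s T :: real and g :: "real \<Rightarrow> 'a::euclidean_space" and C0 C1 :: "real \<Rightarrow> real" +
  fixes f :: "nat \<Rightarrow> real \<Rightarrow> 'a \<Rightarrow> 'a" and b :: "real \<Rightarrow> 'a \<Rightarrow> 'a"
  assumes lip: "lip_field (f n)" and growth_f: "growth (f n)" and growth_b: "growth b"
    and one_sided_b: "one_sided R b"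
    and one_sided_f: "eventually (\<lambda>n. one_sided R (f n)) sequentially"
    and b_meas: "AE r in lebesgue. r \<in> {s..T} \<longrightarrow> b r \<in> borel_measurable lebesgue"
    and dist_f: "\<exists>h. (\<forall>n. field_dist R (f n) b (h n)) \<and> (\<lambda>n. integral {s..T} (h n)) \<longlonglongrightarrow> 0"
begin

lemma f_meas: "AE r in lebesgue. r \<in> {s..T} \<longrightarrow> f n r \<in> borel_measurable lebesgue"
proof -
  obtain L where L: "AE r in lebesgue. r \<in> {s..T} \<longrightarrow> lipschitz_on (L r) UNIV (f n r)"
    using lip[of n] unfolding lip_field_def by blast
  show ?thesis
  proof (rule eventually_mono[OF L], intro impI)
    fix r assume "r \<in> {s..T} \<longrightarrow> lipschitz_on (L r) UNIV (f n r)" "r \<in> {s..T}"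
    then have "continuous_on UNIV (f n r)" by (auto intro: lipschitz_on_continuous_on)
    then show "f n r \<in> borel_measurable lebesgue"
      using continuous_imp_measurable_on_sets_lebesgue[of UNIV "f n r"] by simp
  qed
qed

lemma field_dist_pair:
  assumes F: "F1 \<in> insert b (range f)" "F2 \<in> insert b (range f)"
    and h: "field_dist R F1 b h1" "field_dist R F2 b h2"
  shows "field_dist R F1 F2 (\<lambda>r. h1 r + h2 r)"
  unfolding field_dist_def
proof (intro conjI)
  show "(\<lambda>r. h1 r + h2 r) absolutely_integrable_on {s..T}"
    using h unfolding field_dist_def by (blast intro: set_integral_add)
  show "\<forall>r\<in>{s..T}. 0 \<le> h1 r + h2 r"
    using h unfolding field_dist_def by auto
  have F': "AE r in lebesgue. r \<in> {s..T} \<longrightarrow> F r \<in> borel_measurable lebesgue" if "F \<in> insert b (range f)" for F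
    using that b_meas f_meas by blast
  have h': "AE r in lebesgue. r \<in> {s..T} \<longrightarrow>
        (\<integral>\<^sup>+q\<in>cball 0 R. ennreal (norm (F1 r q - b r q)) \<partial>lebesgue) \<le> ennreal (h1 r)"
    "AE r in lebesgue. r \<in> {s..T} \<longrightarrow>
        (\<integral>\<^sup>+q\<in>cball 0 R. ennreal (norm (F2 r q - b r q)) \<partial>lebesgue) \<le> ennreal (h2 r)"
    "\<And>r. r \<in> {s..T} \<Longrightarrow> 0 \<le> h1 r" "\<And>r. r \<in> {s..T} \<Longrightarrow> 0 \<le> h2 r"
    using h unfolding field_dist_def by blast+
  show "AE r in lebesgue. r \<in> {s..T} \<longrightarrow>
        (\<integral>\<^sup>+q\<in>cball 0 R. ennreal (norm (F1 r q - F2 r q)) \<partial>lebesgue) \<le> ennreal (h1 r + h2 r)"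
    using h'(1,2) F'[OF F(1)] F'[OF F(2)] b_meas
  proof eventually_elim
    case (elim r)
    show ?case
    proof
      assume r: "r \<in> {s..T}"
      have [measurable]: "F1 r \<in> borel_measurable lebesgue" "F2 r \<in> borel_measurable lebesgue" "b r \<in> borel_measurable lebesgue"
        using elim r by auto
      have [measurable]: "cball 0 R \<in> sets lebesgue" by simp
      have "(\<integral>\<^sup>+q\<in>cball 0 R. ennreal (norm (F1 r q - F2 r q)) \<partial>lebesgue) \<le>
        (\<integral>\<^sup>+q. ennreal (norm (F1 r q - b r q)) * indicator (cball 0 R) q + ennreal (norm (F2 r q - b r q)) * indicator (cball 0 R) q \<partial>lebesgue)"
      proof (intro nn_integral_mono)
        fix q
        have "norm (F1 r q - F2 r q) \<le> norm (F1 r q - b r q) + norm (F2 r q - b r q)"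
          using norm_triangle_ineq4[of "F1 r q - b r q" "F2 r q - b r q"] by simp
        then show "ennreal (norm (F1 r q - F2 r q)) * indicator (cball 0 R) q \<le>
           ennreal (norm (F1 r q - b r q)) * indicator (cball 0 R) q + ennreal (norm (F2 r q - b r q)) * indicator (cball 0 R) q"
          by (auto simp: indicator_def ennreal_plus[symmetric] simp del: ennreal_plus intro: ennreal_leI)
      qed
      also have "\<dots> = (\<integral>\<^sup>+q\<in>cball 0 R. ennreal (norm (F1 r q - b r q)) \<partial>lebesgue) +
         (\<integral>\<^sup>+q\<in>cball 0 R. ennreal (norm (F2 r q - b r q)) \<partial>lebesgue)"
        by (intro nn_integral_add) measurable
      also have "\<dots> \<le> ennreal (h1 r) + ennreal (h2 r)" using elim r by (intro add_mono) auto
      also have "\<dots> = ennreal (h1 r + h2 r)" using h'(3,4)[OF r] by (simp add: ennreal_plus)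
      finally show "(\<integral>\<^sup>+q\<in>cball 0 R. ennreal (norm (F1 r q - F2 r q)) \<partial>lebesgue) \<le> ennreal (h1 r + h2 r)" .
    qed
  qed
qed

text \<open>The field \<open>b\<close> is placed in one family with the late approximations, so that
  a single estimate yields the Cauchy property of the inverse flows, their Lipschitz bound in the
  limit, and the comparison with genuine solutions of the limit equation.\<close>

lemma comparison_uniform:
  assumes \<eta>: "0 < \<eta>"
  obtains N where "\<And>F1 F2 X Y t. \<lbrakk>F1 \<in> insert b (f ` {N..}); F2 \<in> insert b (f ` {N..}); t \<in> {s..T};
    path_sol F1 g s T X; path_sol F2 g s T Y; norm (X t) \<le> \<rho>; norm (Y t) \<le> \<rho>\<rbrakk>
    \<Longrightarrow> (norm (X s - Y s))\<^sup>2 \<le> ((norm (X t - Y t))\<^sup>2 + \<eta>) * Kexp"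
proof (cases "\<rho> < 0")
  case True
  then show ?thesis by (intro that[of 0]) (meson norm_ge_zero order_trans not_le)
next
  case \<rho>: False
  define R where "R = rad \<rho> + 1"
  have I0: "0 \<le> integral {s..T} C0" "0 \<le> integral {s..T} C1"
    using C0_nonneg C1_nonneg by (auto intro!: abs_int_nonneg[OF C0] abs_int_nonneg[OF C1])
  have "0 \<le> rad \<rho>" unfolding rad_def using \<rho> gbound_nonneg by (intro mult_nonneg_nonneg) auto
  then have R: "1 \<le> R" by (simp add: R_def)
  define A where "A = 8 * integral {s..T} C1 + 16 * (1 + R) * integral {s..T} C0"
  have A: "0 \<le> A" unfolding A_def using I0 R by simp
  \<comment> \<open>Chosen before \<open>N\<close>, because the constant \<open>c\<close> below
    contains the inverse volume of the \<open>\<delta>\<close>-ball. The \<open>\<delta>\<close>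
    terms and the field distance each receive half of \<open>\<eta>\<close>.\<close>
  define \<delta> where "\<delta> = min 1 (\<eta> / (2 * (A + 1)))"
  have \<delta>: "0 < \<delta>" "\<delta> \<le> 1" using A \<eta> by (auto simp: \<delta>_def)
  have "\<delta> * A \<le> \<delta> * (A + 1)" using \<delta> by simp
  also have "\<dots> \<le> \<eta> / (2 * (A + 1)) * (A + 1)" using A by (intro mult_right_mono) (auto simp: \<delta>_def)
  also have "\<dots> = \<eta> / 2" using A by (simp add: field_simps)
  finally have \<delta>A: "\<delta> * A \<le> \<eta> / 2" .
  define c where "c = 4 * R / measure lebesgue (cball (0::'a) \<delta>)"
  have c: "0 < c" unfolding c_def using R \<delta> by (simp add: content_cball_pos)
  obtain h where h: "\<And>n. field_dist R (f n) b (h n)" "(\<lambda>n. integral {s..T} (h n)) \<longlonglongrightarrow> 0"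
    using dist_f by blast
  have "eventually (\<lambda>n. integral {s..T} (h n) < \<eta> / (4 * c)) sequentially"
    using h(2) \<eta> c by (intro order_tendstoD) auto
  then have "eventually (\<lambda>n. integral {s..T} (h n) < \<eta> / (4 * c) \<and> one_sided R (f n)) sequentially"
    using one_sided_f eventually_conj by blast
  then obtain N where N: "\<And>n. n \<ge> N \<Longrightarrow> integral {s..T} (h n) < \<eta> / (4 * c)" "\<And>n. n \<ge> N \<Longrightarrow> one_sided R (f n)"
    unfolding eventually_sequentially by auto
  have fam: "\<exists>h. field_dist R F b h \<and> integral {s..T} h \<le> \<eta> / (4 * c) \<and> one_sided R F \<and> growth F \<and> F \<in> insert b (range f)"
    if F: "F \<in> insert b (f ` {N..})" for F
  proof (cases "F = b")
    case True
    have "field_dist R b b (\<lambda>_. 0)" by (simp add: field_dist_def)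
    then show ?thesis using True one_sided_b growth_b \<eta> c by (intro exI[of _ "\<lambda>_. 0"]) auto
  next
    case False
    then obtain n where "n \<ge> N" "F = f n" using F by auto
    then show ?thesis using h(1)[of n] N growth_f by (intro exI[of _ "h n"]) (auto intro: less_imp_le)
  qed
  show ?thesis
  proof (rule that[of N])
    fix F1 F2 X Y t
    assume F: "F1 \<in> insert b (f ` {N..})" "F2 \<in> insert b (f ` {N..})" and t: "t \<in> {s..T}"
      and X: "path_sol F1 g s T X" and Y: "path_sol F2 g s T Y" and \<rho>: "norm (X t) \<le> \<rho>" "norm (Y t) \<le> \<rho>"
    obtain h1 where h1: "field_dist R F1 b h1" "integral {s..T} h1 \<le> \<eta> / (4 * c)" "one_sided R F1" "growth F1" "F1 \<in> insert b (range f)"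
      using fam[OF F(1)] by blast
    obtain h2 where h2: "field_dist R F2 b h2" "integral {s..T} h2 \<le> \<eta> / (4 * c)" "one_sided R F2" "growth F2" "F2 \<in> insert b (range f)"
      using fam[OF F(2)] by blast
    have h12: "field_dist R F1 F2 (\<lambda>r. h1 r + h2 r)"
      by (rule field_dist_pair[OF h1(5) h2(5) h1(1) h2(1)])
    have hi: "h1 absolutely_integrable_on {s..T}" "h2 absolutely_integrable_on {s..T}"
      using h1(1) h2(1) unfolding field_dist_def by blast+
    have "integral {s..T} (\<lambda>r. h1 r + h2 r) = integral {s..T} h1 + integral {s..T} h2"
      by (intro Henstock_Kurzweil_Integration.integral_add set_lebesgue_integral_eq_integral(1) hi)
    also have "\<dots> \<le> \<eta> / (2 * c)" using h1(2) h2(2) by (simp add: field_simps)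
    finally have "c * integral {s..T} (\<lambda>r. h1 r + h2 r) \<le> c * (\<eta> / (2 * c))" using c by (intro mult_left_mono) auto
    then have i12: "c * integral {s..T} (\<lambda>r. h1 r + h2 r) \<le> \<eta> / 2" using c by simp
    have "\<delta>\<^sup>2 * integral {s..T} C1 \<le> \<delta> * integral {s..T} C1"
      using \<delta> I0 by (intro mult_right_mono) (auto simp: power2_eq_square mult_le_one intro: mult_left_le)
    then have "8 * \<delta>\<^sup>2 * integral {s..T} C1 + 16 * (1 + R) * \<delta> * integral {s..T} C0 \<le> \<delta> * A"
      unfolding A_def by (simp add: algebra_simps)
    then have e: "8 * \<delta>\<^sup>2 * integral {s..T} C1 + 16 * (1 + R) * \<delta> * integral {s..T} C0
       + c * integral {s..T} (\<lambda>r. h1 r + h2 r) \<le> \<eta>" using i12 \<delta>A by linarith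
    have "(norm (X s - Y s))\<^sup>2 \<le> ((norm (X t - Y t))\<^sup>2 + (8 * \<delta>\<^sup>2 * integral {s..T} C1
    + 16 * (1 + R) * \<delta> * integral {s..T} C0 + c * integral {s..T} (\<lambda>r. h1 r + h2 r))) * Kexp"
      unfolding c_def
    proof (rule sol_comparison[OF X Y t h1(4) h2(4) h1(3) h2(3) _ _ \<delta> h12])
      show "norm (X r) \<le> R - 1" if "r \<in> {s..T}" for r
        using sol_bound[OF X _ _ h1(4) t \<rho>(1) that] by (simp add: R_def)
      show "norm (Y r) \<le> R - 1" if "r \<in> {s..T}" for r
        using sol_bound[OF Y _ _ h2(4) t \<rho>(2) that] by (simp add: R_def)
    qed
    also have "\<dots> \<le> ((norm (X t - Y t))\<^sup>2 + \<eta>) * Kexp"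
      using e Kexp_pos by (intro mult_right_mono add_left_mono) auto
    finally show "(norm (X s - Y s))\<^sup>2 \<le> ((norm (X t - Y t))\<^sup>2 + \<eta>) * Kexp" .
  qed
qed

section \<open>Approximating flows, their inverses, and the limit of the inverses\<close>

definition sol :: "nat \<Rightarrow> real \<Rightarrow> 'a \<Rightarrow> real \<Rightarrow> 'a" where
  "sol n \<tau> x = (SOME X. path_sol (f n) g s T X \<and> X \<tau> = x)"

lemma sol:
  assumes "\<tau> \<in> {s..T}"
  shows "path_sol (f n) g s T (sol n \<tau> x)" "sol n \<tau> x \<tau> = x"
proof -
  have "\<exists>X. path_sol (f n) g s T X \<and> X \<tau> = x"
    using sol_exists[OF lip growth_f assms] by blast
  from someI_ex[OF this] show "path_sol (f n) g s T (sol n \<tau> x)" "sol n \<tau> x \<tau> = x"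
    unfolding sol_def by blast+
qed

definition flow :: "nat \<Rightarrow> real \<Rightarrow> 'a \<Rightarrow> 'a" where "flow n t x = sol n s x t"
definition pullback :: "nat \<Rightarrow> real \<Rightarrow> 'a \<Rightarrow> 'a" where "pullback n t y = sol n t y s"

lemma s_in: "s \<in> {s..T}" using sT by simp

lemma flow_sol: "path_sol (f n) g s T (\<lambda>t. flow n t x)" "flow n s x = x"
  using sol[OF s_in] unfolding flow_def by auto

lemma flow_unique: "path_sol (f n) g s T X \<Longrightarrow> t \<in> {s..T} \<Longrightarrow> X t = flow n t (X s)"
  using sol_unique[OF _ flow_sol(1) _ _ lip s_in] flow_sol(2) by auto

lemma flow_pullback: "t \<in> {s..T} \<Longrightarrow> flow n t (pullback n t y) = y"
  using flow_unique[OF sol(1)] sol(2) unfolding pullback_def by metis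

lemma pullback_flow: "t \<in> {s..T} \<Longrightarrow> pullback n t (flow n t x) = x"
proof -
  assume t: "t \<in> {s..T}"
  have "sol n t (flow n t x) s = flow n s x"
    using sol_unique[OF sol(1)[OF t] flow_sol(1) _ _ lip t s_in] sol(2)[OF t] by auto
  then show ?thesis by (simp add: pullback_def flow_sol)
qed

lemma flow_bound: "t \<in> {s..T} \<Longrightarrow> norm x \<le> \<rho> \<Longrightarrow> norm (flow n t x) \<le> rad \<rho>"
  using sol_bound[OF flow_sol(1) _ _ growth_f s_in] flow_sol(2) by auto

lemma flow_continuous: "t \<in> {s..T} \<Longrightarrow> continuous_on UNIV (flow n t)"
proof -
  assume t: "t \<in> {s..T}"
  obtain L where L: "L absolutely_integrable_on {s..T}"
      "AE r in lebesgue. r \<in> {s..T} \<longrightarrow> lipschitz_on (L r) UNIV (f n r)"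
    using lip[of n] unfolding lip_field_def by blast
  have "lipschitz_on (exp (2 * integral {s..T} L)) UNIV (flow n t)"
    unfolding lipschitz_on_def
    using sol_lip_stable[OF flow_sol(1) flow_sol(1) _ _ L s_in t] by (auto simp: flow_sol(2) dist_norm mult.commute)
  then show ?thesis by (rule lipschitz_on_continuous_on)
qed

lemma pullback_close:
  assumes "0 < \<eta>"
  obtains N where "\<And>n m (y::'a) z t. \<lbrakk>n \<ge> N; m \<ge> N; t \<in> {s..T}; norm y \<le> \<rho>; norm z \<le> \<rho>\<rbrakk> \<Longrightarrow>
     (norm (pullback n t y - pullback m t z))\<^sup>2 \<le> ((norm (y - z))\<^sup>2 + \<eta>) * Kexp"
proof -
  obtain N where N: "\<And>F1 F2 X Y t. \<lbrakk>F1 \<in> insert b (f ` {N..}); F2 \<in> insert b (f ` {N..}); t \<in> {s..T};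
    path_sol F1 g s T X; path_sol F2 g s T Y; norm (X t) \<le> \<rho>; norm (Y t) \<le> \<rho>\<rbrakk>
    \<Longrightarrow> (norm (X s - Y s))\<^sup>2 \<le> ((norm (X t - Y t))\<^sup>2 + \<eta>) * Kexp"
    using comparison_uniform[OF assms] by blast
  show ?thesis
  proof (rule that[of N])
    fix n m t and y z :: 'a assume h: "n \<ge> N" "m \<ge> N" "t \<in> {s..T}" "norm y \<le> \<rho>" "norm z \<le> \<rho>"
    show "(norm (pullback n t y - pullback m t z))\<^sup>2 \<le> ((norm (y - z))\<^sup>2 + \<eta>) * Kexp"
      using N[of "f n" "f m" t "sol n t y" "sol m t z"] h sol[OF h(3)] unfolding pullback_def by auto
  qed
qed

text \<open>The map called \<open>S\<close> in the overview, one for each time \<open>t\<close>.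
  Unlike the limit of the forward flows it is obtained at every point.\<close>

definition blim :: "real \<Rightarrow> 'a \<Rightarrow> 'a" where "blim t y = lim (\<lambda>n. pullback n t y)"

lemma blim: "t \<in> {s..T} \<Longrightarrow> (\<lambda>n. pullback n t y) \<longlonglongrightarrow> blim t y"
proof -
  assume t: "t \<in> {s..T}"
  have "Cauchy (\<lambda>n. pullback n t y)"
  proof (rule CauchyI)
    fix e :: real assume e: "0 < e"
    then have "0 < e\<^sup>2 / (2 * Kexp)" using Kexp_pos by simp
    from pullback_close[OF this, of "norm y"] obtain N where
      N: "\<And>n m. n \<ge> N \<Longrightarrow> m \<ge> N \<Longrightarrow> (norm (pullback n t y - pullback m t y))\<^sup>2 \<le> (e\<^sup>2 / (2 * Kexp)) * Kexp"
      using t by (metis diff_self norm_zero power_zero_numeral add_0 order_refl)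
    have "norm (pullback n t y - pullback m t y) < e" if "n \<ge> N" "m \<ge> N" for n m
    proof -
      have "(norm (pullback n t y - pullback m t y))\<^sup>2 < e\<^sup>2" using order.strict_trans1[OF N[OF that], of "e\<^sup>2"] Kexp_pos e by simp
      then show ?thesis using e by (simp add: power_less_imp_less_base)
    qed
    then show "\<exists>N. \<forall>m\<ge>N. \<forall>n\<ge>N. norm (pullback m t y - pullback n t y) < e" by blast
  qed
  then show ?thesis unfolding blim_def using Cauchy_convergent convergent_LIMSEQ_iff by blast
qed

lemma blim_lipschitz: "t \<in> {s..T} \<Longrightarrow> norm (blim t y - blim t z) \<le> sqrt Kexp * norm (y - z)"
proof -
  assume t: "t \<in> {s..T}"
  have "(norm (blim t y - blim t z))\<^sup>2 \<le> (norm (y - z))\<^sup>2 * Kexp"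
  proof (rule field_le_epsilon)
    fix e :: real assume e: "0 < e"
    then have "0 < e / Kexp" using Kexp_pos by simp
    from pullback_close[OF this, of "max (norm y) (norm z)"] obtain N where
      N: "\<And>n m. n \<ge> N \<Longrightarrow> m \<ge> N \<Longrightarrow> (norm (pullback n t y - pullback m t z))\<^sup>2 \<le> ((norm (y - z))\<^sup>2 + e / Kexp) * Kexp"
      using t by (metis max.cobounded1 max.cobounded2)
    have "(\<lambda>n. (norm (pullback n t y - pullback n t z))\<^sup>2) \<longlonglongrightarrow> (norm (blim t y - blim t z))\<^sup>2"
      by (intro tendsto_intros blim t)
    then have "(norm (blim t y - blim t z))\<^sup>2 \<le> ((norm (y - z))\<^sup>2 + e / Kexp) * Kexp"
      by (rule LIMSEQ_le_const2) (use N in auto)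
    also have "\<dots> = (norm (y - z))\<^sup>2 * Kexp + e" using Kexp_pos by (simp add: field_simps)
    finally show "(norm (blim t y - blim t z))\<^sup>2 \<le> (norm (y - z))\<^sup>2 * Kexp + e" .
  qed
  then have "sqrt ((norm (blim t y - blim t z))\<^sup>2) \<le> sqrt ((norm (y - z))\<^sup>2 * Kexp)"
    by (rule real_sqrt_le_mono)
  then show ?thesis by (simp add: real_sqrt_mult mult.commute)
qed

text \<open>The estimate \<open>pullback_close\<close> is uniform on balls, so convergence persists
  when the argument moves with the index. Applied to \<open>z k = flow (r k) t x\<close> it shows
  that \<open>blim t\<close> sends every cluster point of the forward flows back to the starting
  point \<open>x\<close>.\<close>

lemma pullback_subseq_tendsto:
  assumes t: "t \<in> {s..T}" and r: "strict_mono (r :: nat \<Rightarrow> nat)" and z: "z \<longlonglongrightarrow> y"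
  shows "(\<lambda>k. pullback (r k) t (z k)) \<longlonglongrightarrow> blim t y"
proof -
  obtain \<rho> where \<rho>: "\<And>k. norm (z k) \<le> \<rho>"
    using Bseq_def z convergentI convergent_imp_Bseq by metis
  have y: "norm y \<le> \<rho>" by (rule LIMSEQ_le_const2[OF tendsto_norm[OF z]]) (use \<rho> in auto)
  have "(\<lambda>k. (norm (pullback (r k) t (z k) - pullback (r k) t y))\<^sup>2) \<longlonglongrightarrow> 0"
  proof (rule LIMSEQ_I)
    fix e :: real assume e: "0 < e"
    then have "0 < e / (2 * Kexp)" using Kexp_pos by simp
    from pullback_close[OF this, of \<rho>] obtain N where
      N: "\<And>n k. n \<ge> N \<Longrightarrow> (norm (pullback n t (z k) - pullback n t y))\<^sup>2 \<le> ((norm (z k - y))\<^sup>2 + e / (2 * Kexp)) * Kexp"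
      using t \<rho> y by metis
    have "(\<lambda>k. (norm (z k - y))\<^sup>2) \<longlonglongrightarrow> (norm (y - y))\<^sup>2" by (intro tendsto_intros z)
    then have "eventually (\<lambda>k. (norm (z k - y))\<^sup>2 < e / (2 * Kexp)) sequentially"
      by (rule order_tendstoD) (use e Kexp_pos in auto)
    then obtain M where M: "\<And>k. k \<ge> M \<Longrightarrow> (norm (z k - y))\<^sup>2 < e / (2 * Kexp)"
      unfolding eventually_sequentially by blast
    have "(norm (pullback (r k) t (z k) - pullback (r k) t y))\<^sup>2 < e" if "k \<ge> max N M" for k
    proof -
      have "r k \<ge> N" using seq_suble[OF r, of k] that by simp
      then have "(norm (pullback (r k) t (z k) - pullback (r k) t y))\<^sup>2 \<le> ((norm (z k - y))\<^sup>2 + e / (2 * Kexp)) * Kexp"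
        by (rule N)
      also have "\<dots> < (e / (2 * Kexp) + e / (2 * Kexp)) * Kexp"
        using M[of k] that Kexp_pos by (intro mult_strict_right_mono add_strict_right_mono) auto
      also have "\<dots> = e" using Kexp_pos by (simp add: field_simps)
      finally show ?thesis .
    qed
    then show "\<exists>no. \<forall>k\<ge>no. norm ((norm (pullback (r k) t (z k) - pullback (r k) t y))\<^sup>2 - 0) < e"
      by (intro exI[of _ "max N M"]) auto
  qed
  then have "(\<lambda>k. sqrt ((norm (pullback (r k) t (z k) - pullback (r k) t y))\<^sup>2)) \<longlonglongrightarrow> sqrt 0"
    by (rule tendsto_real_sqrt)
  then have "(\<lambda>k. pullback (r k) t (z k) - pullback (r k) t y) \<longlonglongrightarrow> 0"
    by (simp add: tendsto_norm_zero_iff)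
  from tendsto_add[OF this LIMSEQ_subseq_LIMSEQ[OF blim[OF t, of y] r]] show ?thesis by (simp add: comp_def)
qed

text \<open>The comparison estimate with one field equal to \<open>b\<close>, applied to the
  approximate solution that passes through \<open>Y t\<close> at time \<open>t\<close>. Thus every
  solution of the limit equation runs in the fibres of \<open>blim\<close> over its initial
  value.\<close>

lemma blim_of_b_solution:
  assumes t: "t \<in> {s..T}" and Y: "path_sol b g s T Y"
  shows "blim t (Y t) = Y s"
proof -
  have "(\<lambda>n. (norm (pullback n t (Y t) - Y s))\<^sup>2) \<longlonglongrightarrow> 0"
  proof (rule LIMSEQ_I)
    fix e :: real assume e: "0 < e"
    then have "0 < e / (2 * Kexp)" using Kexp_pos by simp
    from comparison_uniform[OF this, of "norm (Y t)"] obtain N where N: "\<And>F1 F2 X Y' u. \<lbrakk>F1 \<in> insert b (f ` {N..}); F2 \<in> insert b (f ` {N..}); u \<in> {s..T};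
    path_sol F1 g s T X; path_sol F2 g s T Y'; norm (X u) \<le> norm (Y t); norm (Y' u) \<le> norm (Y t)\<rbrakk>
    \<Longrightarrow> (norm (X s - Y' s))\<^sup>2 \<le> ((norm (X u - Y' u))\<^sup>2 + e / (2 * Kexp)) * Kexp" by blast
    have "(norm (pullback n t (Y t) - Y s))\<^sup>2 < e" if "n \<ge> N" for n
    proof -
      have "(norm (sol n t (Y t) s - Y s))\<^sup>2 \<le> ((norm (sol n t (Y t) t - Y t))\<^sup>2 + e / (2 * Kexp)) * Kexp"
        using that by (intro N[of "f n" b] sol(1) t Y) (auto simp: sol(2)[OF t])
      also have "\<dots> < e" using Kexp_pos e by (simp add: sol(2)[OF t] field_simps)
      finally show ?thesis by (simp add: pullback_def)
    qed
    then show "\<exists>no. \<forall>k\<ge>no. norm ((norm (pullback k t (Y t) - Y s))\<^sup>2 - 0) < e" by auto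
  qed
  moreover have "(\<lambda>n. (norm (pullback n t (Y t) - Y s))\<^sup>2) \<longlonglongrightarrow> (norm (blim t (Y t) - Y s))\<^sup>2"
    by (intro tendsto_intros blim t)
  ultimately have "(norm (blim t (Y t) - Y s))\<^sup>2 = 0" using LIMSEQ_unique by blast
  then show ?thesis by simp
qed

end

section \<open>Fibres of the limit of the inverse flows\<close>

lemma tendsto_of_cluster_unique:
  fixes z :: "nat \<Rightarrow> 'a::euclidean_space"
  assumes bd: "\<And>n. norm (z n) \<le> \<rho>"
    and unique: "\<And>r y. strict_mono r \<Longrightarrow> (z \<circ> r) \<longlonglongrightarrow> y \<Longrightarrow> y = l"
  shows "z \<longlonglongrightarrow> l"
proof (rule ccontr)
  assume "\<not> z \<longlonglongrightarrow> l"
  then obtain e where e: "e > 0" "\<not> eventually (\<lambda>n. dist (z n) l < e) sequentially"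
    unfolding tendsto_iff by blast
  then have "\<forall>N. \<exists>n\<ge>N. dist (z n) l \<ge> e"
    unfolding eventually_sequentially by (metis not_le)
  then have "infinite {n. dist (z n) l \<ge> e}" by (simp add: infinite_nat_iff_unbounded_le)
  from infinite_enumerate[OF this] obtain r :: "nat \<Rightarrow> nat"
    where r: "strict_mono r" "\<And>k. dist (z (r k)) l \<ge> e" by auto
  have "bounded (range (z \<circ> r))" using bd by (auto simp: bounded_iff)
  then obtain l' q where q: "strict_mono q" "((z \<circ> r) \<circ> q) \<longlonglongrightarrow> l'"
    using bounded_imp_convergent_subsequence by blast
  have "l' = l" by (rule unique[of "r \<circ> q"]) (use r q in \<open>auto simp: strict_mono_o o_assoc\<close>)
  then have "(\<lambda>k. dist (z (r (q k))) l) \<longlonglongrightarrow> dist l l"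
    using q(2) by (intro tendsto_intros) (simp_all add: comp_def)
  then have "e \<le> dist l l" by (rule LIMSEQ_le_const) (use r in auto)
  then show False using e by simp
qed

text \<open>Hyperplanes are negligible, Lipschitz maps of a space into itself keep this, and
  rational heights leave countably many of them. The set \<open>D\<close> is there for the resolvent
  of a monotone map, which is controlled only on its domain.\<close>

lemma negligible_UN_rational_hyperplanes:
  fixes S :: "'a::euclidean_space \<Rightarrow> 'a"
  assumes lip: "\<And>y z. y \<in> D \<Longrightarrow> z \<in> D \<Longrightarrow> norm (S y - S z) \<le> L * norm (y - z)"
  shows "negligible (\<Union>i\<in>Basis. \<Union>c\<in>\<rat>. S ` {y \<in> D. y \<bullet> i = c})"
proof -
  have "negligible (S ` {y \<in> D. y \<bullet> i = c})" if "i \<in> Basis" for i c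
  proof (rule negligible_locally_Lipschitz_image)
    show "negligible {y \<in> D. y \<bullet> i = c}"
      using negligible_standard_hyperplane[OF that, of c]
      by (rule negligible_subset) (auto simp: inner_commute)
    fix x assume "x \<in> {y \<in> D. y \<bullet> i = c}"
    then show "\<exists>T B. open T \<and> x \<in> T \<and> (\<forall>y\<in>{y \<in> D. y \<bullet> i = c} \<inter> T. norm (S y - S x) \<le> B * norm (y - x))"
      using lip by (intro exI[of _ UNIV] exI[of _ L]) auto
  qed simp
  then show ?thesis
    by (intro negligible_countable_Union)
      (auto intro!: negligible_countable_Union countable_image countable_rat simp: countable_finite)
qed

lemma ex_rational_hyperplane_between:
  fixes y z :: "'a::euclidean_space"
  assumes "y \<noteq> z"
  obtains i c where "i \<in> Basis" "c \<in> \<rat>" "y \<bullet> i < c \<and> c < z \<bullet> i \<or> z \<bullet> i < c \<and> c < y \<bullet> i"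
proof -
  obtain i where i: "i \<in> Basis" "y \<bullet> i \<noteq> z \<bullet> i" using assms euclidean_eqI by blast
  then consider "y \<bullet> i < z \<bullet> i" | "z \<bullet> i < y \<bullet> i" by linarith
  then show ?thesis
  proof cases
    case 1
    from Rats_dense_in_real[OF this] that i show ?thesis by blast
  next
    case 2
    from Rats_dense_in_real[OF this] that i show ?thesis by blast
  qed
qed

context flow_limit begin

definition badset :: "real \<Rightarrow> 'a set" where
  "badset t = (\<Union>i\<in>Basis. \<Union>c\<in>\<rat>. blim t ` {y. y \<bullet> i = c})"

lemma negligible_badset: "t \<in> {s..T} \<Longrightarrow> negligible (badset t)"
  using negligible_UN_rational_hyperplanes[of UNIV "blim t" "sqrt Kexp"] blim_lipschitz
  unfolding badset_def by simp

lemma blim_fibre: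
  assumes t: "t \<in> {s..T}" and x: "x \<notin> badset t" and y: "blim t y = x" "blim t y' = x"
  shows "y = y'"
proof (rule ccontr)
  assume "y \<noteq> y'"
  then obtain i c where i: "i \<in> Basis" "c \<in> \<rat>" and
     c: "y \<bullet> i < c \<and> c < y' \<bullet> i \<or> y' \<bullet> i < c \<and> c < y \<bullet> i"
    by (rule ex_rational_hyperplane_between)
  obtain p q where pq: "blim t p = x" "blim t q = x" "p \<bullet> i < c" "c < q \<bullet> i"
    using c y by blast
  \<comment> \<open>The flow maps the segment joining the two pullbacks to a curve from
    \<open>p\<close> to \<open>q\<close>, which must cross the hyperplane, while the segment itself
    shrinks to \<open>x\<close>.\<close>
  have "\<exists>v. v \<in> closed_segment (pullback n t p) (pullback n t q) \<and> flow n t v \<bullet> i = c" for n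
  proof -
    let ?u = "pullback n t p" and ?v = "pullback n t q"
    have "\<exists>\<tau>\<ge>0. \<tau> \<le> 1 \<and> flow n t (linepath ?u ?v \<tau>) \<bullet> i = c"
    proof (rule IVT')
      show "continuous_on {0..1} (\<lambda>\<tau>. flow n t (linepath ?u ?v \<tau>) \<bullet> i)"
        by (intro continuous_intros continuous_on_compose2[OF flow_continuous[OF t]]) auto
    qed (use pq flow_pullback[OF t] in \<open>auto simp: linepath_def\<close>)
    then show ?thesis by (metis atLeastAtMost_iff linepath_in_path)
  qed
  then obtain v where v: "\<And>n. v n \<in> closed_segment (pullback n t p) (pullback n t q)" "\<And>n. flow n t (v n) \<bullet> i = c"
    by metis
  have vlim: "v \<longlonglongrightarrow> x"
  proof (rule Lim_null_comparison[THEN LIM_zero_cancel])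
    show "eventually (\<lambda>n. norm (v n - x) \<le> norm (pullback n t p - x) + norm (pullback n t q - x)) sequentially"
    proof (intro always_eventually allI)
      fix n
      have "norm (v n - x) \<le> norm (pullback n t p - x) \<or> norm (v n - x) \<le> norm (pullback n t q - x)"
        using segment_furthest_le[OF v(1)[of n], of x] by (simp add: norm_minus_commute)
      then show "norm (v n - x) \<le> norm (pullback n t p - x) + norm (pullback n t q - x)"
        by (smt (verit) norm_ge_zero)
    qed
    have "(\<lambda>n. norm (pullback n t p - x) + norm (pullback n t q - x)) \<longlonglongrightarrow> norm (blim t p - x) + norm (blim t q - x)"
      by (intro tendsto_intros blim t)
    then show "(\<lambda>n. norm (pullback n t p - x) + norm (pullback n t q - x)) \<longlonglongrightarrow> 0" by (simp add: pq)
  qed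
  then obtain \<rho> where \<rho>: "\<And>n. norm (v n) \<le> \<rho>"
    using Bseq_def convergentI convergent_imp_Bseq by metis
  have "bounded (range (\<lambda>n. flow n t (v n)))"
    using flow_bound[OF t \<rho>] by (auto simp: bounded_iff)
  then obtain z r where r: "strict_mono r" and z: "((\<lambda>n. flow n t (v n)) \<circ> r) \<longlonglongrightarrow> z"
    using bounded_imp_convergent_subsequence by blast
  \<comment> \<open>The crossing points \<open>flow n t (v n)\<close> cluster at \<open>z\<close>,
    and their pullbacks are the points \<open>v n\<close>, which tend to \<open>x\<close>.\<close>
  from pullback_subseq_tendsto[OF t r z] have "(\<lambda>k. v (r k)) \<longlonglongrightarrow> blim t z"
    by (simp add: pullback_flow[OF t] comp_def)
  moreover have "(\<lambda>k. v (r k)) \<longlonglongrightarrow> x" using LIMSEQ_subseq_LIMSEQ[OF vlim r] by (simp add: comp_def)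
  ultimately have "blim t z = x" using LIMSEQ_unique by blast
  moreover have "z \<bullet> i = c"
  proof -
    have "(\<lambda>k. flow (r k) t (v (r k)) \<bullet> i) \<longlonglongrightarrow> z \<bullet> i"
      using z by (intro tendsto_intros) (simp add: comp_def)
    then show ?thesis using v(2) LIMSEQ_unique[OF _ tendsto_const] by simp
  qed
  ultimately have "x \<in> badset t" unfolding badset_def using i by blast
  then show False using x by blast
qed

section \<open>Convergence of the forward flows off a null set\<close>

definition flim :: "real \<Rightarrow> 'a \<Rightarrow> 'a" where "flim t x = lim (\<lambda>n. flow n t x)"

text \<open>Compactness takes the place of a forward estimate: the values are bounded, and all their
  cluster points lie in the fibre of \<open>blim t\<close> over \<open>x\<close>, which is a single
  point.\<close>

lemma flow_tendsto:
  assumes t: "t \<in> {s..T}" and x: "x \<notin> badset t"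
  shows "(\<lambda>n. flow n t x) \<longlonglongrightarrow> flim t x" "blim t (flim t x) = x"
proof -
  have bd: "norm (flow n t x) \<le> rad (norm x)" for n by (rule flow_bound[OF t]) simp
  have cl: "blim t y = x" if r: "strict_mono r" and y: "((\<lambda>n. flow n t x) \<circ> r) \<longlonglongrightarrow> y" for r y
    using pullback_subseq_tendsto[OF t r y] LIMSEQ_unique[OF _ tendsto_const]
    by (simp add: comp_def pullback_flow[OF t])
  have "bounded (range (\<lambda>n. flow n t x))" using bd by (auto simp: bounded_iff)
  then obtain l r where l: "strict_mono r" "((\<lambda>n. flow n t x) \<circ> r) \<longlonglongrightarrow> l"
    using bounded_imp_convergent_subsequence by blast
  have "(\<lambda>n. flow n t x) \<longlonglongrightarrow> l"
    by (rule tendsto_of_cluster_unique[OF bd]) (use cl l blim_fibre[OF t x] in blast)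
  moreover from this have "flim t x = l" unfolding flim_def by (rule limI)
  ultimately show "(\<lambda>n. flow n t x) \<longlonglongrightarrow> flim t x" "blim t (flim t x) = x"
    using cl[OF l] by auto
qed

text \<open>The uniform modulus of continuity in time reduces everything to rational times.\<close>

definition bad :: "'a set" where "bad = (\<Union>t\<in>(\<rat> \<inter> {s..T}). badset t)"

lemma negligible_bad: "negligible bad"
  unfolding bad_def using negligible_badset
  by (intro negligible_countable_Union) (auto simp: countable_rat intro!: countable_Int1)

lemma flow_uniform_modulus:
  assumes "norm x \<le> \<rho>" "s \<le> u" "u \<le> v" "v \<le> T"
  shows "norm (flow n v x - flow n u x) \<le> rad \<rho> * integral {u..v} C0 + norm (g v - g u)"
  using sol_modulus[OF flow_sol(1) _ _ growth_f s_in _ assms(2-4)] assms(1) flow_sol(2) by auto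

text \<open>The modulus depends only on \<open>C0\<close>, \<open>g\<close> and
  \<open>\<rho>\<close>; the continuous curve \<open>G\<close> bundles its two terms, and its
  uniform continuity gives \<open>d\<close>.\<close>

lemma flow_equicontinuous:
  assumes "0 < e"
  obtains d where "0 < d" "\<And>n u v x. norm x \<le> \<rho> \<Longrightarrow> u \<in> {s..T} \<Longrightarrow> v \<in> {s..T} \<Longrightarrow> \<bar>u - v\<bar> < d \<Longrightarrow>
    norm (flow n v x - flow n u x) < e"
proof -
  define G where "G t = (rad \<rho> * integral {s..t} C0, g t)" for t
  have "continuous_on {s..T} G"
    unfolding G_def by (intro continuous_intros continuous_indefinite C0 g)
  then have "uniformly_continuous_on {s..T} G" by (intro compact_uniformly_continuous) auto
  then obtain d where d: "0 < d" "\<And>u v. u \<in> {s..T} \<Longrightarrow> v \<in> {s..T} \<Longrightarrow> dist v u < d \<Longrightarrow> dist (G v) (G u) < e / 2"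
    using assms unfolding uniformly_continuous_on_def by (meson half_gt_zero)
  have main: "norm (flow n v x - flow n u x) < e"
    if h: "norm x \<le> \<rho>" "u \<in> {s..T}" "v \<in> {s..T}" "\<bar>u - v\<bar> < d" "u \<le> v" for n u v x
  proof -
    have D: "dist (G v) (G u) < e / 2" using d(2)[of u v] h by (simp add: dist_real_def)
    have "norm (flow n v x - flow n u x) \<le> rad \<rho> * integral {u..v} C0 + norm (g v - g u)"
      using h by (intro flow_uniform_modulus) auto
    also have "rad \<rho> * integral {u..v} C0 = fst (G v) - fst (G u)"
      using integral_diff_abs_int[OF C0, of u v] h by (simp add: G_def algebra_simps flip: distrib_left)
    also have "\<dots> \<le> dist (G v) (G u)" using dist_fst_le[of "G v" "G u"] by (simp add: dist_real_def)
    also have "norm (g v - g u) \<le> dist (G v) (G u)" using dist_snd_le[of "G v" "G u"] by (simp add: dist_norm G_def)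
    finally show ?thesis using D by simp
  qed
  show ?thesis
  proof (rule that[OF d(1)])
    fix n u v and x :: 'a assume h: "norm x \<le> \<rho>" "u \<in> {s..T}" "v \<in> {s..T}" "\<bar>u - v\<bar> < d"
    then show "norm (flow n v x - flow n u x) < e"
      using main[of x u v n] main[of x v u n] by (cases "u \<le> v") (auto simp: norm_minus_commute abs_minus_commute)
  qed
qed

lemma rational_net:
  assumes "0 < d"
  obtains Q where "finite Q" "Q \<subseteq> \<rat> \<inter> {s..T}" "\<And>t. t \<in> {s..T} \<Longrightarrow> \<exists>q\<in>Q. \<bar>t - q\<bar> < d"
proof -
  have cov: "\<exists>q\<in>\<rat> \<inter> {s..T}. \<bar>t - q\<bar> < d" if t: "t \<in> {s..T}" for t
  proof -
    have "max s (t - d) < min T (t + d)" using t sT assms by auto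
    from Rats_dense_in_real[OF this] obtain q where q: "q \<in> \<rat>" "max s (t - d) < q" "q < min T (t + d)" by blast
    then show ?thesis by (intro bexI[of _ q]) auto
  qed
  have "{s..T} \<subseteq> (\<Union>q\<in>\<rat> \<inter> {s..T}. ball q d)"
    using cov by (force simp: dist_real_def abs_minus_commute)
  then obtain Q where Q: "Q \<subseteq> \<rat> \<inter> {s..T}" "finite Q" "{s..T} \<subseteq> (\<Union>q\<in>Q. ball q d)"
    using compactE_image[OF compact_Icc, of "\<rat> \<inter> {s..T}" "\<lambda>q. ball q d"] by (metis open_ball)
  show ?thesis
  proof (rule that[OF Q(2,1)])
    fix t assume "t \<in> {s..T}"
    with Q(3) obtain q where "q \<in> Q" "t \<in> ball q d" by blast
    then show "\<exists>q\<in>Q. \<bar>t - q\<bar> < d" by (auto simp: dist_real_def abs_minus_commute)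
  qed
qed

text \<open>The usual argument for equicontinuous sequences: convergence at the finitely many times
  of a rational net controls all times.\<close>

lemma flow_uniform_limit:
  assumes x: "x \<notin> bad"
  shows "uniform_limit {s..T} (\<lambda>n t. flow n t x) (\<lambda>t. flim t x) sequentially"
proof -
  have "uniformly_Cauchy_on {s..T} (\<lambda>n t. flow n t x)"
  proof (rule uniformly_Cauchy_onI)
    fix e :: real assume e: "0 < e"
    then have "0 < e / 3" by simp
    from flow_equicontinuous[OF this, of "norm x"] obtain d where
      d: "0 < d" "\<And>n u v. u \<in> {s..T} \<Longrightarrow> v \<in> {s..T} \<Longrightarrow> \<bar>u - v\<bar> < d \<Longrightarrow> norm (flow n v x - flow n u x) < e / 3"
      by (metis order_refl)
    from rational_net[OF d(1)] obtain Q where Q: "finite Q" "Q \<subseteq> \<rat> \<inter> {s..T}" "\<And>t. t \<in> {s..T} \<Longrightarrow> \<exists>q\<in>Q. \<bar>t - q\<bar> < d"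
      by blast
    have "\<exists>N. \<forall>m\<ge>N. \<forall>n\<ge>N. dist (flow m q x) (flow n q x) < e / 3" if "q \<in> Q" for q
    proof -
      have "q \<in> {s..T}" "x \<notin> badset q" using that Q(2) x unfolding bad_def by auto
      from flow_tendsto(1)[OF this] have "Cauchy (\<lambda>n. flow n q x)" by (rule LIMSEQ_imp_Cauchy)
      then show ?thesis using \<open>0 < e / 3\<close> unfolding Cauchy_def by blast
    qed
    then obtain N where N: "\<And>q m n. q \<in> Q \<Longrightarrow> m \<ge> N q \<Longrightarrow> n \<ge> N q \<Longrightarrow> dist (flow m q x) (flow n q x) < e / 3"
      by metis
    define M where "M = Max (insert 0 (N ` Q))"
    have M: "N q \<le> M" if "q \<in> Q" for q unfolding M_def using Q(1) that by (intro Max_ge) auto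
    have "dist (flow m t x) (flow n t x) < e" if "t \<in> {s..T}" "m \<ge> M" "n \<ge> M" for t m n
    proof -
      obtain q where q: "q \<in> Q" "\<bar>t - q\<bar> < d" using Q(3)[OF \<open>t \<in> {s..T}\<close>] by blast
      then have qs: "q \<in> {s..T}" using Q(2) by auto
      have "norm (flow k t x - flow k q x) < e / 3" for k
        using q qs that by (intro d(2)) (auto simp: abs_minus_commute)
      moreover have "dist (flow m q x) (flow n q x) < e / 3" using N[OF q(1)] M[OF q(1)] that by force
      ultimately have "dist (flow m t x) (flow m q x) < e / 3" "dist (flow m q x) (flow n q x) < e / 3"
         "dist (flow n q x) (flow n t x) < e / 3" by (auto simp: dist_norm norm_minus_commute)
      then show ?thesis
        using dist_triangle[of "flow m t x" "flow n t x" "flow m q x"] dist_triangle[of "flow m q x" "flow n t x" "flow n q x"]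
        by linarith
    qed
    then show "\<exists>M. \<forall>t\<in>{s..T}. \<forall>m\<ge>M. \<forall>n\<ge>M. dist (flow m t x) (flow n t x) < e" by blast
  qed
  then show ?thesis
    unfolding flim_def using Cauchy_uniformly_convergent uniformly_convergent_uniform_limit_iff by blast
qed

lemma flow_tendsto_all: "x \<notin> bad \<Longrightarrow> t \<in> {s..T} \<Longrightarrow> (\<lambda>n. flow n t x) \<longlonglongrightarrow> flim t x"
  using tendsto_uniform_limitI[OF flow_uniform_limit] by blast

lemma flim_continuous: "x \<notin> bad \<Longrightarrow> continuous_on {s..T} (\<lambda>t. flim t x)"
  by (rule uniform_limit_theorem[OF _ flow_uniform_limit])
     (auto intro!: always_eventually path_sol_continuous[OF flow_sol(1)] g)

text \<open>At a rational time both points lie in the same one-point fibre of \<open>blim\<close>,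
  and continuity covers the other times. This is the source of uniqueness, and it makes the limit
  independent of the approximating sequence.\<close>

lemma b_solution_eq_flim:
  assumes Y: "path_sol b g s T Y" and bad: "Y s \<notin> bad" and t: "t \<in> {s..T}"
  shows "Y t = flim t (Y s)"
proof -
  have eq: "Y q = flim q (Y s)" if "q \<in> \<rat> \<inter> {s..T}" for q
  proof -
    have q: "q \<in> {s..T}" "Y s \<notin> badset q" using that bad unfolding bad_def by auto
    show ?thesis
      by (rule blim_fibre[OF q blim_of_b_solution[OF q(1) Y] flow_tendsto(2)[OF q]])
  qed
  have cont: "continuous_on {s..T} (\<lambda>t. Y t - flim t (Y s))"
    by (intro continuous_intros path_sol_continuous[OF Y] g flim_continuous bad)
  have "norm (Y t - flim t (Y s)) \<le> 0"
  proof (rule field_le_epsilon)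
    fix e :: real assume e: "0 < e"
    then obtain d where d: "0 < d" "\<And>u. u \<in> {s..T} \<Longrightarrow> dist u t < d \<Longrightarrow> dist (Y u - flim u (Y s)) (Y t - flim t (Y s)) < e"
      using cont t unfolding continuous_on_iff by meson
    obtain Q where Q: "Q \<subseteq> \<rat> \<inter> {s..T}" "\<And>t. t \<in> {s..T} \<Longrightarrow> \<exists>q\<in>Q. \<bar>t - q\<bar> < d"
      using rational_net[OF d(1)] by metis
    then obtain q where q: "q \<in> \<rat> \<inter> {s..T}" "\<bar>t - q\<bar> < d" using t by blast
    then have "dist q t < d" "q \<in> {s..T}" by (auto simp: dist_real_def)
    from d(2)[OF this(2,1)] eq[OF q(1)] show "norm (Y t - flim t (Y s)) \<le> 0 + e"
      by (simp add: dist_norm norm_minus_commute)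
  qed
  then show ?thesis by simp
qed

end

section \<open>One-sided Lipschitz maps and mollification\<close>

text \<open>\<open>A\<close> enlarges \<open>F\<close> to a set-valued monotone map with convex
  values, and its resolvent \<open>J\<close>, the inverse of identity plus \<open>A\<close>, is
  nonexpansive. A point with two values of \<open>A\<close> is the image under \<open>J\<close> of a
  whole segment, which crosses a rational hyperplane; such points form a null set. Where
  \<open>A\<close> has one value, \<open>F\<close> is continuous.\<close>

lemma monotone_isCont_ae:
  fixes F :: "'a::euclidean_space \<Rightarrow> 'a"
  assumes mono: "\<And>x y. 0 \<le> (F x - F y) \<bullet> (x - y)"
    and bound: "\<And>x. norm (F x) \<le> B * (1 + norm x)"
  shows "negligible {x. \<not> isCont F x}"
proof -
  define A where "A x = {v. \<forall>y. 0 \<le> (v - F y) \<bullet> (x - y)}" for x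
  have FA: "F x \<in> A x" for x unfolding A_def using mono by blast
  have A_mono: "0 \<le> (v - w) \<bullet> (x - y)" if v: "v \<in> A x" and w: "w \<in> A y" for v w x y
  proof -
    \<comment> \<open>Both values are tested against \<open>F\<close> at the midpoint. The two
      inequalities then point in opposite directions along \<open>x - y\<close>, and adding them
      cancels \<open>F z\<close>.\<close>
    define z where "z = (1/2) *\<^sub>R (x + y)"
    have zx: "x - z = (1/2) *\<^sub>R (x - y)" and zy: "y - z = (1/2) *\<^sub>R (y - x)"
      unfolding z_def by (simp_all add: algebra_simps) (simp_all flip: scaleR_add_left)
    have "0 \<le> (v - F z) \<bullet> (x - z)" "0 \<le> (w - F z) \<bullet> (y - z)" using v w unfolding A_def by blast+
    then have "0 \<le> (v - F z) \<bullet> (x - y)" "0 \<le> (w - F z) \<bullet> (y - x)" unfolding zx zy by simp_all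
    then show ?thesis by (simp add: inner_simps)
  qed
  have A_convex: "(1 - l) *\<^sub>R v + l *\<^sub>R w \<in> A x" if "v \<in> A x" "w \<in> A x" "0 \<le> l" "l \<le> 1" for v w x l
  proof -
    have "0 \<le> ((1 - l) *\<^sub>R v + l *\<^sub>R w - F y) \<bullet> (x - y)" for y
    proof -
      have "((1 - l) *\<^sub>R v + l *\<^sub>R w - F y) \<bullet> (x - y) = (1 - l) * ((v - F y) \<bullet> (x - y)) + l * ((w - F y) \<bullet> (x - y))"
        by (simp add: inner_simps algebra_simps)
      also have "0 \<le> \<dots>" using that unfolding A_def by (intro add_nonneg_nonneg mult_nonneg_nonneg) auto
      finally show ?thesis .
    qed
    then show ?thesis unfolding A_def by blast
  qed
  \<comment> \<open>The choice in \<open>J\<close> is meaningful exactly on \<open>D\<close>, hence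
    the intersection of the hyperplanes with \<open>D\<close>.\<close>
  define D where "D = {u. \<exists>x. u - x \<in> A x}"
  define J where "J u = (SOME x. u - x \<in> A x)" for u
  have J: "u - J u \<in> A (J u)" if "u \<in> D" for u
    using that someI_ex[of "\<lambda>x. u - x \<in> A x"] unfolding D_def J_def by blast
  have contr: "norm (x - y) \<le> norm (u - w)" if "u - x \<in> A x" "w - y \<in> A y" for u w x y
  proof -
    have "0 \<le> ((u - x) - (w - y)) \<bullet> (x - y)" using A_mono[OF that] .
    then have "(norm (x - y))\<^sup>2 \<le> (u - w) \<bullet> (x - y)" by (simp add: power2_norm_eq_inner inner_simps algebra_simps)
    also have "\<dots> \<le> norm (u - w) * norm (x - y)" by (rule norm_cauchy_schwarz)
    finally show ?thesis by (cases "norm (x - y) = 0") (auto simp: power2_eq_square)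
  qed
  have neg: "negligible (\<Union>i\<in>Basis. \<Union>c\<in>\<rat>. J ` {y \<in> D. y \<bullet> i = c})"
    by (rule negligible_UN_rational_hyperplanes[where L=1]) (use contr J in auto)
  have sub: "{x. \<exists>v\<in>A x. v \<noteq> F x} \<subseteq> (\<Union>i\<in>Basis. \<Union>c\<in>\<rat>. J ` {y \<in> D. y \<bullet> i = c})"
  proof clarify
    fix x v assume v: "v \<in> A x" "v \<noteq> F x"
    then have "x + v \<noteq> x + F x" by simp
    then obtain i c where i: "i \<in> Basis" "c \<in> \<rat>" and
      "(x + v) \<bullet> i < c \<and> c < (x + F x) \<bullet> i \<or> (x + F x) \<bullet> i < c \<and> c < (x + v) \<bullet> i"
      by (rule ex_rational_hyperplane_between)
    then obtain p q where pq: "p \<in> A x" "q \<in> A x" "(x + p) \<bullet> i < c" "c < (x + q) \<bullet> i"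
      using v(1) FA by blast
    define l where "l = (c - (x + p) \<bullet> i) / ((x + q) \<bullet> i - (x + p) \<bullet> i)"
    have l: "0 \<le> l" "l \<le> 1" unfolding l_def using pq by (auto simp: divide_le_eq)
    define u where "u = x + ((1 - l) *\<^sub>R p + l *\<^sub>R q)"
    have "u - x \<in> A x" unfolding u_def using A_convex[OF pq(1,2) l] by simp
    then have uD: "u \<in> D" unfolding D_def by blast
    have "u \<bullet> i = (x + p) \<bullet> i + l * ((x + q) \<bullet> i - (x + p) \<bullet> i)"
      unfolding u_def by (simp add: inner_simps algebra_simps)
    also have "\<dots> = c" unfolding l_def using pq by simp
    finally have "u \<bullet> i = c" .
    moreover have "J u = x" using contr[OF J[OF uD] \<open>u - x \<in> A x\<close>] by simp
    ultimately show "x \<in> (\<Union>i\<in>Basis. \<Union>c\<in>\<rat>. J ` {y \<in> D. y \<bullet> i = c})" using i uD by blast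
  qed
  \<comment> \<open>Limits of values of \<open>F\<close> along a sequence tending to
    \<open>x\<close> inherit the inequalities defining \<open>A x\<close>. The values are bounded,
    so \<open>F x\<close> as the only possible cluster point is their limit.\<close>
  have "isCont F x" if single: "\<And>v. v \<in> A x \<Longrightarrow> v = F x" for x
    unfolding continuous_at_sequentially
  proof (intro allI impI)
    fix z assume z: "z \<longlonglongrightarrow> x"
    obtain \<rho> where \<rho>: "\<And>n. norm (z n) \<le> \<rho>" using Bseq_def z convergentI convergent_imp_Bseq by metis
    show "(F \<circ> z) \<longlonglongrightarrow> F x"
    proof (rule tendsto_of_cluster_unique)
      show "norm ((F \<circ> z) n) \<le> \<bar>B\<bar> * (1 + \<rho>)" for n
      proof -
        have "norm (F (z n)) \<le> B * (1 + norm (z n))" by (rule bound)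
        also have "\<dots> \<le> \<bar>B\<bar> * (1 + \<rho>)" using \<rho>[of n] by (intro mult_mono) auto
        finally show ?thesis by simp
      qed
      fix r and v assume r: "strict_mono (r :: nat \<Rightarrow> nat)" and v: "((F \<circ> z) \<circ> r) \<longlonglongrightarrow> v"
      have "0 \<le> (v - F y) \<bullet> (x - y)" for y
      proof (rule LIMSEQ_le_const)
        show "(\<lambda>k. (F (z (r k)) - F y) \<bullet> (z (r k) - y)) \<longlonglongrightarrow> (v - F y) \<bullet> (x - y)"
          using v LIMSEQ_subseq_LIMSEQ[OF z r] by (intro tendsto_intros) (simp_all add: comp_def)
      qed (use mono in auto)
      then show "v = F x" by (intro single) (simp add: A_def)
    qed
  qed
  then have "{x. \<not> isCont F x} \<subseteq> {x. \<exists>v\<in>A x. v \<noteq> F x}" by blast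
  then show ?thesis by (rule negligible_subset[OF neg subset_trans[OF _ sub]])
qed

text \<open>Adding \<open>c\<close> times the identity makes \<open>f\<close> monotone and changes
  neither its continuity points nor linear growth.\<close>

lemma one_sided_isCont_ae:
  fixes f :: "'a::euclidean_space \<Rightarrow> 'a"
  assumes os: "\<And>x y. - c * (norm (x - y))\<^sup>2 \<le> (f x - f y) \<bullet> (x - y)"
    and bound: "\<And>x. norm (f x) \<le> B * (1 + norm x)"
  shows "negligible {x. \<not> isCont f x}"
proof -
  have "negligible {x. \<not> isCont (\<lambda>x. f x + c *\<^sub>R x) x}"
  proof (rule monotone_isCont_ae)
    fix x y
    have "(f x + c *\<^sub>R x - (f y + c *\<^sub>R y)) \<bullet> (x - y) = (f x - f y) \<bullet> (x - y) + c * (norm (x - y))\<^sup>2"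
      by (simp add: power2_norm_eq_inner inner_simps algebra_simps)
    then show "0 \<le> (f x + c *\<^sub>R x - (f y + c *\<^sub>R y)) \<bullet> (x - y)" using os[of x y] by simp
    have "norm (f x + c *\<^sub>R x) \<le> B * (1 + norm x) + \<bar>c\<bar> * norm x"
      using bound[of x] norm_triangle_ineq[of "f x" "c *\<^sub>R x"] by simp
    also have "\<dots> \<le> (B + \<bar>c\<bar>) * (1 + norm x)" by (simp add: algebra_simps)
    finally show "norm (f x + c *\<^sub>R x) \<le> (B + \<bar>c\<bar>) * (1 + norm x)" .
  qed
  moreover have "isCont f x" if "isCont (\<lambda>x. f x + c *\<^sub>R x) x" for x
  proof -
    have "isCont (\<lambda>x. (f x + c *\<^sub>R x) - c *\<^sub>R x) x" by (rule continuous_diff[OF that]) (intro continuous_intros)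
    then show ?thesis by simp
  qed
  then have "{x. \<not> isCont f x} \<subseteq> {x. \<not> isCont (\<lambda>x. f x + c *\<^sub>R x) x}" by blast
  with calculation show ?thesis by (rule negligible_subset)
qed

section \<open>Mollification with a tent kernel\<close>

lemma AE_translate:
  fixes x :: "'a::euclidean_space"
  assumes "AE z in lborel. P z"
  shows "AE w in lborel. P (x + w)"
proof -
  have "negligible {z. \<not> P z}"
    using assms by (simp add: AE_lborel_iff_negligible)
  then have "negligible ((+) (- x) ` {z. \<not> P z})" by (rule negligible_translation)
  moreover have "{w. \<not> P (x + w)} \<subseteq> (+) (- x) ` {z. \<not> P z}"
  proof
    fix w assume "w \<in> {w. \<not> P (x + w)}"
    then show "w \<in> (+) (- x) ` {z. \<not> P z}" by (intro image_eqI[of _ _ "x + w"]) auto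
  qed
  ultimately show ?thesis
    unfolding AE_lborel_iff_negligible by (rule negligible_subset)
qed

text \<open>A tent with Lipschitz constant 1 and support in the ball of radius
  \<open>\<delta>\<close>: the approximating fields only have to be Lipschitz. It is left
  unnormalised, and \<open>mollify\<close> divides by its integral.\<close>

definition bump :: "real \<Rightarrow> 'a::euclidean_space \<Rightarrow> real" where "bump \<delta> z = max 0 (\<delta> - norm z)"

definition mollify :: "real \<Rightarrow> ('a::euclidean_space \<Rightarrow> 'a) \<Rightarrow> 'a \<Rightarrow> 'a" where
  "mollify \<delta> f x = (1 / (\<integral>z. bump \<delta> (z::'a) \<partial>lborel)) *\<^sub>R (\<integral>z. bump \<delta> (z - x) *\<^sub>R f z \<partial>lborel)"

lemma bump_nonneg: "0 \<le> bump \<delta> z" by (simp add: bump_def)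
lemma bump_le: "0 \<le> \<delta> \<Longrightarrow> bump \<delta> z \<le> \<delta>" by (simp add: bump_def)
lemma bump_eq_0: "\<delta> < norm z \<Longrightarrow> bump \<delta> z = 0" by (simp add: bump_def)
lemma bump_measurable[measurable]: "bump \<delta> \<in> borel_measurable borel" unfolding bump_def by measurable
lemma bump_diff: "\<bar>bump \<delta> z - bump \<delta> w\<bar> \<le> norm (z - w)"
  using norm_triangle_ineq3[of z w] unfolding bump_def by (auto simp: max_def abs_if split: if_splits)

lemma lborel_integral_translate:
  fixes f :: "'a::euclidean_space \<Rightarrow> 'b::{banach, second_countable_topology}"
  assumes [measurable]: "f \<in> borel_measurable borel"
  shows "(\<integral>w. f (x + w) \<partial>lborel) = (\<integral>z. f z \<partial>lborel)"
proof -
  have "(\<integral>z. f z \<partial>lborel) = (\<integral>z. f z \<partial>distr lborel borel ((+) x))" by (simp add: lborel_distr_plus)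
  also have "\<dots> = (\<integral>w. f (x + w) \<partial>lborel)" by (subst integral_distr) auto
  finally show ?thesis by simp
qed

lemma bump_mult_integrable:
  fixes f :: "'a::euclidean_space \<Rightarrow> 'b::{banach, second_countable_topology}"
  assumes [measurable]: "f \<in> borel_measurable borel" and \<delta>: "0 \<le> \<delta>"
    and bd: "AE z in lborel. z \<in> cball x \<delta> \<longrightarrow> norm (f z) \<le> M"
  shows "integrable lborel (\<lambda>z. bump \<delta> (z - x) *\<^sub>R f z)"
proof (rule integrableI_bounded_set[where A="cball x \<delta>" and B="\<delta> * M"])
  show "emeasure lborel (cball x \<delta>) < \<infinity>" by (rule emeasure_lborel_cball_finite)
  show "AE z in lborel. z \<in> cball x \<delta> \<longrightarrow> norm (bump \<delta> (z - x) *\<^sub>R f z) \<le> \<delta> * M"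
  proof (rule eventually_mono[OF bd], intro impI)
    fix z assume "z \<in> cball x \<delta> \<longrightarrow> norm (f z) \<le> M" "z \<in> cball x \<delta>"
    then show "norm (bump \<delta> (z - x) *\<^sub>R f z) \<le> \<delta> * M"
      using bump_nonneg[of \<delta> "z - x"] bump_le[OF \<delta>, of "z - x"] \<delta> by (simp add: mult_mono)
  qed
  show "AE z in lborel. z \<notin> cball x \<delta> \<longrightarrow> bump \<delta> (z - x) *\<^sub>R f z = 0"
    by (auto simp: dist_norm norm_minus_commute intro!: AE_I2 bump_eq_0)
qed auto

lemma bump_integrable: "0 \<le> \<delta> \<Longrightarrow> integrable lborel (\<lambda>z. bump \<delta> (z - x))"
  using bump_mult_integrable[of "\<lambda>_. 1::real" \<delta> x 1] by simp

lemma bump_integral_translate: "(\<integral>z. bump \<delta> (z - (x::'a)) \<partial>lborel) = (\<integral>z. bump \<delta> (z::'a::euclidean_space) \<partial>lborel)"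
  using lborel_integral_translate[of "bump \<delta>" "- x"] by simp

lemma bump_integral_pos:
  assumes "0 < \<delta>" shows "0 < (\<integral>z. bump \<delta> (z::'a::euclidean_space) \<partial>lborel)"
proof -
  have i: "integrable lborel (bump \<delta> :: 'a \<Rightarrow> real)" using bump_integrable[of \<delta> "0::'a"] assms by simp
  have "(\<integral>z. (\<delta>/2) * indicator (cball (0::'a) (\<delta>/2)) z \<partial>lborel) \<le> (\<integral>z. bump \<delta> (z::'a) \<partial>lborel)"
  proof (rule integral_mono[OF _ i])
    show "integrable lborel (\<lambda>z::'a. (\<delta>/2) * indicator (cball 0 (\<delta>/2)) z)"
      by (intro integrable_mult_right integrable_real_indicator emeasure_lborel_cball_finite) auto
    show "\<delta> / 2 * indicator (cball 0 (\<delta> / 2)) z \<le> bump \<delta> z" for z :: 'a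
      by (auto simp: bump_def indicator_def max_def)
  qed
  moreover have "0 < measure lborel (cball (0::'a) (\<delta>/2))"
    using assms content_cball_pos[of "\<delta>/2" "0::'a"] by simp
  then have "0 < \<delta> / 2 * measure lborel (cball (0::'a) (\<delta>/2))" using assms by simp
  ultimately show ?thesis by simp
qed

text \<open>A weighted average over a ball stays as close to \<open>v\<close> as the averaged values
  do. With \<open>v = 0\<close> this gives growth bounds, with \<open>v = F x\<close>
  convergence.\<close>

lemma mollify_close:
  fixes f :: "'a::euclidean_space \<Rightarrow> 'a"
  assumes [measurable]: "f \<in> borel_measurable borel" and \<delta>: "0 < \<delta>"
    and bd: "AE z in lborel. z \<in> cball x \<delta> \<longrightarrow> norm (f z - v) \<le> e"
  shows "norm (mollify \<delta> f x - v) \<le> e"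
proof -
  define c where "c = (\<integral>z. bump \<delta> (z::'a) \<partial>lborel)"
  have c: "0 < c" unfolding c_def by (rule bump_integral_pos[OF \<delta>])
  have bd': "AE z in lborel. z \<in> cball x \<delta> \<longrightarrow> norm (f z) \<le> e + norm v"
  proof (rule eventually_mono[OF bd], intro impI)
    fix z assume "z \<in> cball x \<delta> \<longrightarrow> norm (f z - v) \<le> e" "z \<in> cball x \<delta>"
    then show "norm (f z) \<le> e + norm v" using norm_triangle_sub[of "f z" v] by simp
  qed
  have i1: "integrable lborel (\<lambda>z. bump \<delta> (z - x) *\<^sub>R f z)"
    using \<delta> bd' by (intro bump_mult_integrable) auto
  have i2: "integrable lborel (\<lambda>z. bump \<delta> (z - x) *\<^sub>R v)"
    using \<delta> by (intro integrable_scaleR_left bump_integrable) auto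
  have cv: "(\<integral>z. bump \<delta> (z - x) *\<^sub>R v \<partial>lborel) = c *\<^sub>R v"
    unfolding c_def bump_integral_translate[of \<delta> x, symmetric]
    using bump_integrable[of \<delta> x] \<delta> by simp
  have "mollify \<delta> f x - v = (1 / c) *\<^sub>R ((\<integral>z. bump \<delta> (z - x) *\<^sub>R f z \<partial>lborel) - c *\<^sub>R v)"
    unfolding mollify_def c_def[symmetric] using c by (simp add: scaleR_diff_right)
  also have "(\<integral>z. bump \<delta> (z - x) *\<^sub>R f z \<partial>lborel) - c *\<^sub>R v = (\<integral>z. bump \<delta> (z - x) *\<^sub>R (f z - v) \<partial>lborel)"
    unfolding cv[symmetric] Bochner_Integration.integral_diff[OF i1 i2, symmetric] by (simp only: scaleR_diff_right)
  also have "norm ((1 / c) *\<^sub>R \<dots>) = (1 / c) * norm (\<integral>z. bump \<delta> (z - x) *\<^sub>R (f z - v) \<partial>lborel)"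
    using c by simp
  also have "\<dots> \<le> (1 / c) * (\<integral>z. bump \<delta> (z - x) * e \<partial>lborel)"
  proof (intro mult_left_mono integral_norm_bound[THEN order_trans, OF integral_mono_AE])
    show "integrable lborel (\<lambda>z. norm (bump \<delta> (z - x) *\<^sub>R (f z - v)))"
      unfolding scaleR_diff_right by (intro integrable_norm Bochner_Integration.integrable_diff i1 i2)
    show "integrable lborel (\<lambda>z. bump \<delta> (z - x) * e)"
      using \<delta> by (intro integrable_mult_left bump_integrable) auto
    show "AE z in lborel. norm (bump \<delta> (z - x) *\<^sub>R (f z - v)) \<le> bump \<delta> (z - x) * e"
    proof (rule eventually_mono[OF bd])
      fix z assume z: "z \<in> cball x \<delta> \<longrightarrow> norm (f z - v) \<le> e"
      show "norm (bump \<delta> (z - x) *\<^sub>R (f z - v)) \<le> bump \<delta> (z - x) * e"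
      proof (cases "z \<in> cball x \<delta>")
        case True
        then show ?thesis using z bump_nonneg[of \<delta> "z - x"] by (simp add: mult_left_mono)
      next
        case False
        then have "bump \<delta> (z - x) = 0" by (intro bump_eq_0) (simp add: dist_norm norm_minus_commute)
        then show ?thesis by simp
      qed
    qed
  qed (use c in auto)
  also have "(\<integral>z. bump \<delta> (z - x) * e \<partial>lborel) = c * e"
    unfolding c_def bump_integral_translate[of \<delta> x, symmetric]
    using bump_integrable[of \<delta> x] \<delta> by simp
  also have "(1 / c) * (c * e) = e" using c by simp
  finally show ?thesis .
qed

text \<open>The Lipschitz constant 1 of the kernel passes to the difference of its two translates,
  which are supported in the larger ball where \<open>f\<close> is bounded by
  \<open>M\<close>.\<close>

lemma mollify_lipschitz:
  fixes f :: "'a::euclidean_space \<Rightarrow> 'a"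
  assumes [measurable]: "f \<in> borel_measurable borel" and \<delta>: "0 < \<delta>" and M: "0 \<le> M"
    and bd: "AE z in lborel. z \<in> cball 0 (R + \<delta>) \<longrightarrow> norm (f z) \<le> M"
    and xy: "x \<in> cball 0 R" "y \<in> cball 0 R"
  shows "norm (mollify \<delta> f x - mollify \<delta> f y) \<le>
    M * (measure lborel (cball (0::'a) (R + \<delta>)) / (\<integral>z. bump \<delta> (z::'a) \<partial>lborel)) * norm (x - y)"
proof -
  define c where "c = (\<integral>z. bump \<delta> (z::'a) \<partial>lborel)"
  have c: "0 < c" unfolding c_def by (rule bump_integral_pos[OF \<delta>])
  have sub: "cball x \<delta> \<subseteq> cball 0 (R + \<delta>)" if "x \<in> cball 0 R" for x :: 'a
  proof
    fix z assume "z \<in> cball x \<delta>"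
    then show "z \<in> cball 0 (R + \<delta>)" using that dist_triangle[of 0 z x] by simp
  qed
  have i: "integrable lborel (\<lambda>z. bump \<delta> (z - x) *\<^sub>R f z)" if "x \<in> cball 0 R" for x
  proof (rule bump_mult_integrable)
    show "AE z in lborel. z \<in> cball x \<delta> \<longrightarrow> norm (f z) \<le> M"
      by (rule eventually_mono[OF bd]) (use sub[OF that] in blast)
  qed (use \<delta> in auto)
  have "mollify \<delta> f x - mollify \<delta> f y = (1 / c) *\<^sub>R (\<integral>z. bump \<delta> (z - x) *\<^sub>R f z - bump \<delta> (z - y) *\<^sub>R f z \<partial>lborel)"
    unfolding mollify_def c_def[symmetric]
    by (simp add: Bochner_Integration.integral_diff[OF i[OF xy(1)] i[OF xy(2)]] scaleR_diff_right)
  also have "norm \<dots> = (1 / c) * norm (\<integral>z. bump \<delta> (z - x) *\<^sub>R f z - bump \<delta> (z - y) *\<^sub>R f z \<partial>lborel)"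
    using c by simp
  also have "\<dots> \<le> (1 / c) * (\<integral>z. (M * norm (x - y)) * indicator (cball (0::'a) (R + \<delta>)) z \<partial>lborel)"
  proof (intro mult_left_mono integral_norm_bound[THEN order_trans, OF integral_mono_AE])
    show "integrable lborel (\<lambda>z. norm (bump \<delta> (z - x) *\<^sub>R f z - bump \<delta> (z - y) *\<^sub>R f z))"
      by (intro integrable_norm Bochner_Integration.integrable_diff i xy)
    show "integrable lborel (\<lambda>z. (M * norm (x - y)) * indicator (cball (0::'a) (R + \<delta>)) z)"
      by (intro integrable_mult_right integrable_real_indicator emeasure_lborel_cball_finite) auto
    show "AE z in lborel. norm (bump \<delta> (z - x) *\<^sub>R f z - bump \<delta> (z - y) *\<^sub>R f z) \<le> (M * norm (x - y)) * indicator (cball 0 (R + \<delta>)) z"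
    proof (rule eventually_mono[OF bd])
      fix z assume z: "z \<in> cball 0 (R + \<delta>) \<longrightarrow> norm (f z) \<le> M"
      show "norm (bump \<delta> (z - x) *\<^sub>R f z - bump \<delta> (z - y) *\<^sub>R f z) \<le> (M * norm (x - y)) * indicator (cball 0 (R + \<delta>)) z"
      proof (cases "z \<in> cball 0 (R + \<delta>)")
        case True
        have "norm (bump \<delta> (z - x) *\<^sub>R f z - bump \<delta> (z - y) *\<^sub>R f z) = \<bar>bump \<delta> (z - x) - bump \<delta> (z - y)\<bar> * norm (f z)"
          by (simp flip: scaleR_diff_left)
        also have "\<dots> \<le> norm (x - y) * M"
          using bump_diff[of \<delta> "z - x" "z - y"] z True by (intro mult_mono) (auto simp: norm_minus_commute)
        finally show ?thesis using True by (simp add: mult.commute)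
      next
        case False
        then have "z \<notin> cball x \<delta>" "z \<notin> cball y \<delta>" using sub xy by blast+
        then have "bump \<delta> (z - x) = 0" "bump \<delta> (z - y) = 0"
          by (auto intro!: bump_eq_0 simp: dist_norm norm_minus_commute)
        then show ?thesis using False by simp
      qed
    qed
  qed (use c in auto)
  also have "\<dots> = M * (measure lborel (cball (0::'a) (R + \<delta>)) / c) * norm (x - y)"
    by (simp add: algebra_simps)
  finally show ?thesis unfolding c_def .
qed

text \<open>After a change of variables both mollifications average over the same shift
  \<open>w\<close>, and \<open>(x + w) - (y + w) = x - y\<close>. The inequality holds everywhere
  for \<open>F\<close>, and almost every \<open>w\<close> is such that \<open>f\<close> and
  \<open>F\<close> agree at both shifted points.\<close>

lemma mollify_one_sided:
  fixes f F :: "'a::euclidean_space \<Rightarrow> 'a"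
  assumes [measurable]: "f \<in> borel_measurable borel" and \<delta>: "0 < \<delta>"
    and bd: "\<And>R. \<exists>M. AE z in lborel. z \<in> cball 0 R \<longrightarrow> norm (f z) \<le> M"
    and fF: "AE z in lborel. f z = F z"
    and os: "\<And>x y. - k * (norm (x - y))\<^sup>2 \<le> (F x - F y) \<bullet> (x - y)"
  shows "- k * (norm (x - y))\<^sup>2 \<le> (mollify \<delta> f x - mollify \<delta> f y) \<bullet> (x - y)"
proof -
  define c where "c = (\<integral>z. bump \<delta> (z::'a) \<partial>lborel)"
  have c: "0 < c" unfolding c_def by (rule bump_integral_pos[OF \<delta>])
  have i: "integrable lborel (\<lambda>w. bump \<delta> w *\<^sub>R f (x + w))" for x
  proof -
    obtain M where M: "AE z in lborel. z \<in> cball 0 (norm x + \<delta>) \<longrightarrow> norm (f z) \<le> M" using bd by blast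
    have "AE w in lborel. w \<in> cball 0 \<delta> \<longrightarrow> norm (f (x + w)) \<le> M"
    proof (rule eventually_mono[OF AE_translate[OF M, of x]], intro impI)
      fix w assume h: "x + w \<in> cball 0 (norm x + \<delta>) \<longrightarrow> norm (f (x + w)) \<le> M" "w \<in> cball 0 \<delta>"
      then show "norm (f (x + w)) \<le> M" using norm_triangle_ineq[of x w] by simp
    qed
    then have "integrable lborel (\<lambda>w. bump \<delta> (w - 0) *\<^sub>R f (x + w))"
      using \<delta> by (intro bump_mult_integrable) auto
    then show ?thesis by simp
  qed
  have tr: "(\<integral>z. bump \<delta> (z - x) *\<^sub>R f z \<partial>lborel) = (\<integral>w. bump \<delta> w *\<^sub>R f (x + w) \<partial>lborel)" for x
    by (subst lborel_integral_translate[of _ x, symmetric]) auto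
  have "mollify \<delta> f x - mollify \<delta> f y = (1 / c) *\<^sub>R (\<integral>w. bump \<delta> w *\<^sub>R f (x + w) - bump \<delta> w *\<^sub>R f (y + w) \<partial>lborel)"
    unfolding mollify_def c_def[symmetric] tr
    by (simp add: Bochner_Integration.integral_diff[OF i i] scaleR_diff_right)
  also have "\<dots> \<bullet> (x - y) = (1 / c) * (\<integral>w. (bump \<delta> w *\<^sub>R f (x + w) - bump \<delta> w *\<^sub>R f (y + w)) \<bullet> (x - y) \<partial>lborel)"
    using Bochner_Integration.integrable_diff[OF i[of x] i[of y]] by (simp add: integral_inner_left)
  also have "\<dots> \<ge> (1 / c) * (\<integral>w. bump \<delta> (w::'a) * (- k * (norm (x - y))\<^sup>2) \<partial>lborel)"
  proof (intro mult_left_mono integral_mono_AE)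
    show "integrable lborel (\<lambda>w::'a. bump \<delta> w * (- k * (norm (x - y))\<^sup>2))"
      using \<delta> bump_integrable[of \<delta> "0::'a"] by (intro integrable_mult_left) auto
    show "integrable lborel (\<lambda>w. (bump \<delta> w *\<^sub>R f (x + w) - bump \<delta> w *\<^sub>R f (y + w)) \<bullet> (x - y))"
      by (intro integrable_inner_left Bochner_Integration.integrable_diff i)
    show "AE w in lborel. bump \<delta> w * (- k * (norm (x - y))\<^sup>2) \<le> (bump \<delta> w *\<^sub>R f (x + w) - bump \<delta> w *\<^sub>R f (y + w)) \<bullet> (x - y)"
      using AE_translate[OF fF, of x] AE_translate[OF fF, of y]
    proof eventually_elim
      case (elim w)
      have "- k * (norm (x - y))\<^sup>2 \<le> (f (x + w) - f (y + w)) \<bullet> (x - y)"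
        using os[of "x + w" "y + w"] elim by simp
      then have "bump \<delta> w * (- k * (norm (x - y))\<^sup>2) \<le> bump \<delta> w * ((f (x + w) - f (y + w)) \<bullet> (x - y))"
        by (intro mult_left_mono bump_nonneg)
      then show ?case by (simp add: inner_simps algebra_simps)
    qed
  qed (use c in auto)
  also have "(1 / c) * (\<integral>w. bump \<delta> (w::'a) * (- k * (norm (x - y))\<^sup>2) \<partial>lborel) = - k * (norm (x - y))\<^sup>2"
    using c bump_integrable[of \<delta> "0::'a"] \<delta> unfolding c_def by simp
  finally show ?thesis .
qed

text \<open>The evaluation point is allowed to move with \<open>n\<close>, because the mollified
  fields will be evaluated along the approximating trajectories.\<close>

lemma mollify_tendsto:
  fixes f F :: "'a::euclidean_space \<Rightarrow> 'a"
  assumes [measurable]: "f \<in> borel_measurable borel" and \<delta>: "\<And>n. 0 < \<delta> n" "\<delta> \<longlonglongrightarrow> 0"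
    and fF: "AE z in lborel. f z = F z" and cont: "isCont F x" and x: "x' \<longlonglongrightarrow> x"
  shows "(\<lambda>n. mollify (\<delta> n) f (x' n)) \<longlonglongrightarrow> F x"
proof (rule LIMSEQ_I)
  fix e :: real assume e: "0 < e"
  then have "0 < e / 2" by simp
  with cont obtain d where d: "0 < d" "\<And>z. dist z x < d \<Longrightarrow> dist (F z) (F x) < e / 2"
    unfolding continuous_at_eps_delta by blast
  have "eventually (\<lambda>n. \<delta> n < d / 2 \<and> dist (x' n) x < d / 2) sequentially"
    using order_tendstoD(2)[OF \<delta>(2), of "d/2"] tendstoD[OF x, of "d/2"] d(1) by (intro eventually_conj) auto
  then obtain N where N: "\<And>n. n \<ge> N \<Longrightarrow> \<delta> n < d / 2 \<and> dist (x' n) x < d / 2"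
    unfolding eventually_sequentially by blast
  have "norm (mollify (\<delta> n) f (x' n) - F x) < e" if "n \<ge> N" for n
  proof -
    have "norm (mollify (\<delta> n) f (x' n) - F x) \<le> e / 2"
    proof (rule mollify_close)
      show "AE z in lborel. z \<in> cball (x' n) (\<delta> n) \<longrightarrow> norm (f z - F x) \<le> e / 2"
      proof (rule eventually_mono[OF fF], intro impI)
        fix z assume z: "f z = F z" "z \<in> cball (x' n) (\<delta> n)"
        have "dist z x \<le> dist (x' n) z + dist (x' n) x" by (rule dist_triangle3)
        then have "dist z x < d" using z(2) N[OF that] by simp
        from d(2)[OF this] show "norm (f z - F x) \<le> e / 2" using z(1) by (simp add: dist_norm)
      qed
    qed (use \<delta> in auto)
    then show ?thesis using e by simp
  qed
  then show "\<exists>no. \<forall>n\<ge>no. norm (mollify (\<delta> n) f (x' n) - F x) < e" by blast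
qed

lemma mollify_measurable:
  fixes f :: "real \<Rightarrow> 'a::euclidean_space \<Rightarrow> 'a"
  assumes [measurable]: "(\<lambda>(r, x). f r x) \<in> borel_measurable borel"
  shows "(\<lambda>p. mollify \<delta> (f (fst p)) (snd p)) \<in> borel_measurable borel"
proof -
  have [measurable]: "(\<lambda>(r, x). f r x) \<in> borel_measurable (borel \<Otimes>\<^sub>M borel)" using assms by (simp add: borel_prod)
  have "(\<lambda>p. mollify \<delta> (f (fst p)) (snd p)) \<in> borel_measurable (borel \<Otimes>\<^sub>M borel)"
    unfolding mollify_def by measurable
  then show ?thesis by (simp add: borel_prod)
qed

section \<open>Borel versions and distances of fields\<close>

text \<open>The exceptional set is kept as an explicit Borel set of space-time, because whether a
  trajectory meets it has to be a measurable condition on time and starting point.\<close>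

definition borel_version :: "real \<Rightarrow> real \<Rightarrow> (real \<Rightarrow> 'a \<Rightarrow> 'a) \<Rightarrow> (real \<Rightarrow> 'a::euclidean_space \<Rightarrow> 'a) \<Rightarrow> (real \<times> 'a) set \<Rightarrow> bool"
  where "borel_version s T f f' N \<longleftrightarrow> (\<lambda>p. f' (fst p) (snd p)) \<in> borel_measurable borel \<and> N \<in> sets borel \<and>
    (AE r in lborel. AE x in lborel. (r, x) \<notin> N) \<and> (\<forall>r\<in>{s..T}. \<forall>x. (r, x) \<notin> N \<longrightarrow> f r x = f' r x)"

lemma borel_version_refl:
  "(\<lambda>p. f (fst p) (snd p)) \<in> borel_measurable borel \<Longrightarrow> borel_version s T f f {}"
  by (simp add: borel_version_def)

lemma borel_version_mono: "borel_version s T f f' N \<Longrightarrow> s \<le> s' \<Longrightarrow> borel_version s' T f f' N"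
  by (auto simp: borel_version_def)

lemma completion_ex_borel_measurable_euclidean:
  fixes f :: "'a \<Rightarrow> 'b::euclidean_space"
  assumes f: "f \<in> borel_measurable (completion M)"
  shows "\<exists>f'\<in>borel_measurable M. AE x in M. f x = f' x"
proof -
  have "\<exists>u\<in>borel_measurable M. AE x in M. f x \<bullet> i = u x" for i
    using f by (intro completion_ex_borel_measurable_real borel_measurable_inner) auto
  then obtain u where u: "\<And>i. u i \<in> borel_measurable M" "\<And>i. AE x in M. f x \<bullet> i = u i x" by metis
  show ?thesis
  proof (intro bexI)
    show "(\<lambda>x. \<Sum>i\<in>Basis. u i x *\<^sub>R i) \<in> borel_measurable M"
      using u(1) by (intro borel_measurable_sum borel_measurable_scaleR) auto
    have "AE x in M. \<forall>i\<in>Basis. f x \<bullet> i = u i x" by (intro AE_finite_allI u(2)) auto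
    then show "AE x in M. f x = (\<Sum>i\<in>Basis. u i x *\<^sub>R i)"
    proof (rule eventually_mono)
      fix x assume "\<forall>i\<in>Basis. f x \<bullet> i = u i x"
      then have "(\<Sum>i\<in>Basis. u i x *\<^sub>R i) = (\<Sum>i\<in>Basis. (f x \<bullet> i) *\<^sub>R i)" by (intro sum.cong) auto
      then show "f x = (\<Sum>i\<in>Basis. u i x *\<^sub>R i)" by (simp add: euclidean_representation)
    qed
  qed
qed

lemma borel_version_exists:
  fixes f :: "real \<Rightarrow> 'a::euclidean_space \<Rightarrow> 'a"
  assumes "(\<lambda>(t, x). f t x) \<in> borel_measurable (lebesgue_on ({s..T} \<times> UNIV))"
  shows "\<exists>f' N. borel_version s T f f' N"
proof -
  define S where "S = {s..T} \<times> (UNIV :: 'a set)"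
  have S: "S \<in> sets lebesgue" unfolding S_def by (intro sets_completionI_sets) (simp add: borel_closed closed_Times)
  define F where "F p = indicator S p *\<^sub>R (case p of (t, x) \<Rightarrow> f t x)" for p
  have "F \<in> borel_measurable lebesgue"
    using assms S unfolding F_def S_def by (subst (asm) borel_measurable_restrict_space_iff) auto
  from completion_ex_borel_measurable_euclidean[OF this] obtain F' where
    F': "F' \<in> borel_measurable lborel" "AE p in lborel. F p = F' p" by blast
  from F'(2) obtain N where N: "{p \<in> space lborel. F p \<noteq> F' p} \<subseteq> N" "emeasure lborel N = 0" "N \<in> sets lborel"
    by (rule AE_E)
  have "AE p in lborel. p \<notin> N" using N(2,3) by (intro AE_not_in) auto
  then have "AE p in lborel \<Otimes>\<^sub>M lborel. p \<notin> N" unfolding lborel_prod .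
  from lborel_pair.AE_pair[OF this] have "AE r in lborel. AE x in lborel. (r, x) \<notin> N" .
  moreover have "f r x = F' (r, x)" if "r \<in> {s..T}" "(r, x) \<notin> N" for r x
  proof -
    have "F (r, x) = F' (r, x)" using N(1) that by auto
    then show ?thesis using that by (simp add: F_def S_def)
  qed
  ultimately have "borel_version s T f (\<lambda>r x. F' (r, x)) N"
    using F'(1) N(3) by (auto simp: borel_version_def)
  then show ?thesis by blast
qed

lemma borel_versionD:
  assumes "borel_version s T f f' N"
  shows "(\<lambda>p. f' (fst p) (snd p)) \<in> borel_measurable borel" "N \<in> sets borel"
    "AE r in lebesgue. AE x in lborel. (r, x) \<notin> N"
    "\<And>r x. r \<in> {s..T} \<Longrightarrow> (r, x) \<notin> N \<Longrightarrow> f r x = f' r x"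
    "f' r \<in> borel_measurable borel"
    "AE r in lebesgue. r \<in> {s..T} \<longrightarrow> (AE x in lborel. f r x = f' r x)"
proof -
  show 1: "(\<lambda>p. f' (fst p) (snd p)) \<in> borel_measurable borel" and "N \<in> sets borel" and
    2: "AE r in lebesgue. AE x in lborel. (r, x) \<notin> N" and
    3: "\<And>r x. r \<in> {s..T} \<Longrightarrow> (r, x) \<notin> N \<Longrightarrow> f r x = f' r x"
    using assms by (auto simp: borel_version_def AE_completion_iff)
  have "(\<lambda>x. (r, x)) \<in> borel_measurable borel" by (intro borel_measurable_continuous_onI continuous_intros)
  from measurable_compose[OF this 1] show "f' r \<in> borel_measurable borel" by simp
  show "AE r in lebesgue. r \<in> {s..T} \<longrightarrow> (AE x in lborel. f r x = f' r x)"
    using 2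
  proof (rule eventually_mono, intro impI)
    fix r assume "AE x in lborel. (r, x) \<notin> N" "r \<in> {s..T}"
    then show "AE x in lborel. f r x = f' r x" by (auto elim!: eventually_mono intro: 3)
  qed
qed

lemma joint_measurable_along_path:
  fixes F :: "real \<times> 'a::euclidean_space \<Rightarrow> 'b::topological_space" and X :: "real \<Rightarrow> 'a"
  assumes F: "F \<in> borel_measurable borel" and X: "continuous_on {s..T} X"
  shows "(\<lambda>r. F (r, X r)) \<in> borel_measurable (lebesgue_on {s..T})"
proof -
  have "(\<lambda>r. (r, X r)) \<in> borel_measurable (lebesgue_on {s..T})"
    by (intro continuous_imp_measurable_on_sets_lebesgue continuous_intros X) auto
  from measurable_compose[OF this F] show ?thesis .
qed

section \<open>Convergence of fields in \<open>L^1\<close> on balls, and measurability along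
  paths\<close>

context flow_setting begin

lemma borel_version_sec_measurable:
  assumes "borel_version s T f f' N"
  shows "AE r in lebesgue. r \<in> {s..T} \<longrightarrow> f r \<in> borel_measurable lebesgue"
  using borel_versionD(6)[OF assms]
proof (rule eventually_mono, intro impI)
  fix r assume "r \<in> {s..T} \<longrightarrow> (AE x in lborel. f r x = f' r x)" "r \<in> {s..T}"
  then have "AE x in lebesgue. f' r x = f r x" by (auto simp: AE_completion_iff elim!: eventually_mono)
  moreover have "f' r \<in> borel_measurable lebesgue"
    using borel_versionD(5)[OF assms] by (intro measurable_completion) auto
  ultimately show "f r \<in> borel_measurable lebesgue" by (rule measurable_lebesgue_AE_cong)
qed

text \<open>Dominated convergence twice, in space on the ball at almost every time and then in time,
  with both majorants from the growth bound. Computing \<open>h\<close> from the Borel versions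
  makes it measurable in time.\<close>

lemma field_dist_tendsto:
  assumes gf: "\<And>n. growth (f n)" and gb: "growth b"
    and f: "\<And>n. borel_version s T (f n) (f' n) (N n)" and b: "borel_version s T b b' Nb"
    and conv: "AE r in lebesgue. r \<in> {s..T} \<longrightarrow> (AE x in lborel. (\<lambda>n. f n r x) \<longlonglongrightarrow> b r x)"
  shows "\<exists>h. (\<forall>n. field_dist R (f n) b (h n)) \<and> (\<lambda>n. integral {s..T} (h n)) \<longlonglongrightarrow> 0"
proof -
  define E where "E n r = (\<integral>\<^sup>+q\<in>cball 0 R. ennreal (norm (f' n r q - b' r q)) \<partial>lborel)" for n r
  define h where "h n r = enn2real (E n r)" for n r
  define V where "V = measure lborel (cball (0::'a) R)"
  have eV: "emeasure lborel (cball (0::'a) R) = ennreal V"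
    unfolding V_def using emeasure_lborel_cball_finite[of "0::'a" R]
    by (intro emeasure_eq_ennreal_measure) auto
  have [measurable]: "(\<lambda>p. f' n (fst p) (snd p)) \<in> borel_measurable borel" for n
    by (rule borel_versionD(1)[OF f])
  have [measurable]: "(\<lambda>p. b' (fst p) (snd p)) \<in> borel_measurable borel"
    by (rule borel_versionD(1)[OF b])
  have [measurable]: "f' n r \<in> borel_measurable borel" "b' r \<in> borel_measurable borel" for n r
    using borel_versionD(5)[OF f] borel_versionD(5)[OF b] by auto
  have [measurable]: "cball (0::'a) R \<in> sets borel" by simp
  have Em: "E n \<in> borel_measurable borel" for n
  proof -
    have "(\<lambda>p. ennreal (norm (f' n (fst p) (snd p) - b' (fst p) (snd p))) * indicator (cball 0 R) (snd p)) \<in> borel_measurable (borel \<Otimes>\<^sub>M lborel)"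
    proof -
      have "(\<lambda>p. ennreal (norm (f' n (fst p) (snd p) - b' (fst p) (snd p))) * indicator (cball 0 R) (snd p)) \<in> borel_measurable (borel :: (real \<times> 'a) measure)"
      proof (intro borel_measurable_times_ennreal)
        show "(\<lambda>p. indicator (cball 0 R) (snd p) :: ennreal) \<in> borel_measurable (borel :: (real \<times> 'a) measure)"
        proof (rule measurable_compose[where f=snd])
          show "snd \<in> borel_measurable (borel :: (real \<times> 'a) measure)"
            by (intro borel_measurable_continuous_onI continuous_intros)
          show "(indicator (cball 0 R) :: 'a \<Rightarrow> ennreal) \<in> borel_measurable borel"
            by (intro borel_measurable_indicator) auto
        qed
      qed measurable
      then show ?thesis by (simp add: borel_prod[symmetric] cong: measurable_cong_sets)
    qed
    then have "(\<lambda>(r, q). ennreal (norm (f' n r q - b' r q)) * indicator (cball 0 R) q) \<in> borel_measurable (borel \<Otimes>\<^sub>M lborel)"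
      by (simp add: case_prod_unfold)
    then show ?thesis unfolding E_def by (rule lborel.borel_measurable_nn_integral)
  qed
  then have hm: "h n \<in> borel_measurable borel" for n unfolding h_def by measurable
  define good where "good r \<longleftrightarrow> (\<forall>n. \<forall>x. norm (f n r x) \<le> C0 r * (1 + norm x)) \<and> (\<forall>x. norm (b r x) \<le> C0 r * (1 + norm x)) \<and>
     (\<forall>n. AE x in lborel. f n r x = f' n r x) \<and> (AE x in lborel. b r x = b' r x) \<and> (AE x in lborel. (\<lambda>n. f n r x) \<longlonglongrightarrow> b r x)" for r
  have good: "AE r in lebesgue. r \<in> {s..T} \<longrightarrow> good r"
  proof -
    have "AE r in lebesgue. \<forall>n. r \<in> {s..T} \<longrightarrow> (\<forall>x. norm (f n r x) \<le> C0 r * (1 + norm x))"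
      using gf unfolding growth_def AE_all_countable by blast
    moreover have "AE r in lebesgue. \<forall>n. r \<in> {s..T} \<longrightarrow> (AE x in lborel. f n r x = f' n r x)"
      using borel_versionD(6)[OF f] unfolding AE_all_countable by blast
    ultimately show ?thesis
      using gb[unfolded growth_def] borel_versionD(6)[OF b] conv
      by eventually_elim (auto simp: good_def)
  qed
  have ptw: "AE q in lborel. ennreal (norm (f' n r q - b' r q)) * indicator (cball 0 R) q \<le> ennreal (2 * (C0 r * (1 + R))) * indicator (cball 0 R) q"
    if r: "good r" "r \<in> {s..T}" for n r
  proof -
    have "AE q in lborel. f n r q = f' n r q" "AE q in lborel. b r q = b' r q" using r unfolding good_def by auto
    then show ?thesis
    proof eventually_elim
      case (elim q)
      have "norm (f' n r q - b' r q) \<le> 2 * (C0 r * (1 + R))" if "q \<in> cball 0 R"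
      proof -
        have "norm (f' n r q - b' r q) \<le> norm (f n r q) + norm (b r q)"
          using elim norm_triangle_ineq4[of "f n r q" "b r q"] by simp
        also have "\<dots> \<le> C0 r * (1 + norm q) + C0 r * (1 + norm q)"
          using r unfolding good_def by (intro add_mono) auto
        also have "\<dots> \<le> C0 r * (1 + R) + C0 r * (1 + R)"
          using that C0_nonneg[OF r(2)] by (intro add_mono mult_left_mono) auto
        finally show ?thesis by simp
      qed
      then show ?case by (auto simp: indicator_def intro!: ennreal_leI)
    qed
  qed
  have bd: "E n r \<le> ennreal (2 * (1 + R) * V * C0 r)" if r: "good r" "r \<in> {s..T}" and R: "0 \<le> R" for n r
  proof -
    have "E n r \<le> (\<integral>\<^sup>+q. ennreal (2 * (C0 r * (1 + R))) * indicator (cball (0::'a) R) q \<partial>lborel)"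
      unfolding E_def by (rule nn_integral_mono_AE[OF ptw[OF r]])
    also have "\<dots> = ennreal (2 * (C0 r * (1 + R))) * ennreal V"
      by (subst nn_integral_cmult_indicator) (auto simp: eV)
    also have "\<dots> = ennreal (2 * (1 + R) * V * C0 r)"
      using C0_nonneg[OF r(2)] R by (subst ennreal_mult[symmetric]) (auto simp: V_def mult_ac)
    finally show ?thesis .
  qed
  have Efin: "E n r < \<infinity>" if r: "good r" "r \<in> {s..T}" for n r
  proof (cases "0 \<le> R")
    case True
    then show ?thesis using bd[OF r True, of n] by (simp add: le_less_trans)
  next
    case False
    then have "cball (0::'a) R = {}" by simp
    then show ?thesis by (simp add: E_def)
  qed
  have hbd: "norm (h n r) \<le> \<bar>2 * (1 + R) * V\<bar> * C0 r" if r: "good r" "r \<in> {s..T}" for n r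
  proof (cases "0 \<le> R")
    case True
    have "h n r \<le> enn2real (ennreal (2 * (1 + R) * V * C0 r))"
      unfolding h_def by (intro enn2real_mono bd r True) simp
    also have "\<dots> = 2 * (1 + R) * V * C0 r" using True C0_nonneg[OF r(2)] by (simp add: V_def)
    finally show ?thesis using True by (simp add: h_def V_def)
  next
    case False
    then have "cball (0::'a) R = {}" by simp
    then show ?thesis using C0_nonneg[OF r(2)] by (simp add: h_def E_def)
  qed
  have Eeq: "(\<integral>\<^sup>+q\<in>cball 0 R. ennreal (norm (f n r q - b r q)) \<partial>lebesgue) = ennreal (h n r)"
    if r: "good r" "r \<in> {s..T}" for n r
  proof -
    have "(\<integral>\<^sup>+q\<in>cball 0 R. ennreal (norm (f n r q - b r q)) \<partial>lebesgue) = (\<integral>\<^sup>+q\<in>cball 0 R. ennreal (norm (f n r q - b r q)) \<partial>lborel)"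
      by (rule nn_integral_completion)
    also have "\<dots> = E n r"
    proof -
      have "AE q in lborel. f n r q = f' n r q" "AE q in lborel. b r q = b' r q" using r unfolding good_def by auto
      then have "AE q in lborel. ennreal (norm (f n r q - b r q)) * indicator (cball 0 R) q = ennreal (norm (f' n r q - b' r q)) * indicator (cball 0 R) q"
        by eventually_elim simp
      then show ?thesis unfolding E_def by (rule nn_integral_cong_AE)
    qed
    also have "\<dots> = ennreal (h n r)" using Efin[OF r] unfolding h_def by (simp add: less_top)
    finally show ?thesis .
  qed
  have Elim: "(\<lambda>n. h n r) \<longlonglongrightarrow> 0" if r: "good r" "r \<in> {s..T}" for r
  proof -
    have "(\<lambda>n. E n r) \<longlonglongrightarrow> (\<integral>\<^sup>+q. 0 \<partial>(lborel :: 'a measure))"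
      unfolding E_def
    proof (rule nn_integral_dominated_convergence[where w="\<lambda>q. ennreal (2 * (C0 r * (1 + R))) * indicator (cball (0::'a) R) q"])
      have fb: "AE q in lborel. \<forall>n. f n r q = f' n r q" "AE q in lborel. b r q = b' r q"
          "AE q in lborel. (\<lambda>n. f n r q) \<longlonglongrightarrow> b r q"
        using r unfolding good_def AE_all_countable by auto
      show "AE q in lborel. ennreal (norm (f' n r q - b' r q)) * indicator (cball 0 R) q \<le> ennreal (2 * (C0 r * (1 + R))) * indicator (cball 0 R) q" for n
        by (rule ptw[OF r])
      have "(\<integral>\<^sup>+q. ennreal (2 * (C0 r * (1 + R))) * indicator (cball (0::'a) R) q \<partial>lborel) = ennreal (2 * (C0 r * (1 + R))) * ennreal V"
        by (subst nn_integral_cmult_indicator) (auto simp: eV)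
      then show "(\<integral>\<^sup>+q. ennreal (2 * (C0 r * (1 + R))) * indicator (cball (0::'a) R) q \<partial>lborel) < \<infinity>"
        by (simp add: ennreal_mult_less_top)
      show "AE q in lborel. (\<lambda>n. ennreal (norm (f' n r q - b' r q)) * indicator (cball 0 R) q) \<longlonglongrightarrow> 0"
        using fb
      proof eventually_elim
        case (elim q)
        have "(\<lambda>n. norm (f n r q - b r q)) \<longlonglongrightarrow> norm (b r q - b r q)" by (intro tendsto_intros elim)
        then have "(\<lambda>n. norm (f' n r q - b' r q)) \<longlonglongrightarrow> 0" using elim by simp
        then have "(\<lambda>n. ennreal (norm (f' n r q - b' r q))) \<longlonglongrightarrow> ennreal 0" by (rule tendsto_ennrealI)
        then show ?case by (cases "q \<in> cball 0 R") auto
      qed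
      show "(\<lambda>q. ennreal (norm (f' n r q - b' r q)) * indicator (cball 0 R) q) \<in> borel_measurable lborel" for n
        unfolding measurable_lborel1 by (intro borel_measurable_times_ennreal borel_measurable_indicator) measurable
      show "(\<lambda>q. ennreal (2 * (C0 r * (1 + R))) * indicator (cball (0::'a) R) q) \<in> borel_measurable lborel"
        unfolding measurable_lborel1 by (intro borel_measurable_times_ennreal borel_measurable_indicator) auto
    qed simp
    then have "(\<lambda>n. E n r) \<longlonglongrightarrow> 0" by simp
    from tendsto_enn2real[OF this[folded ennreal_0]] show ?thesis unfolding h_def by simp
  qed
  have bi: "(\<lambda>r. \<bar>2 * (1 + R) * V\<bar> * C0 r) absolutely_integrable_on {s..T}"
    by (rule set_integrable_mult_right[OF C0])
  have hml: "h n \<in> borel_measurable (lebesgue_on {s..T})" for n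
    using hm[of n] by (intro measurable_restrict_space1 measurable_completion) auto
  have hi: "h n absolutely_integrable_on {s..T}" for n
    by (rule abs_int_on_AE_bound[OF hml bi]) (rule eventually_mono[OF good], use hbd in blast)
  have "field_dist R (f n) b (h n)" for n
    unfolding field_dist_def
  proof (intro conjI hi)
    show "\<forall>r\<in>{s..T}. 0 \<le> h n r" by (simp add: h_def)
    show "AE r in lebesgue. r \<in> {s..T} \<longrightarrow> (\<integral>\<^sup>+q\<in>cball 0 R. ennreal (norm (f n r q - b r q)) \<partial>lebesgue) \<le> ennreal (h n r)"
      by (rule eventually_mono[OF good]) (use Eeq in auto)
  qed
  moreover have "(\<lambda>n. integral {s..T} (h n)) \<longlonglongrightarrow> 0"
  proof -
    have "(\<lambda>n. LINT r|lebesgue. indicator {s..T} r *\<^sub>R h n r) \<longlonglongrightarrow> (LINT r|(lebesgue :: real measure). (0::real))"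
    proof (rule integral_dominated_convergence[where w="\<lambda>r. indicator {s..T} r *\<^sub>R (\<bar>2 * (1 + R) * V\<bar> * C0 r)"])
      show "(\<lambda>r. indicat_real {s..T} r *\<^sub>R h n r) \<in> borel_measurable lebesgue" for n
        using hi[of n] unfolding set_integrable_def by auto
      show "integrable lebesgue (\<lambda>r. indicat_real {s..T} r *\<^sub>R (\<bar>2 * (1 + R) * V\<bar> * C0 r))"
        using bi unfolding set_integrable_def .
      show "AE r in lebesgue. (\<lambda>n. indicat_real {s..T} r *\<^sub>R h n r) \<longlonglongrightarrow> 0"
        by (rule eventually_mono[OF good]) (use Elim in \<open>auto simp: indicator_def\<close>)
      show "AE r in lebesgue. norm (indicat_real {s..T} r *\<^sub>R h n r) \<le> indicat_real {s..T} r *\<^sub>R (\<bar>2 * (1 + R) * V\<bar> * C0 r)" for n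
        by (rule eventually_mono[OF good]) (use hbd in \<open>auto simp: indicator_def\<close>)
    qed auto
    then show ?thesis
      using set_lebesgue_integral_eq_integral(2)[OF hi] unfolding set_lebesgue_integral_def by simp
  qed
  ultimately show ?thesis by blast
qed

text \<open>The graph of \<open>X\<close> is a null set, so \<open>f\<close> cannot simply be
  replaced by \<open>f'\<close> along it. Mollifications of \<open>f' r\<close> depend only on its
  almost everywhere class, are jointly Borel, and converge to \<open>f r (X r)\<close> because
  \<open>f r\<close> is continuous.\<close>

lemma lip_fieldI:
  assumes L: "L absolutely_integrable_on {s..T}" "AE r in lebesgue. r \<in> {s..T} \<longrightarrow> lipschitz_on (L r) UNIV (f r)"
    and f: "borel_version s T f f' N"
  shows "lip_field f"
  unfolding lip_field_def
proof (intro conjI allI impI)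
  show "\<exists>L. L absolutely_integrable_on {s..T} \<and> (AE r in lebesgue. r \<in> {s..T} \<longrightarrow> lipschitz_on (L r) UNIV (f r))"
    using L by blast
  fix X :: "real \<Rightarrow> 'a" assume X: "continuous_on {s..T} X"
  define G where "G p = lim (\<lambda>n. mollify (inverse (real (Suc n))) (f' (fst p)) (snd p))" for p
  have f'm: "(\<lambda>(r, x). f' r x) \<in> borel_measurable borel"
    using borel_versionD(1)[OF f] by (simp add: case_prod_unfold)
  have "G \<in> borel_measurable borel"
    unfolding G_def by (intro borel_measurable_lim_metric mollify_measurable f'm)
  then have Gm: "(\<lambda>r. G (r, X r)) \<in> borel_measurable (lebesgue_on {s..T})"
    by (rule joint_measurable_along_path[OF _ X])
  have "AE r in lebesgue. indicator {s..T} r *\<^sub>R G (r, X r) = indicator {s..T} r *\<^sub>R f r (X r)"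
    using L(2) borel_versionD(6)[OF f]
  proof eventually_elim
    case (elim r)
    show ?case
    proof (cases "r \<in> {s..T}")
      case True
      then have lipf: "lipschitz_on (L r) UNIV (f r)" and ae: "AE x in lborel. f' r x = f r x"
        using elim by (auto elim!: eventually_mono)
      have "isCont (f r) (X r)"
        using lipschitz_on_continuous_on[OF lipf] by (simp add: continuous_on_eq_continuous_at)
      then have "(\<lambda>n. mollify (inverse (real (Suc n))) (f' r) (X r)) \<longlonglongrightarrow> f r (X r)"
        by (intro mollify_tendsto[OF borel_versionD(5)[OF f] _ LIMSEQ_inverse_real_of_nat ae]) auto
      then show ?thesis by (simp add: G_def limI)
    qed simp
  qed
  moreover have "(\<lambda>r. indicator {s..T} r *\<^sub>R G (r, X r)) \<in> borel_measurable lebesgue"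
    using Gm by (subst (asm) borel_measurable_restrict_space_iff) auto
  ultimately have "(\<lambda>r. indicator {s..T} r *\<^sub>R f r (X r)) \<in> borel_measurable lebesgue"
    by (rule measurable_lebesgue_AE_cong)
  then show "(\<lambda>r. f r (X r)) \<in> borel_measurable (lebesgue_on {s..T})"
    by (subst borel_measurable_restrict_space_iff) auto
qed

end

section \<open>Approximation of the field and existence\<close>

text \<open>Projecting onto the ball of radius \<open>n\<close> before mollifying makes the
  Lipschitz bound global with a constant integrable in time. The one-sided bound is then available
  inside the ball, which exhausts the space as \<open>n\<close> grows.\<close>

definition approx :: "(real \<Rightarrow> 'a::euclidean_space \<Rightarrow> 'a) \<Rightarrow> nat \<Rightarrow> real \<Rightarrow> 'a \<Rightarrow> 'a" where
  "approx b' n r x = mollify (inverse (real (Suc n))) (b' r) (closest_point (cball 0 (real n)) x)"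

lemma norm_closest_point_cball:
  fixes x :: "'a::euclidean_space"
  assumes "0 \<le> R"
  shows "norm (closest_point (cball 0 R) x) \<le> norm x" "norm (closest_point (cball 0 R) x) \<le> R"
proof -
  have "closest_point (cball 0 R) x \<in> cball 0 R" using assms by (intro closest_point_in_set) auto
  then show "norm (closest_point (cball 0 R) x) \<le> R" by simp
  have "dist (closest_point (cball 0 R) x) (closest_point (cball 0 R) 0) \<le> dist x 0"
    using assms by (intro closest_point_lipschitz) auto
  moreover have "closest_point (cball 0 R) (0::'a) = 0" using assms by (intro closest_point_self) auto
  ultimately show "norm (closest_point (cball 0 R) x) \<le> norm x" by simp
qed

lemma approx_measurable:
  fixes b' :: "real \<Rightarrow> 'a::euclidean_space \<Rightarrow> 'a"
  assumes "(\<lambda>p. b' (fst p) (snd p)) \<in> borel_measurable borel"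
  shows "(\<lambda>p. approx b' n (fst p) (snd p)) \<in> borel_measurable borel"
proof -
  have 1: "(\<lambda>p. mollify (inverse (real (Suc n))) (b' (fst p)) (snd p)) \<in> borel_measurable borel"
    using assms by (intro mollify_measurable) (simp add: case_prod_unfold)
  have 2: "(\<lambda>p :: real \<times> 'a. (fst p, closest_point (cball 0 (real n)) (snd p))) \<in> borel_measurable borel"
    by (intro borel_measurable_continuous_onI continuous_intros continuous_on_compose2[OF continuous_on_closest_point[of "cball 0 (real n)" UNIV]]) auto
  from measurable_compose[OF 2 1] show ?thesis by (simp add: approx_def)
qed

context flow_setting begin

context
  fixes b b' :: "real \<Rightarrow> 'a \<Rightarrow> 'a" and N :: "(real \<times> 'a) set"
  assumes half_growth: "AE r in lebesgue. r \<in> {s..T} \<longrightarrow> (\<forall>x. norm (b r x) \<le> C0 r / 2 * (1 + norm x))"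
    and os: "AE r in lebesgue. r \<in> {s..T} \<longrightarrow> (\<forall>x y. - C1 r * (norm (x - y))\<^sup>2 \<le> (b r x - b r y) \<bullet> (x - y))"
    and bv: "borel_version s T b b' N"
begin

text \<open>Collects the times at which all conditions known for almost every time hold together, so
  that the following arguments concern one fixed map \<open>b r\<close>.\<close>

definition regular :: "real \<Rightarrow> bool" where
  "regular r \<longleftrightarrow> r \<in> {s..T} \<and> (\<forall>x. norm (b r x) \<le> C0 r / 2 * (1 + norm x)) \<and>
     (\<forall>x y. - C1 r * (norm (x - y))\<^sup>2 \<le> (b r x - b r y) \<bullet> (x - y)) \<and>
     (AE x in lborel. b' r x = b r x) \<and> (AE x in lborel. (r, x) \<notin> N)"

lemma AE_regular: "AE r in lebesgue. r \<in> {s..T} \<longrightarrow> regular r"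
  using half_growth os borel_versionD(3)[OF bv] borel_versionD(6)[OF bv]
proof eventually_elim
  case (elim r)
  show ?case
  proof
    assume r: "r \<in> {s..T}"
    then have "AE x in lborel. b r x = b' r x" using elim by blast
    then have "AE x in lborel. b' r x = b r x" by (rule eventually_mono) simp
    then show "regular r" using elim r unfolding regular_def by blast
  qed
qed

lemma b'_sec: "b' r \<in> borel_measurable borel" by (rule borel_versionD(5)[OF bv])

lemma b'_bound:
  assumes r: "regular r"
  shows "AE z in lborel. z \<in> cball 0 R \<longrightarrow> norm (b' r z) \<le> C0 r / 2 * (1 + R)"
proof -
  have "AE x in lborel. b' r x = b r x" using r by (simp add: regular_def)
  then show ?thesis
  proof (rule eventually_mono, intro impI)
    fix z assume z: "b' r z = b r z" "z \<in> cball 0 R"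
    have "norm (b r z) \<le> C0 r / 2 * (1 + norm z)" using r by (simp add: regular_def)
    also have "\<dots> \<le> C0 r / 2 * (1 + R)"
      using z C0_nonneg[of r] r by (intro mult_left_mono) (auto simp: regular_def)
    finally show "norm (b' r z) \<le> C0 r / 2 * (1 + R)" using z by simp
  qed
qed

text \<open>Averaging reaches out by \<open>\<delta> \<le> 1\<close> and thereby at most doubles
  \<open>1 + norm x\<close>. This is why the growth of \<open>b\<close> was assumed with
  \<open>C0 r / 2\<close>.\<close>

lemma approx_bound:
  assumes r: "regular r"
  shows "norm (approx b' n r x) \<le> C0 r * (1 + norm x)"
proof -
  define y where "y = closest_point (cball 0 (real n)) x"
  define \<delta> where "\<delta> = inverse (real (Suc n))"
  have \<delta>: "0 < \<delta>" "\<delta> \<le> 1" by (auto simp: \<delta>_def field_simps)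
  have y: "norm y \<le> norm x" unfolding y_def by (rule norm_closest_point_cball) simp
  have "norm (mollify \<delta> (b' r) y - 0) \<le> C0 r / 2 * (1 + (norm y + \<delta>))"
  proof (rule mollify_close[OF b'_sec \<delta>(1)])
    show "AE z in lborel. z \<in> cball y \<delta> \<longrightarrow> norm (b' r z - 0) \<le> C0 r / 2 * (1 + (norm y + \<delta>))"
    proof (rule eventually_mono[OF b'_bound[OF r, of "norm y + \<delta>"]], intro impI)
      fix z assume z: "z \<in> cball 0 (norm y + \<delta>) \<longrightarrow> norm (b' r z) \<le> C0 r / 2 * (1 + (norm y + \<delta>))" "z \<in> cball y \<delta>"
      have "norm z \<le> norm y + \<delta>" using z(2) norm_triangle_sub[of z y] by (simp add: dist_norm norm_minus_commute)
      then show "norm (b' r z - 0) \<le> C0 r / 2 * (1 + (norm y + \<delta>))" using z(1) by simp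
    qed
  qed
  also have "\<dots> \<le> C0 r / 2 * (2 * (1 + norm x))"
    using y \<delta> r C0_nonneg[of r] norm_ge_zero[of x] by (intro mult_left_mono) (auto simp: regular_def simp del: norm_ge_zero)
  also have "C0 r / 2 * (2 * (1 + norm x)) = C0 r * (1 + norm x)" by simp
  finally show ?thesis by (simp add: approx_def y_def \<delta>_def)
qed

lemma growth_approx: "growth (approx b' n)"
  unfolding growth_def by (rule eventually_mono[OF AE_regular]) (use approx_bound in blast)

lemma lip_field_approx: "lip_field (approx b' n)"
proof -
  define \<delta> where "\<delta> = inverse (real (Suc n))"
  \<comment> \<open>The constant of \<open>mollify_lipschitz\<close> for the bound
    \<open>C0 r / 2 * (1 + (real n + \<delta>))\<close> on \<open>b' r\<close>, with
    \<open>C0 r\<close> factored out.\<close>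
  define k where "k = (1 + (real n + \<delta>)) / 2 * (measure lborel (cball (0::'a) (real n + \<delta>)) / (\<integral>z. bump \<delta> (z::'a) \<partial>lborel))"
  have \<delta>: "0 < \<delta>" by (auto simp: \<delta>_def)
  have c: "0 < (\<integral>z. bump \<delta> (z::'a) \<partial>lborel)" by (rule bump_integral_pos[OF \<delta>])
  show ?thesis
  proof (rule lip_fieldI[where L="\<lambda>r. k * C0 r"])
    show "(\<lambda>r. k * C0 r) absolutely_integrable_on {s..T}" by (rule set_integrable_mult_right[OF C0])
    show "borel_version s T (approx b' n) (approx b' n) {}"
      by (rule borel_version_refl[OF approx_measurable[OF borel_versionD(1)[OF bv]]])
    have "lipschitz_on (k * C0 r) UNIV (approx b' n r)" if r: "regular r" for r
      unfolding lipschitz_on_def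
    proof (intro conjI ballI)
      have C0r: "0 \<le> C0 r" using r C0_nonneg by (auto simp: regular_def)
      have k0: "0 \<le> k" unfolding k_def using \<delta> c by (intro mult_nonneg_nonneg divide_nonneg_nonneg) auto
      show "0 \<le> k * C0 r" using C0r k0 by simp
      fix x y :: 'a
      let ?P = "closest_point (cball 0 (real n))"
      have P: "?P x \<in> cball 0 (real n)" for x :: 'a using norm_closest_point_cball(2)[of "real n" x] by simp
      have "dist (approx b' n r x) (approx b' n r y) = norm (mollify \<delta> (b' r) (?P x) - mollify \<delta> (b' r) (?P y))"
        by (simp add: approx_def dist_norm \<delta>_def)
      also have "\<dots> \<le> C0 r / 2 * (1 + (real n + \<delta>)) * (measure lborel (cball (0::'a) (real n + \<delta>)) / (\<integral>z. bump \<delta> (z::'a) \<partial>lborel)) * norm (?P x - ?P y)"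
        using C0r \<delta> by (intro mollify_lipschitz[OF b'_sec \<delta> _ b'_bound[OF r] P P]) auto
      also have "\<dots> = k * C0 r * dist (?P x) (?P y)" by (simp add: k_def dist_norm)
      also have "\<dots> \<le> k * C0 r * dist x y"
        using C0r k0 by (intro mult_left_mono closest_point_lipschitz) auto
      finally show "dist (approx b' n r x) (approx b' n r y) \<le> k * C0 r * dist x y" .
    qed
    then show "AE r in lebesgue. r \<in> {s..T} \<longrightarrow> lipschitz_on (k * C0 r) UNIV (approx b' n r)"
      by (intro eventually_mono[OF AE_regular]) blast
  qed
qed

text \<open>On the ball of radius \<open>n\<close> the projection is the identity, and there
  mollification preserves the one-sided bound.\<close>

lemma one_sided_approx:
  assumes "R \<le> real n"
  shows "one_sided R (approx b' n)"
  unfolding one_sided_def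
proof (rule eventually_mono[OF AE_regular], intro impI ballI)
  fix r and x y :: 'a assume r: "r \<in> {s..T} \<longrightarrow> regular r" "r \<in> {s..T}" and xy: "x \<in> cball 0 R" "y \<in> cball 0 R"
  have self: "closest_point (cball 0 (real n)) z = z" if "z \<in> cball 0 R" for z :: 'a
    using that assms by (intro closest_point_self) auto
  have "- C1 r * (norm (x - y))\<^sup>2 \<le> (mollify (inverse (real (Suc n))) (b' r) x - mollify (inverse (real (Suc n))) (b' r) y) \<bullet> (x - y)"
  proof (rule mollify_one_sided[where F="b r", OF b'_sec])
    show "\<exists>M. AE z in lborel. z \<in> cball 0 R \<longrightarrow> norm (b' r z) \<le> M" for R
      using b'_bound[of r R] r by blast
  qed (use r in \<open>auto simp: regular_def\<close>)
  then show "- C1 r * (norm (x - y))\<^sup>2 \<le> (approx b' n r x - approx b' n r y) \<bullet> (x - y)"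
    by (simp add: approx_def self[OF xy(1)] self[OF xy(2)])
qed

lemma approx_tendsto:
  assumes r: "regular r" and cont: "isCont (b r) z" and z: "z' \<longlonglongrightarrow> z"
  shows "(\<lambda>n. approx b' n r (z' n)) \<longlonglongrightarrow> b r z"
  unfolding approx_def
proof (rule mollify_tendsto[OF b'_sec _ LIMSEQ_inverse_real_of_nat _ cont])
  show "AE x in lborel. b' r x = b r x" using r by (simp add: regular_def)
  obtain \<rho> where \<rho>: "\<And>n. norm (z' n) \<le> \<rho>" using Bseq_def z convergentI convergent_imp_Bseq by metis
  obtain n0 :: nat where n0: "\<rho> \<le> real n0" using real_arch_simple by blast
  have "eventually (\<lambda>n. z' n = closest_point (cball 0 (real n)) (z' n)) sequentially"
  proof (rule eventually_sequentiallyI)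
    fix n assume "n0 \<le> n"
    then have "norm (z' n) \<le> real n" using \<rho>[of n] n0 by (meson of_nat_mono order_trans)
    then show "z' n = closest_point (cball 0 (real n)) (z' n)" by (intro closest_point_self[symmetric]) simp
  qed
  from Lim_transform_eventually[OF z this] show "(\<lambda>n. closest_point (cball 0 (real n)) (z' n)) \<longlonglongrightarrow> z" .
qed simp

lemma regular_isCont_ae:
  assumes r: "regular r"
  shows "negligible {z. \<not> isCont (b r) z}"
  using r unfolding regular_def by (intro one_sided_isCont_ae[where c="C1 r" and B="C0 r / 2"]) auto

lemma growth_from_half: "growth b"
  unfolding growth_def
proof (rule eventually_mono[OF AE_regular], intro impI allI)
  fix r x assume "r \<in> {s..T} \<longrightarrow> regular r" "r \<in> {s..T}"
  then have r: "regular r" by blast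
  have "norm (b r x) \<le> C0 r / 2 * (1 + norm x)" using r by (simp add: regular_def)
  also have "\<dots> \<le> C0 r * (1 + norm x)"
    using r C0_nonneg[of r] by (intro mult_right_mono) (auto simp: regular_def)
  finally show "norm (b r x) \<le> C0 r * (1 + norm x)" .
qed

lemma one_sided_from_os: "one_sided R b"
  unfolding one_sided_def by (rule eventually_mono[OF os]) auto

lemma flow_limit_approx: "flow_limit s T g C0 C1 (approx b') b"
proof (intro flow_limit.intro flow_limit_axioms.intro)
  show "flow_setting s T g C0 C1" by (rule flow_setting_axioms)
  show "lip_field (approx b' n)" "growth (approx b' n)" for n
    by (rule lip_field_approx growth_approx)+
  show "growth b" by (rule growth_from_half)
  show "one_sided R b" for R by (rule one_sided_from_os)
  show "\<forall>\<^sub>F n in sequentially. one_sided R (approx b' n)" for R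
  proof -
    obtain n0 :: nat where n0: "R \<le> real n0" using real_arch_simple by blast
    show ?thesis
      by (rule eventually_sequentiallyI[of n0]) (use n0 in \<open>meson one_sided_approx of_nat_mono order_trans\<close>)
  qed
  show "AE r in lebesgue. r \<in> {s..T} \<longrightarrow> b r \<in> borel_measurable lebesgue"
    by (rule borel_version_sec_measurable[OF bv])
  show "\<exists>h. (\<forall>n. field_dist R (approx b' n) b (h n)) \<and> (\<lambda>n. integral {s..T} (h n)) \<longlonglongrightarrow> 0" for R
  proof (rule field_dist_tendsto[OF growth_approx growth_from_half _ bv])
    show "borel_version s T (approx b' n) (approx b' n) {}" for n
      by (rule borel_version_refl[OF approx_measurable[OF borel_versionD(1)[OF bv]]])
    have "AE x in lborel. (\<lambda>n. approx b' n r x) \<longlonglongrightarrow> b r x" if r: "regular r" for r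
    proof -
      have "AE x in lborel. isCont (b r) x"
        using regular_isCont_ae[OF r] by (simp add: AE_lborel_iff_negligible)
      then show ?thesis by (rule eventually_mono) (intro approx_tendsto[OF r] tendsto_const)
    qed
    then show "AE r in lebesgue. r \<in> {s..T} \<longrightarrow> (AE x in lborel. (\<lambda>n. approx b' n r x) \<longlonglongrightarrow> b r x)"
      by (intro eventually_mono[OF AE_regular]) blast
  qed
qed

end
end

section \<open>The limit of the flows solves the equation\<close>

lemma LIMSEQ_iff_inverse_Suc:
  fixes X :: "nat \<Rightarrow> 'a::metric_space"
  shows "X \<longlonglongrightarrow> L \<longleftrightarrow> (\<forall>k. \<exists>N. \<forall>n. n \<ge> N \<longrightarrow> dist (X n) L < inverse (real (Suc k)))"
proof
  assume "X \<longlonglongrightarrow> L"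
  then show "\<forall>k. \<exists>N. \<forall>n. n \<ge> N \<longrightarrow> dist (X n) L < inverse (real (Suc k))"
    unfolding lim_sequentially by simp
next
  assume *: "\<forall>k. \<exists>N. \<forall>n. n \<ge> N \<longrightarrow> dist (X n) L < inverse (real (Suc k))"
  show "X \<longlonglongrightarrow> L"
    unfolding lim_sequentially
  proof (intro allI impI)
    fix e :: real assume "0 < e"
    then obtain k where "inverse (real (Suc k)) < e" using reals_Archimedean by blast
    with * show "\<exists>no. \<forall>n\<ge>no. dist (X n) L < e" by (meson less_trans)
  qed
qed

context flow_limit begin

text \<open>Clamping time makes the flow jointly continuous on all of space-time, so that it and its
  limit \<open>cflim\<close> are Borel functions of both variables.\<close>

definition cflow :: "nat \<Rightarrow> real \<times> 'a \<Rightarrow> 'a" where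
  "cflow n p = flow n (clamp s T (fst p)) (snd p)"

definition cflim :: "real \<times> 'a \<Rightarrow> 'a" where "cflim p = lim (\<lambda>n. cflow n p)"

lemma clamp_in: "clamp s T r \<in> {s..T}"
  using clamp_in_interval[of s T r] sT by simp

lemma cflow_eq: "r \<in> {s..T} \<Longrightarrow> cflow n (r, x) = flow n r x"
  by (simp add: cflow_def)

lemma cflim_eq: "r \<in> {s..T} \<Longrightarrow> cflim (r, x) = flim r x"
  by (simp add: cflim_def flim_def cflow_eq)

lemma cflow_continuous: "continuous_on UNIV (cflow n)"
proof -
  obtain L where L: "L absolutely_integrable_on {s..T}"
      "AE r in lebesgue. r \<in> {s..T} \<longrightarrow> lipschitz_on (L r) UNIV (f n r)"
    using lip[of n] unfolding lip_field_def by blast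
  define k where "k = exp (2 * integral {s..T} L)"
  have lipx: "norm (flow n t x - flow n t y) \<le> norm (x - y) * k" if "t \<in> {s..T}" for t x y
    using sol_lip_stable[OF flow_sol(1) flow_sol(1) _ _ L s_in that] unfolding k_def by (simp add: flow_sol(2))
  have "(cflow n \<longlongrightarrow> cflow n p) (at p)" for p
  proof -
    have "continuous_on (cbox s T) (\<lambda>t. flow n t (snd p))"
      using path_sol_continuous[OF flow_sol(1) g] by simp
    then have "continuous_on UNIV (\<lambda>r. flow n (clamp s T r) (snd p))"
      by (rule clamp_continuous_on)
    then have "isCont (\<lambda>r. flow n (clamp s T r) (snd p)) (fst p)"
      by (simp add: continuous_on_eq_continuous_at)
    then have "((\<lambda>q. flow n (clamp s T (fst q)) (snd p)) \<longlongrightarrow> flow n (clamp s T (fst p)) (snd p)) (at p)"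
      by (rule isCont_tendsto_compose) (intro tendsto_intros)
    then have "((\<lambda>q. norm (snd q - snd p) * k + norm (flow n (clamp s T (fst q)) (snd p) - cflow n p)) \<longlongrightarrow> norm (snd p - snd p) * k + norm (cflow n p - cflow n p)) (at p)"
      unfolding cflow_def by (intro tendsto_intros)
    then have lim0: "((\<lambda>q. norm (snd q - snd p) * k + norm (flow n (clamp s T (fst q)) (snd p) - cflow n p)) \<longlongrightarrow> 0) (at p)"
      by simp
    have "((\<lambda>q. cflow n q - cflow n p) \<longlongrightarrow> 0) (at p)"
    proof (rule Lim_null_comparison[OF _ lim0], intro always_eventually allI)
      fix q
      have "norm (cflow n q - cflow n p) \<le> norm (cflow n q - flow n (clamp s T (fst q)) (snd p)) + norm (flow n (clamp s T (fst q)) (snd p) - cflow n p)"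
        using norm_triangle_ineq[of "cflow n q - flow n (clamp s T (fst q)) (snd p)" "flow n (clamp s T (fst q)) (snd p) - cflow n p"] by simp
      also have "norm (cflow n q - flow n (clamp s T (fst q)) (snd p)) \<le> norm (snd q - snd p) * k"
        unfolding cflow_def by (rule lipx[OF clamp_in])
      finally show "norm (cflow n q - cflow n p) \<le> norm (snd q - snd p) * k + norm (flow n (clamp s T (fst q)) (snd p) - cflow n p)" by simp
    qed
    then show ?thesis by (simp add: LIM_zero_cancel)
  qed
  then show ?thesis unfolding continuous_on_def by (simp add: tendsto_within_subset)
qed

lemma cflow_measurable: "cflow n \<in> borel_measurable borel"
  by (rule borel_measurable_continuous_onI[OF cflow_continuous])

lemma cflim_measurable: "cflim \<in> borel_measurable borel"
  unfolding cflim_def by (intro borel_measurable_lim_metric cflow_measurable)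

lemma flim_measurable: "t \<in> {s..T} \<Longrightarrow> flim t \<in> borel_measurable borel"
proof -
  assume t: "t \<in> {s..T}"
  have "(\<lambda>x. (t, x)) \<in> borel_measurable (borel :: 'a measure)"
    by (intro borel_measurable_continuous_onI continuous_intros)
  from measurable_compose[OF this cflim_measurable] show ?thesis using t by (simp add: cflim_eq)
qed

text \<open>One null set serves all times, irrational ones included, because off \<open>bad\<close>
  the flows converge at every time.\<close>

lemma blim_flim:
  assumes x: "x \<notin> bad" and t: "t \<in> {s..T}"
  shows "blim t (flim t x) = x"
proof -
  have "(\<lambda>k. pullback k t (flow k t x)) \<longlonglongrightarrow> blim t (flim t x)"
    using pullback_subseq_tendsto[OF t strict_mono_id flow_tendsto_all[OF x t]] by simp
  then show ?thesis using LIMSEQ_unique[OF _ tendsto_const] by (simp add: pullback_flow[OF t])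
qed

text \<open>Off \<open>bad\<close>, if \<open>flim t x\<close> lies in \<open>N\<close>, then
  \<open>x = blim t (flim t x)\<close> lies in the image of \<open>N\<close> under the Lipschitz map
  \<open>blim t\<close>, which is negligible. In other words, the limit flow carries Lebesgue
  measure to an absolutely continuous one.\<close>

lemma flim_avoids_negligible:
  assumes t: "t \<in> {s..T}" and N: "negligible N"
  shows "AE x in lborel. flim t x \<notin> N"
proof -
  have "negligible (blim t ` N)"
  proof (rule negligible_locally_Lipschitz_image[OF _ N])
    show "\<exists>U B. open U \<and> x \<in> U \<and> (\<forall>y\<in>N \<inter> U. norm (blim t y - blim t x) \<le> B * norm (y - x))" if "x \<in> N" for x
      using blim_lipschitz[OF t] by (intro exI[of _ UNIV] exI[of _ "sqrt Kexp"]) auto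
  qed simp
  with negligible_bad have "negligible (bad \<union> blim t ` N)" by (rule negligible_Un)
  moreover have "{x. \<not> flim t x \<notin> N} \<subseteq> bad \<union> blim t ` N"
  proof
    fix x assume "x \<in> {x. \<not> flim t x \<notin> N}"
    then show "x \<in> bad \<union> blim t ` N"
      using blim_flim[OF _ t, of x] by (cases "x \<in> bad") (auto intro: image_eqI[of _ _ "flim t x"])
  qed
  ultimately show ?thesis unfolding AE_lborel_iff_negligible by (rule negligible_subset)
qed

text \<open>At almost every time the discontinuities of \<open>b r\<close> and the slice of
  \<open>N\<close> are negligible, so almost every starting point avoids them at that time; Fubini
  exchanges the two quantifiers. Along such a trajectory the velocities converge at almost every
  time, and dominated convergence passes to the limit in the integral equation.\<close>

lemma flim_solves:
  assumes fb: "\<And>n. (\<lambda>p. f n (fst p) (snd p)) \<in> borel_measurable borel"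
    and bv: "borel_version s T b b' N"
    and conv: "AE r in lebesgue. r \<in> {s..T} \<longrightarrow> negligible {z. \<not> isCont (b r) z} \<and>
       (\<forall>z y. isCont (b r) z \<longrightarrow> y \<longlonglongrightarrow> z \<longrightarrow> (\<lambda>n. f n r (y n)) \<longlonglongrightarrow> b r z)"
  shows "AE x in lborel. path_sol b g s T (\<lambda>t. flim t x)"
proof -
  \<comment> \<open>Expressed through \<open>b'\<close>, \<open>N\<close> and the clamped flows, all
    of which are Borel, since exchanging the quantifiers requires a measurable subset of
    space-time.\<close>
  define P where "P r x \<longleftrightarrow> r \<notin> {s..T} \<or>
     ((\<lambda>n. f n r (cflow n (r, x))) \<longlonglongrightarrow> b' r (cflim (r, x)) \<and> (r, cflim (r, x)) \<notin> N)" for r x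
  have gm: "(\<lambda>p. (fst p, cflow n p)) \<in> borel_measurable borel" "(\<lambda>p. (fst p, cflim p)) \<in> borel_measurable borel" for n
    by (rule borel_measurable_Pair[OF borel_measurable_continuous_onI[OF continuous_on_fst[OF continuous_on_id]]],
        rule cflow_measurable cflim_measurable)+
  have um: "(\<lambda>p. f n (fst p) (cflow n p)) \<in> borel_measurable borel" for n
    using measurable_compose[OF gm(1) fb] by simp
  have vm: "(\<lambda>p. b' (fst p) (cflim p)) \<in> borel_measurable borel"
    using measurable_compose[OF gm(2) borel_versionD(1)[OF bv]] by simp
  have Nm: "{p. (fst p, cflim p) \<in> N} \<in> sets borel"
    using measurable_sets[OF gm(2) borel_versionD(2)[OF bv]] by (simp add: vimage_def)
  have "{p. P (fst p) (snd p)} \<in> sets (borel :: (real \<times> 'a) measure)"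
  proof -
    have [measurable]: "(\<lambda>p. dist (f n (fst p) (cflow n p)) (b' (fst p) (cflim p))) \<in> borel_measurable borel" for n
      by (intro borel_measurable_dist um vm)
    \<comment> \<open>With countably many tolerances, convergence becomes a Borel condition on
      space-time.\<close>
    have 1: "{p. \<forall>k. \<exists>M. \<forall>n. n \<ge> M \<longrightarrow> dist (f n (fst p) (cflow n p)) (b' (fst p) (cflim p)) < inverse (real (Suc k))} \<in> sets borel"
      by measurable
    have 2: "{p. fst p \<notin> {s..T}} \<in> sets (borel :: (real \<times> 'a) measure)"
    proof -
      have eq: "{p. fst p \<notin> {s..T}} = - ({s..T} \<times> (UNIV :: 'a set))" by auto
      show ?thesis unfolding eq by (intro borel_open open_Compl closed_Times) auto
    qed
    have "{p. P (fst p) (snd p)} = {p. fst p \<notin> {s..T}} \<union>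
       ({p. \<forall>k. \<exists>M. \<forall>n. n \<ge> M \<longrightarrow> dist (f n (fst p) (cflow n p)) (b' (fst p) (cflim p)) < inverse (real (Suc k))} - {p. (fst p, cflim p) \<in> N})"
      unfolding P_def LIMSEQ_iff_inverse_Suc by auto
    then show ?thesis using 1 2 Nm by auto
  qed
  then have Pm: "{p \<in> space (lborel \<Otimes>\<^sub>M lborel). P (fst p) (snd p)} \<in> sets (lborel \<Otimes>\<^sub>M (lborel :: 'a measure))"
    unfolding lborel_prod by simp
  have "AE r in lborel. AE x in lborel. P r x"
    using conv[unfolded AE_completion_iff] borel_versionD(3)[OF bv, unfolded AE_completion_iff]
  proof eventually_elim
    case (elim r)
    show ?case
    proof (cases "r \<in> {s..T}")
      case False
      then show ?thesis by (simp add: P_def)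
    next
      case r: True
      have "AE x in lborel. isCont (b r) x" using elim(1) r by (simp add: AE_lborel_iff_negligible)
      with elim(2) have "AE z in lborel. isCont (b r) z \<and> (r, z) \<notin> N" by eventually_elim simp
      then have "negligible {z. \<not> (isCont (b r) z \<and> (r, z) \<notin> N)}" by (simp only: AE_lborel_iff_negligible)
      from flim_avoids_negligible[OF r this]
      have 1: "AE x in lborel. isCont (b r) (flim r x) \<and> (r, flim r x) \<notin> N" by (rule eventually_mono) simp
      have 2: "AE x in lborel. x \<notin> bad" using negligible_bad by (simp add: AE_lborel_iff_negligible)
      from 1 2 show ?thesis
      proof eventually_elim
        case (elim x)
        have "(\<lambda>n. f n r (flow n r x)) \<longlonglongrightarrow> b r (flim r x)"
          using \<open>r \<in> {s..T} \<longrightarrow> _\<close> r elim(1) flow_tendsto_all[OF elim(2) r] by blast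
        moreover have "b r (flim r x) = b' r (flim r x)" using borel_versionD(4)[OF bv r] elim(1) by blast
        ultimately show ?case using elim(1) r by (simp add: P_def cflow_eq cflim_eq)
      qed
    qed
  qed
  then have AEP: "AE x in lborel. AE r in lborel. P r x"
    using lborel_pair.AE_commute[OF Pm] by blast
  have "AE x in lborel. x \<notin> bad" using negligible_bad by (simp add: AE_lborel_iff_negligible)
  with AEP show ?thesis
  proof eventually_elim
    case (elim x)
    have lim: "AE r in lebesgue. r \<in> {s..T} \<longrightarrow> (\<lambda>n. f n r (flow n r x)) \<longlonglongrightarrow> b r (flim r x)"
      unfolding AE_completion_iff using elim(1)
    proof (rule eventually_mono, intro impI)
      fix r assume r: "r \<in> {s..T}" and "P r x"
      then show "(\<lambda>n. f n r (flow n r x)) \<longlonglongrightarrow> b r (flim r x)"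
        using borel_versionD(4)[OF bv r, of "flim r x"] by (simp add: P_def cflow_eq cflim_eq)
    qed
    have fi: "(\<lambda>r. f n r (flow n r x)) absolutely_integrable_on {s..T}" for n
      using path_solD(1)[OF flow_sol(1)] .
    have fbd: "AE r in lebesgue. r \<in> {s..T} \<longrightarrow> norm (f n r (flow n r x)) \<le> rad (norm x) * C0 r" for n
    proof (rule eventually_mono[OF growth_f[of n, unfolded growth_def]], intro impI)
      fix r assume h: "r \<in> {s..T} \<longrightarrow> (\<forall>x. norm (f n r x) \<le> C0 r * (1 + norm x))" "r \<in> {s..T}"
      have "norm (f n r (flow n r x)) \<le> C0 r * (1 + norm (flow n r x))" using h by blast
      also have "\<dots> \<le> C0 r * rad (norm x)"
        using sol_bound1[OF flow_sol(1) _ _ growth_f s_in, of n x "norm x" r] h C0_nonneg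
        by (intro mult_left_mono) (auto simp: flow_sol(2))
      finally show "norm (f n r (flow n r x)) \<le> rad (norm x) * C0 r" by (simp add: mult.commute)
    qed
    have wi: "(\<lambda>r. rad (norm x) * C0 r) absolutely_integrable_on {s..T}" by (rule set_integrable_mult_right[OF C0])
    have dom: "set_integrable lebesgue {u..t} (\<lambda>r. b r (flim r x)) \<and>
        (\<lambda>n. integral {u..t} (\<lambda>r. f n r (flow n r x))) \<longlonglongrightarrow> integral {u..t} (\<lambda>r. b r (flim r x))"
      if ut: "s \<le> u" "t \<le> T" for u t
    proof -
      have fi': "(\<lambda>r. f n r (flow n r x)) absolutely_integrable_on {u..t}" for n
        using abs_int_on_subinterval[OF fi ut] .
      have m: "(\<lambda>r. indicat_real {u..t} r *\<^sub>R f n r (flow n r x)) \<in> borel_measurable lebesgue" for n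
        using fi'[of n] unfolding set_integrable_def by auto
      \<comment> \<open>Measurability of \<open>b r (flim r x)\<close> in \<open>r\<close> is
        obtained by identifying it almost everywhere with this limit of measurable
        functions.\<close>
      define F where "F r = lim (\<lambda>n. indicat_real {u..t} r *\<^sub>R f n r (flow n r x))" for r
      have Fm: "F \<in> borel_measurable lebesgue" unfolding F_def by (intro borel_measurable_lim_metric m)
      have L: "AE r in lebesgue. (\<lambda>n. indicat_real {u..t} r *\<^sub>R f n r (flow n r x)) \<longlonglongrightarrow> indicat_real {u..t} r *\<^sub>R b r (flim r x)"
        by (rule eventually_mono[OF lim]) (use ut in \<open>auto simp: indicator_def\<close>)
      have "AE r in lebesgue. F r = indicat_real {u..t} r *\<^sub>R b r (flim r x)"
        by (rule eventually_mono[OF L]) (simp add: F_def limI)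
      then have bm: "(\<lambda>r. indicat_real {u..t} r *\<^sub>R b r (flim r x)) \<in> borel_measurable lebesgue"
        using Fm by (rule measurable_lebesgue_AE_cong)
      have w: "integrable lebesgue (\<lambda>r. indicat_real {s..T} r *\<^sub>R (rad (norm x) * C0 r))"
        using wi unfolding set_integrable_def .
      have bd: "AE r in lebesgue. norm (indicat_real {u..t} r *\<^sub>R f n r (flow n r x)) \<le> indicat_real {s..T} r *\<^sub>R (rad (norm x) * C0 r)" for n
        using fbd[of n]
      proof (rule eventually_mono)
        fix r assume h: "r \<in> {s..T} \<longrightarrow> norm (f n r (flow n r x)) \<le> rad (norm x) * C0 r"
        show "norm (indicat_real {u..t} r *\<^sub>R f n r (flow n r x)) \<le> indicat_real {s..T} r *\<^sub>R (rad (norm x) * C0 r)"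
        proof (cases "r \<in> {s..T}")
          case True
          then have "norm (f n r (flow n r x)) \<le> rad (norm x) * C0 r" using h by blast
          then show ?thesis using True norm_ge_zero[of "f n r (flow n r x)"] by (auto simp: indicator_def simp del: norm_ge_zero)
        next
          case False
          then have "r \<notin> {u..t}" using ut by auto
          then show ?thesis using False by simp
        qed
      qed
      note D = bm m w L bd
      have int: "set_integrable lebesgue {u..t} (\<lambda>r. b r (flim r x))"
        unfolding set_integrable_def using D by (rule integrable_dominated_convergence)
      have "(\<lambda>n. LINT r|lebesgue. indicat_real {u..t} r *\<^sub>R f n r (flow n r x)) \<longlonglongrightarrow> (LINT r|lebesgue. indicat_real {u..t} r *\<^sub>R b r (flim r x))"
        using D by (rule integral_dominated_convergence)
      then show ?thesis
        using int set_lebesgue_integral_eq_integral(2)[OF int] set_lebesgue_integral_eq_integral(2)[OF fi']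
        unfolding set_lebesgue_integral_def by simp
    qed
    show ?case unfolding path_sol_def
    proof (intro conjI allI impI)
      show "(\<lambda>r. b r (flim r x)) absolutely_integrable_on {s..T}" using dom[of s T] by simp
      fix u t assume h: "s \<le> u" "u \<le> t" "t \<le> T"
      have "(\<lambda>n. flow n t x - flow n u x) \<longlonglongrightarrow> flim t x - flim u x"
        using h by (intro tendsto_intros flow_tendsto_all[OF elim(2)]) auto
      moreover have "flow n t x - flow n u x = integral {u..t} (\<lambda>r. f n r (flow n r x)) + (g t - g u)" for n
        using path_solD(2)[OF flow_sol(1) h] .
      ultimately have "(\<lambda>n. integral {u..t} (\<lambda>r. f n r (flow n r x)) + (g t - g u)) \<longlonglongrightarrow> flim t x - flim u x" by simp
      moreover have "(\<lambda>n. integral {u..t} (\<lambda>r. f n r (flow n r x)) + (g t - g u)) \<longlonglongrightarrow> integral {u..t} (\<lambda>r. b r (flim r x)) + (g t - g u)"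
        using dom[OF h(1,3)] by (intro tendsto_intros) auto
      ultimately show "flim t x - flim u x = integral {u..t} (\<lambda>r. b r (flim r x)) + (g t - g u)"
        using LIMSEQ_unique by blast
    qed
  qed
qed

end

section \<open>Membership and convergence in the path spaces\<close>

lemma solves_from_iff:
  assumes "s \<le> T"
  shows "solves_from s T b g x X \<longleftrightarrow> path_sol b g s T X \<and> X s = x"
proof
  assume *: "solves_from s T b g x X"
  then have int: "(\<lambda>r. b r (X r)) absolutely_integrable_on {s..T}" by (simp add: solves_from_def)
  have X: "X t = x + integral {s..t} (\<lambda>r. b r (X r)) + (g t - g s)" if "t \<in> {s..T}" for t
  proof -
    have "(\<lambda>r. b r (X r)) absolutely_integrable_on {s..t}"
      using that by (intro abs_int_on_subinterval[OF int]) auto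
    from set_lebesgue_integral_eq_integral(2)[OF this] show ?thesis
      using * that unfolding solves_from_def by auto
  qed
  have "X t - X u = integral {u..t} (\<lambda>r. b r (X r)) + (g t - g u)" if "s \<le> u" "u \<le> t" "t \<le> T" for u t
  proof -
    have *: "t \<in> {s..T}" "u \<in> {s..T}" using that by auto
    show ?thesis unfolding X[OF *(1)] X[OF *(2)] integral_diff_abs_int[OF int that, symmetric] by simp
  qed
  then show "path_sol b g s T X \<and> X s = x" using int X[of s] assms by (simp add: path_sol_def)
next
  assume *: "path_sol b g s T X \<and> X s = x"
  then have int: "(\<lambda>r. b r (X r)) absolutely_integrable_on {s..T}" by (simp add: path_sol_def)
  have "X t = x + (LINT r:{s..t}|lebesgue. b r (X r)) + (g t - g s)" if "t \<in> {s..T}" for t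
  proof -
    have "(\<lambda>r. b r (X r)) absolutely_integrable_on {s..t}"
      using that by (intro abs_int_on_subinterval[OF int]) auto
    from set_lebesgue_integral_eq_integral(2)[OF this] show ?thesis
      using path_solD(2)[of b g s T X s t] * that by (auto simp: algebra_simps)
  qed
  then show "solves_from s T b g x X" using int by (simp add: solves_from_def)
qed

lemma ennreal_tendsto_0I:
  fixes u :: "nat \<Rightarrow> ennreal"
  assumes "\<And>e. 0 < e \<Longrightarrow> eventually (\<lambda>n. u n \<le> ennreal e) sequentially"
  shows "u \<longlonglongrightarrow> 0"
proof (rule order_tendstoI)
  fix a :: ennreal assume "0 < a"
  then obtain c where c: "0 < c" "c < a" using dense by blast
  have "c < top" by (rule order.strict_trans2[OF c(2) top_greatest])
  then obtain e where e: "c = ennreal e" "0 \<le> e" by (cases c) auto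
  then have "0 < e" using c(1) by (auto simp: less_le)
  from assms[OF this] show "eventually (\<lambda>n. u n < a) sequentially"
    by (rule eventually_mono) (use c e in auto)
qed auto

lemma compact_in_cball:
  fixes K :: "(real^'d) set"
  assumes "compact K"
  obtains \<rho> where "0 \<le> \<rho>" "\<And>x. x \<in> K \<Longrightarrow> norm x \<le> \<rho>"
  using compact_imp_bounded[OF assms] unfolding bounded_pos by (meson less_imp_le)

lemma nn_integral_compact_le:
  fixes K :: "(real^'d) set"
  assumes K: "compact K" and le: "AE x in lebesgue. x \<in> K \<longrightarrow> u x \<le> c"
  shows "(\<integral>\<^sup>+x\<in>K. u x \<partial>lebesgue) \<le> c * emeasure lebesgue K"
proof -
  have "(\<integral>\<^sup>+x\<in>K. u x \<partial>lebesgue) \<le> (\<integral>\<^sup>+x. c * indicator K x \<partial>lebesgue)"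
    by (rule nn_integral_mono_AE, rule eventually_mono[OF le]) (auto simp: indicator_def)
  also have "\<dots> = c * emeasure lebesgue K"
    using K by (intro nn_integral_cmult_indicator) (auto simp: borel_compact)
  finally show ?thesis .
qed

lemma emeasure_compact_lebesgue: "compact K \<Longrightarrow> emeasure lebesgue (K :: (real^'d) set) < \<infinity>"
  using emeasure_compact_finite[of K] by (simp add: borel_compact)

locale flow_setting_vec = flow_setting s T g C0 C1
  for s T :: real and g :: "real \<Rightarrow> real^'d" and C0 C1 :: "real \<Rightarrow> real"
begin

text \<open>Both the bound \<open>rad \<rho>\<close> and the modulus of continuity in time are
  uniform over starting points in a ball, so they can be integrated over a compact set.\<close>

lemma flow_in_spaces:
  fixes \<Phi> :: "real \<Rightarrow> real^'d \<Rightarrow> real^'d"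
  assumes p: "1 \<le> p" and m: "\<And>t. t \<in> {s..T} \<Longrightarrow> \<Phi> t \<in> borel_measurable lebesgue"
    and sol: "AE x in lebesgue. path_sol f g s T (\<lambda>t. \<Phi> t x) \<and> \<Phi> s x = x" and f: "growth f"
  shows "\<Phi> \<in> C_Lp_loc s T p" "\<Phi> \<in> Lp_loc_C s T p"
proof -
  have bd: "norm (\<Phi> t x) powr p \<le> rad \<rho> powr p"
    if "path_sol f g s T (\<lambda>t. \<Phi> t x) \<and> \<Phi> s x = x" "norm x \<le> \<rho>" "t \<in> {s..T}" for t x \<rho>
    using sol_bound[of f s T "\<lambda>t. \<Phi> t x" s \<rho> t] that f sT p by (intro powr_mono2) auto
  have fin: "(\<integral>\<^sup>+x\<in>K. u x \<partial>lebesgue) < \<infinity>" if K: "compact K"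
    and u: "\<And>x \<rho>. path_sol f g s T (\<lambda>t. \<Phi> t x) \<and> \<Phi> s x = x \<Longrightarrow> norm x \<le> \<rho> \<Longrightarrow> u x \<le> ennreal (rad \<rho> powr p)" for K u
  proof -
    obtain \<rho> where \<rho>: "\<And>x. x \<in> K \<Longrightarrow> norm x \<le> \<rho>" using compact_in_cball[OF K] by blast
    have "(\<integral>\<^sup>+x\<in>K. u x \<partial>lebesgue) \<le> ennreal (rad \<rho> powr p) * emeasure lebesgue K"
      by (rule nn_integral_compact_le[OF K], rule eventually_mono[OF sol]) (use u \<rho> in blast)
    also have "\<dots> < \<infinity>" using emeasure_compact_lebesgue[OF K] by (simp add: ennreal_mult_less_top)
    finally show ?thesis .
  qed
  show "\<Phi> \<in> Lp_loc_C s T p"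
    unfolding Lp_loc_C_def
  proof (intro CollectI conjI ballI allI impI m)
    show "AE x in lebesgue. continuous_on {s..T} (\<lambda>t. \<Phi> t x)"
      by (rule eventually_mono[OF sol]) (use path_sol_continuous g in blast)
    show "(\<integral>\<^sup>+x\<in>K. (SUP t\<in>{s..T}. ennreal (norm (\<Phi> t x) powr p)) \<partial>lebesgue) < \<infinity>" if "compact K" for K
      using that by (rule fin) (intro SUP_least ennreal_leI bd)
  qed
  have Lp: "\<Phi> t \<in> Lp_loc p" if t: "t \<in> {s..T}" for t
    unfolding Lp_loc_def
  proof (intro CollectI conjI allI impI m t)
    show "(\<integral>\<^sup>+x\<in>K. ennreal (norm (\<Phi> t x) powr p) \<partial>lebesgue) < \<infinity>" if "compact K" for K
      using that by (rule fin) (intro ennreal_leI bd t)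
  qed
  show "\<Phi> \<in> C_Lp_loc s T p"
    unfolding C_Lp_loc_def
  proof (intro CollectI conjI ballI allI impI Lp)
    fix K :: "(real^'d) set" and t assume K: "compact K" and t: "t \<in> {s..T}"
    obtain \<rho> where \<rho>: "\<And>x. x \<in> K \<Longrightarrow> norm x \<le> \<rho>" using compact_in_cball[OF K] by blast
    define A where "A r = integral {s..r} C0" for r
    \<comment> \<open>The modulus of \<open>sol_modulus\<close>, with absolute values so that it
      applies to times on either side of \<open>t\<close>.\<close>
    define \<omega> where "\<omega> r = \<bar>rad \<rho>\<bar> * \<bar>A r - A t\<bar> + norm (g r - g t)" for r
    have \<omega>0: "0 \<le> \<omega> r" for r by (simp add: \<omega>_def)
    have "(A \<longlongrightarrow> A t) (at t within {s..T})"
      using continuous_indefinite[OF C0] t unfolding A_def continuous_on_def by blast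
    moreover have "(g \<longlongrightarrow> g t) (at t within {s..T})"
      using g t unfolding continuous_on_def by blast
    ultimately have "(\<omega> \<longlongrightarrow> \<bar>rad \<rho>\<bar> * \<bar>A t - A t\<bar> + norm (g t - g t)) (at t within {s..T})"
      unfolding \<omega>_def by (intro tendsto_intros)
    then have "(\<omega> \<longlongrightarrow> 0) (at t within {s..T})" by simp
    then have "((\<lambda>r. \<omega> r powr p) \<longlongrightarrow> 0 powr p) (at t within {s..T})"
      using p \<omega>0 by (intro tendsto_powr') auto
    then have "((\<lambda>r. ennreal (\<omega> r powr p)) \<longlongrightarrow> 0) (at t within {s..T})"
      using tendsto_ennrealI by fastforce
    then have "((\<lambda>r. emeasure lebesgue K * ennreal (\<omega> r powr p)) \<longlongrightarrow> emeasure lebesgue K * 0) (at t within {s..T})"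
      using emeasure_compact_lebesgue[OF K] by (intro ennreal_tendsto_cmult) auto
    then have up: "((\<lambda>r. ennreal (\<omega> r powr p) * emeasure lebesgue K) \<longlongrightarrow> 0) (at t within {s..T})" by (simp add: mult.commute)
    have le: "(\<integral>\<^sup>+x\<in>K. ennreal (norm (\<Phi> r x - \<Phi> t x) powr p) \<partial>lebesgue) \<le> ennreal (\<omega> r powr p) * emeasure lebesgue K"
      if r: "r \<in> {s..T}" for r
    proof (rule nn_integral_compact_le[OF K], rule eventually_mono[OF sol], intro impI ennreal_leI powr_mono2)
      fix x assume x: "path_sol f g s T (\<lambda>t. \<Phi> t x) \<and> \<Phi> s x = x" "x \<in> K"
      have mod: "norm (\<Phi> v x - \<Phi> u x) \<le> \<bar>rad \<rho>\<bar> * \<bar>A v - A u\<bar> + norm (g v - g u)" if "s \<le> u" "u \<le> v" "v \<le> T" for u v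
      proof -
        have "norm (\<Phi> v x - \<Phi> u x) \<le> rad \<rho> * integral {u..v} C0 + norm (g v - g u)"
          using sol_modulus[of f s T "\<lambda>t. \<Phi> t x" s \<rho> u v] x \<rho> f sT that by auto
        also have "integral {u..v} C0 = A v - A u" unfolding A_def using integral_diff_abs_int[OF C0 that] by simp
        also have "rad \<rho> * (A v - A u) \<le> \<bar>rad \<rho>\<bar> * \<bar>A v - A u\<bar>" by (metis abs_ge_self abs_mult)
        finally show ?thesis by simp
      qed
      show "norm (\<Phi> r x - \<Phi> t x) \<le> \<omega> r"
        using mod[of t r] mod[of r t] r t unfolding \<omega>_def
        by (cases "t \<le> r") (auto simp: norm_minus_commute abs_minus_commute)
    qed (use p in auto)
    show "((\<lambda>r. \<integral>\<^sup>+x\<in>K. ennreal (norm (\<Phi> r x - \<Phi> t x) powr p) \<partial>lebesgue) \<longlongrightarrow> 0) (at t within {s..T})"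
    proof (rule tendsto_sandwich[OF _ _ tendsto_const up])
      show "\<forall>\<^sub>F r in at t within {s..T}. (\<integral>\<^sup>+x\<in>K. ennreal (norm (\<Phi> r x - \<Phi> t x) powr p) \<partial>lebesgue) \<le> ennreal (\<omega> r powr p) * emeasure lebesgue K"
        unfolding eventually_at_filter by (rule always_eventually) (use le in blast)
    qed simp
  qed
qed

text \<open>Reduces the supremum over time to a countable one, which is measurable in the starting
  point.\<close>

lemma SUP_rational:
  fixes u :: "real \<Rightarrow> ennreal"
  assumes u: "continuous_on {s..T} u"
  shows "(SUP t\<in>{s..T}. u t) = (SUP t\<in>\<rat> \<inter> {s..T}. u t)"
proof (rule antisym)
  show "(SUP t\<in>\<rat> \<inter> {s..T}. u t) \<le> (SUP t\<in>{s..T}. u t)" by (rule SUP_subset_mono) auto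
  show "(SUP t\<in>{s..T}. u t) \<le> (SUP t\<in>\<rat> \<inter> {s..T}. u t)"
  proof (rule SUP_least)
    fix t assume t: "t \<in> {s..T}"
    have "\<exists>q. q \<in> \<rat> \<inter> {s..T} \<and> \<bar>t - q\<bar> < inverse (real (Suc n))" for n
    proof -
      have "0 < inverse (real (Suc n))" by simp
      then have "max s (t - inverse (real (Suc n))) < min T (t + inverse (real (Suc n)))"
        using t sT unfolding max_less_iff_conj min_less_iff_conj atLeastAtMost_iff by linarith
      from Rats_dense_in_real[OF this] obtain q where "q \<in> \<rat>" "max s (t - inverse (real (Suc n))) < q"
        "q < min T (t + inverse (real (Suc n)))" by blast
      then show ?thesis by (intro exI[of _ q]) auto
    qed
    then obtain q where q: "\<And>n. q n \<in> \<rat> \<inter> {s..T}" "\<And>n. \<bar>t - q n\<bar> < inverse (real (Suc n))" by metis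
    have "(\<lambda>n. q n - t) \<longlonglongrightarrow> 0"
      by (rule Lim_null_comparison[OF _ LIMSEQ_inverse_real_of_nat])
        (use q(2) in \<open>auto intro!: always_eventually less_imp_le simp: abs_minus_commute\<close>)
    then have "q \<longlonglongrightarrow> t" by (rule LIM_zero_cancel)
    then have "(\<lambda>n. u (q n)) \<longlonglongrightarrow> u t"
      using q(1) t by (intro continuous_on_tendsto_compose[OF u]) auto
    then show "u t \<le> (SUP t\<in>\<rat> \<inter> {s..T}. u t)"
      by (rule LIMSEQ_le_const2) (intro exI[of _ 0] allI impI SUP_upper q(1))
  qed
qed

text \<open>All trajectories starting in \<open>K\<close> stay within radius
  \<open>rad \<rho>\<close>, so a constant multiple of the indicator of \<open>K\<close> is an
  integrable majorant, and uniform convergence in time makes the supremum tend to zero almost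
  everywhere.\<close>

lemma Lp_convergence:
  fixes \<Phi> :: "real \<Rightarrow> real^'d \<Rightarrow> real^'d" and \<Phi>n :: "nat \<Rightarrow> real \<Rightarrow> real^'d \<Rightarrow> real^'d"
  assumes p: "1 \<le> p" and m: "\<And>t. t \<in> {s..T} \<Longrightarrow> \<Phi> t \<in> borel_measurable lebesgue"
    "\<And>n t. t \<in> {s..T} \<Longrightarrow> \<Phi>n n t \<in> borel_measurable lebesgue"
    and sol: "AE x in lebesgue. path_sol f g s T (\<lambda>t. \<Phi> t x) \<and> \<Phi> s x = x" "growth f"
    and soln: "\<And>n. AE x in lebesgue. path_sol (fn n) g s T (\<lambda>t. \<Phi>n n t x) \<and> \<Phi>n n s x = x" "\<And>n. growth (fn n)"
    and unif: "AE x in lebesgue. uniform_limit {s..T} (\<lambda>n t. \<Phi>n n t x) (\<lambda>t. \<Phi> t x) sequentially"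
    and K: "compact K"
  shows "(\<lambda>n. \<integral>\<^sup>+x\<in>K. (SUP t\<in>{s..T}. ennreal (norm (\<Phi>n n t x - \<Phi> t x) powr p)) \<partial>lebesgue) \<longlonglongrightarrow> 0"
proof -
  obtain \<rho> where \<rho>: "\<And>x. x \<in> K \<Longrightarrow> norm x \<le> \<rho>" using compact_in_cball[OF K] by blast
  define D where "D = \<rat> \<inter> {s..T}"
  have D: "countable D" unfolding D_def by (intro countable_Int1 countable_rat)
  define w where "w n x = (SUP t\<in>D. ennreal (norm (\<Phi>n n t x - \<Phi> t x) powr p)) * indicator K x" for n x
  have [measurable]: "K \<in> sets lebesgue" using K by (simp add: borel_compact)
  have wm: "w n \<in> borel_measurable lebesgue" for n
  proof -
    have "(\<lambda>x. ennreal (norm (\<Phi>n n t x - \<Phi> t x) powr p)) \<in> borel_measurable lebesgue" if "t \<in> D" for t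
    proof -
      have [measurable]: "\<Phi> t \<in> borel_measurable lebesgue" "\<Phi>n n t \<in> borel_measurable lebesgue"
        using m that unfolding D_def by auto
      show ?thesis by measurable
    qed
    then have "(\<lambda>x. SUP t\<in>D. ennreal (norm (\<Phi>n n t x - \<Phi> t x) powr p)) \<in> borel_measurable lebesgue"
      by (rule borel_measurable_SUP[OF D])
    then show ?thesis unfolding w_def by measurable
  qed
  have soln': "AE x in lebesgue. \<forall>n. path_sol (fn n) g s T (\<lambda>t. \<Phi>n n t x) \<and> \<Phi>n n s x = x"
    using soln(1) unfolding AE_all_countable by blast
  have "(\<integral>\<^sup>+x\<in>K. (SUP t\<in>{s..T}. ennreal (norm (\<Phi>n n t x - \<Phi> t x) powr p)) \<partial>lebesgue) = (\<integral>\<^sup>+x. w n x \<partial>lebesgue)" for n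
  proof (rule nn_integral_cong_AE)
    show "AE x in lebesgue. (SUP t\<in>{s..T}. ennreal (norm (\<Phi>n n t x - \<Phi> t x) powr p)) * indicator K x = w n x"
      using sol(1) soln(1)[of n]
    proof eventually_elim
      case (elim x)
      have c: "continuous_on {s..T} (\<lambda>t. \<Phi>n n t x)" "continuous_on {s..T} (\<lambda>t. \<Phi> t x)"
        using elim path_sol_continuous g by blast+
      have "continuous_on {s..T} (\<lambda>t. norm (\<Phi>n n t x - \<Phi> t x) powr p)"
        using p by (intro continuous_on_powr' continuous_intros c) auto
      then have "continuous_on {s..T} (\<lambda>t. ennreal (norm (\<Phi>n n t x - \<Phi> t x) powr p))"
        by (rule continuous_on_ennreal)
      from SUP_rational[OF this] show ?case by (simp add: w_def D_def)
    qed
  qed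
  moreover have "(\<lambda>n. \<integral>\<^sup>+x. w n x \<partial>lebesgue) \<longlonglongrightarrow> (\<integral>\<^sup>+x. 0 \<partial>(lebesgue :: (real^'d) measure))"
  proof (rule nn_integral_dominated_convergence[where w="\<lambda>x. ennreal ((2 * rad \<rho>) powr p) * indicator K x"])
    show "(\<lambda>x. ennreal ((2 * rad \<rho>) powr p) * indicator K x) \<in> borel_measurable lebesgue" by measurable
    show "AE x in lebesgue. w n x \<le> ennreal ((2 * rad \<rho>) powr p) * indicator K x" for n
      using sol(1) soln(1)[of n]
    proof eventually_elim
      case (elim x)
      have "ennreal (norm (\<Phi>n n t x - \<Phi> t x) powr p) \<le> ennreal ((2 * rad \<rho>) powr p)" if "x \<in> K" "t \<in> D" for t
      proof (intro ennreal_leI powr_mono2)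
        have t: "t \<in> {s..T}" using that D_def by auto
        have "norm (\<Phi>n n t x) \<le> rad \<rho>" "norm (\<Phi> t x) \<le> rad \<rho>"
          using sol_bound[of "fn n" s T "\<lambda>t. \<Phi>n n t x" s \<rho> t] sol_bound[of f s T "\<lambda>t. \<Phi> t x" s \<rho> t]
            elim sol(2) soln(2) sT t \<rho>[OF that(1)] by auto
        then show "norm (\<Phi>n n t x - \<Phi> t x) \<le> 2 * rad \<rho>"
          using norm_triangle_ineq4[of "\<Phi>n n t x" "\<Phi> t x"] by simp
      qed (use p in auto)
      then show ?case unfolding w_def by (cases "x \<in> K") (auto intro!: SUP_least)
    qed
    show "(\<integral>\<^sup>+x. ennreal ((2 * rad \<rho>) powr p) * indicator K x \<partial>lebesgue) < \<infinity>"
      using emeasure_compact_lebesgue[OF K]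
      by (subst nn_integral_cmult_indicator) (auto simp: ennreal_mult_less_top)
    show "AE x in lebesgue. (\<lambda>n. w n x) \<longlonglongrightarrow> 0"
      using unif
    proof eventually_elim
      case (elim x)
      show ?case
      proof (rule ennreal_tendsto_0I)
        fix e :: real assume e: "0 < e"
        define d where "d = e powr (1 / p)"
        have d: "0 < d" "d powr p = e" using e p by (auto simp: d_def powr_powr)
        have "eventually (\<lambda>n. \<forall>t\<in>{s..T}. dist (\<Phi>n n t x) (\<Phi> t x) < d) sequentially"
          using uniform_limitD[OF elim d(1)] .
        then show "eventually (\<lambda>n. w n x \<le> ennreal e) sequentially"
        proof (rule eventually_mono)
          fix n assume n: "\<forall>t\<in>{s..T}. dist (\<Phi>n n t x) (\<Phi> t x) < d"
          have "ennreal (norm (\<Phi>n n t x - \<Phi> t x) powr p) \<le> ennreal e" if "t \<in> D" for t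
            unfolding d(2)[symmetric] using n that p unfolding D_def
            by (intro ennreal_leI powr_mono2) (auto simp: dist_norm intro: less_imp_le)
          then show "w n x \<le> ennreal e" unfolding w_def by (cases "x \<in> K") (auto intro!: SUP_least)
        qed
      qed
    qed
  qed (auto simp: wm)
  ultimately show ?thesis by simp
qed

end

section \<open>Flows along a fixed path\<close>

lemma abs_int_growth_sum:
  assumes "nonneg_L1 T C" "nonneg_L1 T C'" "0 \<le> s"
  shows "(\<lambda>r. C r + C' r) absolutely_integrable_on {s..T}" "\<And>r. r \<in> {s..T} \<Longrightarrow> 0 \<le> C r + C' r"
proof -
  have "(\<lambda>r. C r + C' r) absolutely_integrable_on {0..T}"
    using assms(1,2) unfolding nonneg_L1_def by (intro set_integral_add) auto
  then show "(\<lambda>r. C r + C' r) absolutely_integrable_on {s..T}"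
    by (rule abs_int_on_subinterval) (use assms(3) in auto)
  show "\<And>r. r \<in> {s..T} \<Longrightarrow> 0 \<le> C r + C' r" using assms unfolding nonneg_L1_def by auto
qed

context
  fixes T p s :: real and b :: "real \<Rightarrow> real^'d \<Rightarrow> real^'d" and C0 C1 :: "real \<Rightarrow> real"
    and g :: "real \<Rightarrow> real^'d"
  assumes b_meas: "velocity_measurable T b"
    and C0: "nonneg_L1 T C0" and C1: "nonneg_L1 T C1"
    and b_bounds: "one_sided_bounds T C0 C1 b"
    and p: "1 \<le> p" and s: "0 \<le> s" "s < T" and g: "continuous_on {0..T} g"
begin

text \<open>One pair of coefficients dominating the bounds of \<open>b\<close> and of the
  approximating fields. For existence the choice \<open>D0 = C0\<close> provides exactly the spare
  factor 2 consumed by mollification.\<close>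

lemma flow_setting_sum:
  assumes "nonneg_L1 T D0" "nonneg_L1 T D1"
  shows "flow_setting s T g (\<lambda>r. C0 r + D0 r) (\<lambda>r. C1 r + D1 r)"
  using abs_int_growth_sum[OF C0 assms(1) s(1)] abs_int_growth_sum[OF C1 assms(2) s(1)] s
  by unfold_locales (auto intro: continuous_on_subset[OF g])

lemma borel_version_b_exists: "\<exists>b' N. borel_version s T b b' N"
proof -
  obtain b' N where "borel_version 0 T b b' N"
    using borel_version_exists b_meas unfolding velocity_measurable_def by blast
  then show ?thesis using borel_version_mono s(1) by blast
qed

text \<open>Existence comes from the truncated mollifications of \<open>b\<close>. Any other flow
  starts, for almost every \<open>x\<close>, outside \<open>bad\<close> and therefore coincides with
  their limit.\<close>

lemma Lp_flow_exists_unique: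
  "\<exists>\<Phi>. Lp_flow s T p b g \<Phi> \<and> (\<forall>\<Psi>. Lp_flow s T p b g \<Psi> \<longrightarrow> (AE x in lebesgue. \<forall>t\<in>{s..T}. \<Psi> t x = \<Phi> t x))"
proof -
  obtain b' N where bv: "borel_version s T b b' N" using borel_version_b_exists by blast
  interpret FS: flow_setting s T g "\<lambda>r. C0 r + C0 r" "\<lambda>r. C1 r + C1 r"
    by (rule flow_setting_sum[OF C0 C1])
  interpret FV: flow_setting_vec s T g "\<lambda>r. C0 r + C0 r" "\<lambda>r. C1 r + C1 r" ..
  have half: "AE r in lebesgue. r \<in> {s..T} \<longrightarrow> (\<forall>x. norm (b r x) \<le> (C0 r + C0 r) / 2 * (1 + norm x))"
    using b_bounds s unfolding one_sided_bounds_def by (intro AE_I2) auto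
  have os: "AE r in lebesgue. r \<in> {s..T} \<longrightarrow> (\<forall>x y. - (C1 r + C1 r) * (norm (x - y))\<^sup>2 \<le> (b r x - b r y) \<bullet> (x - y))"
  proof (intro AE_I2 impI allI)
    fix r and x y :: "real^'d" assume r: "r \<in> {s..T}"
    have "- (C1 r + C1 r) * (norm (x - y))\<^sup>2 \<le> - C1 r * (norm (x - y))\<^sup>2"
      using C1 r s unfolding nonneg_L1_def by (intro mult_right_mono) auto
    also have "\<dots> \<le> (b r x - b r y) \<bullet> (x - y)"
      using b_bounds r s unfolding one_sided_bounds_def by auto
    finally show "- (C1 r + C1 r) * (norm (x - y))\<^sup>2 \<le> (b r x - b r y) \<bullet> (x - y)" .
  qed
  note H = half os bv
  interpret FL: flow_limit s T g "\<lambda>r. C0 r + C0 r" "\<lambda>r. C1 r + C1 r" "approx b'" b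
    by (rule FS.flow_limit_approx[OF H])
  have solv: "AE x in lborel. path_sol b g s T (\<lambda>t. FL.flim t x)"
  proof (rule FL.flim_solves[OF approx_measurable[OF borel_versionD(1)[OF bv]] bv])
    show "AE r in lebesgue. r \<in> {s..T} \<longrightarrow> negligible {z. \<not> isCont (b r) z} \<and>
       (\<forall>z y. isCont (b r) z \<longrightarrow> y \<longlonglongrightarrow> z \<longrightarrow> (\<lambda>n. approx b' n r (y n)) \<longlonglongrightarrow> b r z)"
      using FS.AE_regular[OF H]
      by (rule eventually_mono) (use FS.regular_isCont_ae[OF H] FS.approx_tendsto[OF H] in blast)
  qed
  have start: "FL.flim s x = x" for x
    unfolding FL.flim_def by (simp add: FL.flow_sol(2) limI)
  have solv': "AE x in lebesgue. path_sol b g s T (\<lambda>t. FL.flim t x) \<and> FL.flim s x = x"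
    unfolding AE_completion_iff using solv start by (auto elim!: eventually_mono)
  have m: "t \<in> {s..T} \<Longrightarrow> FL.flim t \<in> borel_measurable lebesgue" for t
    using measurable_completion[of "FL.flim t" lborel borel] FL.flim_measurable by simp
  have flow: "Lp_flow s T p b g FL.flim"
    unfolding Lp_flow_def
    using FV.flow_in_spaces[OF p m solv' FL.growth_b] solv' s by (simp add: solves_from_iff)
  moreover have "AE x in lebesgue. \<forall>t\<in>{s..T}. \<Psi> t x = FL.flim t x" if \<Psi>: "Lp_flow s T p b g \<Psi>" for \<Psi>
  proof -
    have "AE x in lebesgue. path_sol b g s T (\<lambda>t. \<Psi> t x) \<and> \<Psi> s x = x"
      using \<Psi> s unfolding Lp_flow_def by (simp add: solves_from_iff)
    moreover have "AE x in lebesgue. x \<notin> FL.bad"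
      using FL.negligible_bad by (simp add: AE_completion_iff AE_lborel_iff_negligible)
    ultimately show ?thesis
    proof eventually_elim
      case (elim x)
      then show ?case using FL.b_solution_eq_flim[of "\<lambda>t. \<Psi> t x"] by auto
    qed
  qed
  ultimately show ?thesis by blast
qed

section \<open>Regularized flows and their convergence\<close>

context
  fixes b\<epsilon> :: "real \<Rightarrow> real \<Rightarrow> real^'d \<Rightarrow> real^'d" and D0 D1 :: "real \<Rightarrow> real"
  assumes adm: "admissible_regularization T b b\<epsilon>"
    and D: "nonneg_L1 T D0" "nonneg_L1 T D1"
    and D_bounds: "\<And>\<epsilon>. 0 < \<epsilon> \<Longrightarrow> one_sided_bounds T D0 D1 (b\<epsilon> \<epsilon>)"
begin

interpretation FS: flow_setting s T g "\<lambda>r. C0 r + D0 r" "\<lambda>r. C1 r + D1 r"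
  by (rule flow_setting_sum[OF D])

interpretation FV: flow_setting_vec s T g "\<lambda>r. C0 r + D0 r" "\<lambda>r. C1 r + D1 r" ..

lemma growth_one_sided_of_bounds:
  assumes c: "one_sided_bounds T E0 E1 c" and le: "\<And>r. r \<in> {s..T} \<Longrightarrow> E0 r \<le> C0 r + D0 r"
    "\<And>r. r \<in> {s..T} \<Longrightarrow> E1 r \<le> C1 r + D1 r"
  shows "FS.growth c" "FS.one_sided R c"
proof -
  show "FS.growth c" unfolding FS.growth_def
  proof (intro AE_I2 impI allI)
    fix r x assume r: "r \<in> {s..T}"
    have "norm (c r x) \<le> E0 r * (1 + norm x)" using c r s unfolding one_sided_bounds_def by auto
    also have "\<dots> \<le> (C0 r + D0 r) * (1 + norm x)" using le(1)[OF r] by (intro mult_right_mono) auto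
    finally show "norm (c r x) \<le> (C0 r + D0 r) * (1 + norm x)" .
  qed
  show "FS.one_sided R c" unfolding FS.one_sided_def
  proof (intro AE_I2 impI ballI)
    fix r and x y :: "real^'d" assume r: "r \<in> {s..T}"
    have "- (C1 r + D1 r) * (norm (x - y))\<^sup>2 \<le> - E1 r * (norm (x - y))\<^sup>2" using le(2)[OF r] by (intro mult_right_mono) auto
    also have "\<dots> \<le> (c r x - c r y) \<bullet> (x - y)" using c r s unfolding one_sided_bounds_def by auto
    finally show "- (C1 r + D1 r) * (norm (x - y))\<^sup>2 \<le> (c r x - c r y) \<bullet> (x - y)" .
  qed
qed

lemma coefficients_nonneg: "r \<in> {s..T} \<Longrightarrow> 0 \<le> C0 r" "r \<in> {s..T} \<Longrightarrow> 0 \<le> C1 r" "r \<in> {s..T} \<Longrightarrow> 0 \<le> D0 r" "r \<in> {s..T} \<Longrightarrow> 0 \<le> D1 r"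
  using C0 C1 D s unfolding nonneg_L1_def by auto

lemma growth_one_sided_b: "FS.growth b" "FS.one_sided R b"
  using coefficients_nonneg by (auto intro!: growth_one_sided_of_bounds[OF b_bounds])

lemma regularization_field:
  assumes "0 < \<epsilon>"
  shows "FS.growth (b\<epsilon> \<epsilon>)" "FS.one_sided R (b\<epsilon> \<epsilon>)" "FS.lip_field (b\<epsilon> \<epsilon>)" "\<exists>f' N. borel_version s T (b\<epsilon> \<epsilon>) f' N"
proof -
  show "FS.growth (b\<epsilon> \<epsilon>)" "FS.one_sided R (b\<epsilon> \<epsilon>)"
    using coefficients_nonneg by (auto intro!: growth_one_sided_of_bounds[OF D_bounds[OF assms]])
  have "L1_Lipschitz T (b\<epsilon> \<epsilon>)" using adm assms unfolding admissible_regularization_def by blast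
  then obtain L where vm: "velocity_measurable T (b\<epsilon> \<epsilon>)" and L: "set_integrable lebesgue {0..T} L"
     "AE t in lebesgue. t \<in> {0..T} \<longrightarrow> lipschitz_on (L t) UNIV (b\<epsilon> \<epsilon> t)" unfolding L1_Lipschitz_def by blast
  obtain f' N where "borel_version 0 T (b\<epsilon> \<epsilon>) f' N"
    using borel_version_exists vm unfolding velocity_measurable_def by blast
  then have bv: "borel_version s T (b\<epsilon> \<epsilon>) f' N" using borel_version_mono s(1) by blast
  then show "\<exists>f' N. borel_version s T (b\<epsilon> \<epsilon>) f' N" by blast
  show "FS.lip_field (b\<epsilon> \<epsilon>)"
  proof (rule FS.lip_fieldI[OF _ _ bv])
    show "L absolutely_integrable_on {s..T}" using s by (intro abs_int_on_subinterval[OF L(1)]) auto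
    show "AE r in lebesgue. r \<in> {s..T} \<longrightarrow> lipschitz_on (L r) UNIV (b\<epsilon> \<epsilon> r)"
      by (rule eventually_mono[OF L(2)]) (use s in auto)
  qed
qed

lemma classical_flow_exists_unique:
  assumes "0 < \<epsilon>"
  shows "\<exists>\<Phi>. classical_flow s T (b\<epsilon> \<epsilon>) g \<Phi> \<and>
     (\<forall>\<Psi>. classical_flow s T (b\<epsilon> \<epsilon>) g \<Psi> \<longrightarrow> (\<forall>x. \<forall>t\<in>{s..T}. \<Psi> t x = \<Phi> t x))"
proof -
  have sin: "s \<in> {s..T}" using s by simp
  have "\<exists>X. path_sol (b\<epsilon> \<epsilon>) g s T X \<and> X s = x" for x
    using FS.sol_exists[OF regularization_field(3,1)[OF assms] sin] by blast
  then obtain X where X: "\<And>x. path_sol (b\<epsilon> \<epsilon>) g s T (X x)" "\<And>x. X x s = x" by metis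
  show ?thesis
  proof (intro exI[of _ "\<lambda>t x. X x t"] conjI allI impI ballI)
    show "classical_flow s T (b\<epsilon> \<epsilon>) g (\<lambda>t x. X x t)"
      using X s unfolding classical_flow_def by (simp add: solves_from_iff)
    fix \<Psi> x t assume "classical_flow s T (b\<epsilon> \<epsilon>) g \<Psi>" and t: "t \<in> {s..T}"
    then have \<Psi>: "path_sol (b\<epsilon> \<epsilon>) g s T (\<lambda>t. \<Psi> t x)" "\<Psi> s x = x"
      using s unfolding classical_flow_def by (auto simp: solves_from_iff)
    from FS.sol_unique[OF this(1) X(1) _ _ regularization_field(3)[OF assms] sin t] show "\<Psi> t x = X x t" using X(2) \<Psi>(2) by auto
  qed
qed

lemma classical_flow_measurable:
  assumes \<epsilon>: "0 < \<epsilon>" and \<Phi>: "classical_flow s T (b\<epsilon> \<epsilon>) g \<Phi>" and t: "t \<in> {s..T}"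
  shows "\<Phi> t \<in> borel_measurable lebesgue"
proof -
  have sin: "s \<in> {s..T}" using s by simp
  have sol: "path_sol (b\<epsilon> \<epsilon>) g s T (\<lambda>t. \<Phi> t x)" "\<Phi> s x = x" for x
    using \<Phi> s unfolding classical_flow_def by (auto simp: solves_from_iff)
  obtain L where L: "L absolutely_integrable_on {s..T}"
      "AE r in lebesgue. r \<in> {s..T} \<longrightarrow> lipschitz_on (L r) UNIV (b\<epsilon> \<epsilon> r)"
    using regularization_field(3)[OF \<epsilon>] unfolding FS.lip_field_def by blast
  have "lipschitz_on (exp (2 * integral {s..T} L)) UNIV (\<Phi> t)"
    unfolding lipschitz_on_def
    using FS.sol_lip_stable[OF sol(1) sol(1) _ _ L sin t] by (auto simp: sol(2) dist_norm mult.commute)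
  then have "continuous_on UNIV (\<Phi> t)" by (rule lipschitz_on_continuous_on)
  then show ?thesis using continuous_imp_measurable_on_sets_lebesgue[of UNIV "\<Phi> t"] by simp
qed

lemma flow_limit_regularization:
  assumes e: "\<And>n. 0 < e n" "e \<longlonglongrightarrow> 0"
  shows "flow_limit s T g (\<lambda>r. C0 r + D0 r) (\<lambda>r. C1 r + D1 r) (\<lambda>n. b\<epsilon> (e n)) b"
proof (intro flow_limit.intro flow_limit_axioms.intro)
  show "flow_setting s T g (\<lambda>r. C0 r + D0 r) (\<lambda>r. C1 r + D1 r)" by (rule FS.flow_setting_axioms)
  show "FS.lip_field (b\<epsilon> (e n))" "FS.growth (b\<epsilon> (e n))" for n
    using regularization_field(3,1)[OF e(1)] by blast+
  show "\<forall>\<^sub>F n in sequentially. FS.one_sided R (b\<epsilon> (e n))" for R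
    using regularization_field(2)[OF e(1)] by simp
  show "FS.growth b" "FS.one_sided R b" for R by (rule growth_one_sided_b)+
  obtain b' N where bv: "borel_version s T b b' N" using borel_version_b_exists by blast
  show "AE r in lebesgue. r \<in> {s..T} \<longrightarrow> b r \<in> borel_measurable lebesgue"
    by (rule FS.borel_version_sec_measurable[OF bv])
  show "\<exists>h. (\<forall>n. FS.field_dist R (b\<epsilon> (e n)) b (h n)) \<and> (\<lambda>n. integral {s..T} (h n)) \<longlonglongrightarrow> 0" for R
  proof -
    have "\<forall>n. \<exists>f' N. borel_version s T (b\<epsilon> (e n)) f' N" using regularization_field(4)[OF e(1)] by blast
    then obtain f' N' where fv: "\<And>n. borel_version s T (b\<epsilon> (e n)) (f' n) (N' n)" by metis
    show ?thesis
    proof (rule FS.field_dist_tendsto[OF regularization_field(1)[OF e(1)] growth_one_sided_b(1) fv bv])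
      have "AE q in lborel. fst q \<in> {0..T} \<longrightarrow> ((\<lambda>\<epsilon>. b\<epsilon> \<epsilon> (fst q) (snd q)) \<longlongrightarrow> b (fst q) (snd q)) (at_right 0)"
        using adm unfolding admissible_regularization_def by (simp add: AE_completion_iff case_prod_unfold)
      then have "AE q in lborel \<Otimes>\<^sub>M lborel. fst q \<in> {0..T} \<longrightarrow> ((\<lambda>\<epsilon>. b\<epsilon> \<epsilon> (fst q) (snd q)) \<longlongrightarrow> b (fst q) (snd q)) (at_right 0)"
        unfolding lborel_prod .
      \<comment> \<open>By Fubini, convergence almost everywhere in space-time becomes convergence
        almost everywhere in space at almost every time.\<close>
      from lborel_pair.AE_pair[OF this]
      have ae: "AE r in lborel. AE x in lborel. r \<in> {0..T} \<longrightarrow> ((\<lambda>\<epsilon>. b\<epsilon> \<epsilon> r x) \<longlongrightarrow> b r x) (at_right 0)" by simp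
      have elim: "filterlim e (at_right 0) sequentially"
        unfolding filterlim_at using e by (auto simp: less_imp_neq[THEN not_sym])
      show "AE r in lebesgue. r \<in> {s..T} \<longrightarrow> (AE x in lborel. (\<lambda>n. b\<epsilon> (e n) r x) \<longlonglongrightarrow> b r x)"
        unfolding AE_completion_iff using ae
      proof (rule eventually_mono, intro impI)
        fix r assume "AE x in lborel. r \<in> {0..T} \<longrightarrow> ((\<lambda>\<epsilon>. b\<epsilon> \<epsilon> r x) \<longlongrightarrow> b r x) (at_right 0)" "r \<in> {s..T}"
        then show "AE x in lborel. (\<lambda>n. b\<epsilon> (e n) r x) \<longlonglongrightarrow> b r x"
          using s by (elim eventually_mono) (auto intro: filterlim_compose[OF _ elim])
      qed
    qed
  qed
qed

text \<open>Convergence as \<open>\<epsilon>\<close> tends to zero is tested along sequences. Each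
  of them has its own null set \<open>FL.bad\<close> and its own limit, but almost everywhere that
  limit is \<open>\<Phi>\<close>, because \<open>\<Phi>\<close> solves the limit equation. Since a
  supremum of integrals is at most the integral of the supremum, one convergence implies the
  other.\<close>

lemma regularized_flows_converge:
  assumes \<Phi>: "Lp_flow s T p b g \<Phi>" and \<Phi>\<epsilon>: "\<And>\<epsilon>. 0 < \<epsilon> \<Longrightarrow> classical_flow s T (b\<epsilon> \<epsilon>) g (\<Phi>\<epsilon> \<epsilon>)"
  shows "tendsto_C_Lp_loc s T p \<Phi>\<epsilon> \<Phi> \<and> tendsto_Lp_loc_C s T p \<Phi>\<epsilon> \<Phi>"
proof -
  have sol: "AE x in lebesgue. path_sol b g s T (\<lambda>t. \<Phi> t x) \<and> \<Phi> s x = x"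
    using \<Phi> s unfolding Lp_flow_def by (simp add: solves_from_iff)
  have sol\<epsilon>: "path_sol (b\<epsilon> \<epsilon>) g s T (\<lambda>t. \<Phi>\<epsilon> \<epsilon> t x) \<and> \<Phi>\<epsilon> \<epsilon> s x = x" if "0 < \<epsilon>" for \<epsilon> x
    using \<Phi>\<epsilon>[OF that] s unfolding classical_flow_def by (simp add: solves_from_iff)
  have m: "\<Phi> t \<in> borel_measurable lebesgue" if "t \<in> {s..T}" for t
    using \<Phi> that unfolding Lp_flow_def Lp_loc_C_def by blast
  have spaces\<epsilon>: "\<Phi>\<epsilon> \<epsilon> \<in> C_Lp_loc s T p" "\<Phi>\<epsilon> \<epsilon> \<in> Lp_loc_C s T p" if "0 < \<epsilon>" for \<epsilon>
    using FV.flow_in_spaces[OF p classical_flow_measurable[OF that \<Phi>\<epsilon>[OF that]] _ regularization_field(1)[OF that]]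
      sol\<epsilon>[OF that] by auto
  have conv: "((\<lambda>\<epsilon>. \<integral>\<^sup>+x\<in>K. (SUP t\<in>{s..T}. ennreal (norm (\<Phi>\<epsilon> \<epsilon> t x - \<Phi> t x) powr p)) \<partial>lebesgue) \<longlongrightarrow> 0) (at_right 0)"
    if K: "compact K" for K
    unfolding tendsto_at_iff_sequentially
  proof (intro allI impI)
    fix e :: "nat \<Rightarrow> real" assume e: "\<forall>i. e i \<in> {0<..} - {0}" "e \<longlonglongrightarrow> 0"
    then have e0: "0 < e n" for n by auto
    interpret FL: flow_limit s T g "\<lambda>r. C0 r + D0 r" "\<lambda>r. C1 r + D1 r" "\<lambda>n. b\<epsilon> (e n)" b
      by (rule flow_limit_regularization[OF e0 e(2)])
    have eqn: "\<Phi>\<epsilon> (e n) t x = FL.flow n t x" if "t \<in> {s..T}" for n t x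
      using FL.flow_unique[of n "\<lambda>t. \<Phi>\<epsilon> (e n) t x" t] sol\<epsilon>[OF e0, of n x] that by auto
    have "AE x in lebesgue. x \<notin> FL.bad"
      using FL.negligible_bad by (simp add: AE_completion_iff AE_lborel_iff_negligible)
    with sol have unif: "AE x in lebesgue. uniform_limit {s..T} (\<lambda>n t. \<Phi>\<epsilon> (e n) t x) (\<lambda>t. \<Phi> t x) sequentially"
    proof eventually_elim
      case (elim x)
      have "\<Phi> t x = FL.flim t x" if "t \<in> {s..T}" for t
        using FL.b_solution_eq_flim[of "\<lambda>t. \<Phi> t x" t] elim that by auto
      then have "uniform_limit {s..T} (\<lambda>n t. \<Phi>\<epsilon> (e n) t x) (\<lambda>t. \<Phi> t x) sequentially \<longleftrightarrow>
          uniform_limit {s..T} (\<lambda>n t. FL.flow n t x) (\<lambda>t. FL.flim t x) sequentially"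
        by (intro uniform_limit_cong' eqn)
      then show ?case using FL.flow_uniform_limit[OF elim(2)] by blast
    qed
    have "(\<lambda>n. \<integral>\<^sup>+x\<in>K. (SUP t\<in>{s..T}. ennreal (norm (\<Phi>\<epsilon> (e n) t x - \<Phi> t x) powr p)) \<partial>lebesgue) \<longlonglongrightarrow> 0"
      by (rule FV.Lp_convergence[OF p m classical_flow_measurable[OF e0 \<Phi>\<epsilon>[OF e0]] sol growth_one_sided_b(1) _ regularization_field(1)[OF e0] unif K])
        (use sol\<epsilon>[OF e0] in auto)
    then show "((\<lambda>\<epsilon>. \<integral>\<^sup>+x\<in>K. (SUP t\<in>{s..T}. ennreal (norm (\<Phi>\<epsilon> \<epsilon> t x - \<Phi> t x) powr p)) \<partial>lebesgue) \<circ> e) \<longlonglongrightarrow> 0"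
      by (simp add: comp_def)
  qed
  have conv': "((\<lambda>\<epsilon>. SUP t\<in>{s..T}. \<integral>\<^sup>+x\<in>K. ennreal (norm (\<Phi>\<epsilon> \<epsilon> t x - \<Phi> t x) powr p) \<partial>lebesgue) \<longlongrightarrow> 0) (at_right 0)"
    if K: "compact K" for K
  proof (rule tendsto_sandwich[OF _ _ tendsto_const conv[OF K]])
    show "\<forall>\<^sub>F \<epsilon> in at_right 0. (SUP t\<in>{s..T}. \<integral>\<^sup>+x\<in>K. ennreal (norm (\<Phi>\<epsilon> \<epsilon> t x - \<Phi> t x) powr p) \<partial>lebesgue) \<le>
       (\<integral>\<^sup>+x\<in>K. (SUP t\<in>{s..T}. ennreal (norm (\<Phi>\<epsilon> \<epsilon> t x - \<Phi> t x) powr p)) \<partial>lebesgue)"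
      by (intro always_eventually allI SUP_least nn_integral_mono mult_right_mono SUP_upper) auto
  qed simp
  show ?thesis
    using \<Phi> spaces\<epsilon> conv conv' unfolding tendsto_C_Lp_loc_def tendsto_Lp_loc_C_def Lp_flow_def by blast
qed

end
end

theorem theorem4p13:
  fixes T p :: real
    and b :: "real \<Rightarrow> real^'d \<Rightarrow> real^'d"
    and C0 C1 :: "real \<Rightarrow> real"
    and \<sigma> :: "real \<Rightarrow> real^'m^'d"
    and M :: "'w measure"
    and W :: "real \<Rightarrow> 'w \<Rightarrow> real^'m"
    and I :: "real \<Rightarrow> 'w \<Rightarrow> real^'d"
  assumes "T > 0"
    and "velocity_measurable T b"
    and "nonneg_L1 T C0" and "nonneg_L1 T C1"
    and "one_sided_bounds T C0 C1 b"
    and "L2_matrix T \<sigma>"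
    and "prob_space M"
    and "standard_brownian_motion M T W"
    and "continuous_wiener_integral M T W \<sigma> I"
    and "1 \<le> p"
  shows "\<forall>s\<in>{0..<T}.
    (AE \<omega> in M. \<exists>\<Phi>. Lp_flow s T p b (\<lambda>t. I t \<omega>) \<Phi> \<and>
       (\<forall>\<Psi>. Lp_flow s T p b (\<lambda>t. I t \<omega>) \<Psi> \<longrightarrow>
          (AE x in lebesgue. \<forall>t\<in>{s..T}. \<Psi> t x = \<Phi> t x))) \<and>
    (\<forall>b\<epsilon>. admissible_regularization T b b\<epsilon> \<longrightarrow>
       (AE \<omega> in M.
          (\<forall>\<epsilon>>0. \<exists>\<Phi>. classical_flow s T (b\<epsilon> \<epsilon>) (\<lambda>t. I t \<omega>) \<Phi> \<and>
             (\<forall>\<Psi>. classical_flow s T (b\<epsilon> \<epsilon>) (\<lambda>t. I t \<omega>) \<Psi> \<longrightarrow>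
                (\<forall>x. \<forall>t\<in>{s..T}. \<Psi> t x = \<Phi> t x))) \<and>
          (\<forall>\<Phi> \<Phi>\<epsilon>. Lp_flow s T p b (\<lambda>t. I t \<omega>) \<Phi> \<and>
             (\<forall>\<epsilon>>0. classical_flow s T (b\<epsilon> \<epsilon>) (\<lambda>t. I t \<omega>) (\<Phi>\<epsilon> \<epsilon>)) \<longrightarrow>
             tendsto_C_Lp_loc s T p \<Phi>\<epsilon> \<Phi> \<and> tendsto_Lp_loc_C s T p \<Phi>\<epsilon> \<Phi>)))"
proof (intro ballI conjI allI impI)
  fix s assume "s \<in> {0..<T}"
  then have s: "0 \<le> s" "s < T" by auto
  have paths: "AE \<omega> in M. continuous_on {0..T} (\<lambda>t. I t \<omega>)"
    using assms(9) unfolding continuous_wiener_integral_def by blast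
  note data = assms(2-5,10) s
  show "AE \<omega> in M. \<exists>\<Phi>. Lp_flow s T p b (\<lambda>t. I t \<omega>) \<Phi> \<and>
       (\<forall>\<Psi>. Lp_flow s T p b (\<lambda>t. I t \<omega>) \<Psi> \<longrightarrow>
          (AE x in lebesgue. \<forall>t\<in>{s..T}. \<Psi> t x = \<Phi> t x))"
    using paths by (rule eventually_mono) (rule Lp_flow_exists_unique[OF data])
  fix b\<epsilon> assume adm: "admissible_regularization T b b\<epsilon>"
  then obtain D0 D1 where D: "nonneg_L1 T D0" "nonneg_L1 T D1"
    "\<And>\<epsilon>. 0 < \<epsilon> \<Longrightarrow> one_sided_bounds T D0 D1 (b\<epsilon> \<epsilon>)"
    unfolding admissible_regularization_def by blast
  show "AE \<omega> in M.
          (\<forall>\<epsilon>>0. \<exists>\<Phi>. classical_flow s T (b\<epsilon> \<epsilon>) (\<lambda>t. I t \<omega>) \<Phi> \<and>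
             (\<forall>\<Psi>. classical_flow s T (b\<epsilon> \<epsilon>) (\<lambda>t. I t \<omega>) \<Psi> \<longrightarrow>
                (\<forall>x. \<forall>t\<in>{s..T}. \<Psi> t x = \<Phi> t x))) \<and>
          (\<forall>\<Phi> \<Phi>\<epsilon>. Lp_flow s T p b (\<lambda>t. I t \<omega>) \<Phi> \<and>
             (\<forall>\<epsilon>>0. classical_flow s T (b\<epsilon> \<epsilon>) (\<lambda>t. I t \<omega>) (\<Phi>\<epsilon> \<epsilon>)) \<longrightarrow>
             tendsto_C_Lp_loc s T p \<Phi>\<epsilon> \<Phi> \<and> tendsto_Lp_loc_C s T p \<Phi>\<epsilon> \<Phi>)"
    using paths
  proof (rule eventually_mono)
    fix \<omega> assume g: "continuous_on {0..T} (\<lambda>t. I t \<omega>)"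
    show "(\<forall>\<epsilon>>0. \<exists>\<Phi>. classical_flow s T (b\<epsilon> \<epsilon>) (\<lambda>t. I t \<omega>) \<Phi> \<and>
             (\<forall>\<Psi>. classical_flow s T (b\<epsilon> \<epsilon>) (\<lambda>t. I t \<omega>) \<Psi> \<longrightarrow>
                (\<forall>x. \<forall>t\<in>{s..T}. \<Psi> t x = \<Phi> t x))) \<and>
          (\<forall>\<Phi> \<Phi>\<epsilon>. Lp_flow s T p b (\<lambda>t. I t \<omega>) \<Phi> \<and>
             (\<forall>\<epsilon>>0. classical_flow s T (b\<epsilon> \<epsilon>) (\<lambda>t. I t \<omega>) (\<Phi>\<epsilon> \<epsilon>)) \<longrightarrow>
             tendsto_C_Lp_loc s T p \<Phi>\<epsilon> \<Phi> \<and> tendsto_Lp_loc_C s T p \<Phi>\<epsilon> \<Phi>)"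
      using classical_flow_exists_unique[OF data g adm D] regularized_flows_converge[OF data g adm D] by blast
  qed
qed

end
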